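(* Let $\mathcal{P}=\langle X^\sigma\mid V_P\mid\mathcal{R}\rangle$ be a pregroup presentation, let $\Gamma$ be a loop-minimal coloured van Kampen diagram over $\mathcal{P}$ with cyclically $P$-reduced boundary word $w$ of length $n$, and let $r=\max\{|R|:R\in\mathcal{R}\}$. Then there exists a loop-minimal coloured diagram $\Delta$ with boundary word $w$ such that $$\mathrm{Area}(\Delta)\le(3+r)|F_G(\Delta)|+n-2.$$ If every vertex $v$ of $\Gamma$ satisfies $\delta_G(v,\Gamma)\ge1$ then $\Delta$ can be taken to be $\Gamma$.
   Context: A pregroup is a set $P$ with a distinguished element $1$, a partial multiplication $(x,y)\mapsto xy$ defined for $(x,y)\in D(P)\subseteq P\times P$, and an involution $x\mapsto x^\sigma$, such that for all $x,y,z,t\in P$: (P1) $(1,x),(x,1)\in D(P)$ and $1x=x1=x$; (P2) $(x,x^\sigma),(x^\sigma,x)\in D(P)$ and $xx^\sigma=x^\sigma x=1$; (P3) if $(x,y)\in D(P)$ then $(y^\sigma,x^\sigma)\in D(P)$ and $(xy)^\sigma=y^\sigma x^\sigma$; (P4) if $(x,y),(y,z)\in D(P)$ then $(xy,z)\in D(P)$ iff $(x,yz)\in D(P)$, in which case $(xy)z=x(yz)$; (P5) if $(x,y),(y,z),(z,t)\in D(P)$ then $(xy,z)\in D(P)$ or $(yz,t)\in D(P)$. Write $[xy]$ for a product evaluated in $P$. Put $X=P\setminus\{1\}$, $F(X^\sigma)=\langle X\mid xx^\sigma\ (x\in X)\rangle$, $V_P=\{xy[xy]^\sigma: x,y\in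 X,\ (x,y)\in D(P),\ x\ne y^\sigma\}$ and $U(P)=F(X^\sigma)/\langle\langle V_P\rangle\rangle$. A word over $X$ is $P$-reduced if it has length at most $1$ or no two consecutive letters form a pair in $D(P)$; it is cyclically $P$-reduced if it has length at most $1$, or it is $P$-reduced and (last letter, first letter) $\notin D(P)$. A pregroup presentation $\mathcal{P}=\langle X^\sigma\mid V_P\mid\mathcal{R}\rangle$ consists of a finite pregroup $P$ (with $X=P\setminus\{1\}$) and a finite set $\mathcal{R}$ of cyclically $P$-reduced words, none of the form $x^2$ with $x\in X$; it defines $G=U(P)/\langle\langle\mathcal{R}\rangle\rangle$. $\mathcal{R}^{\pm}=\mathcal{R}\cup\{R^{-1}:R\in\mathcal{R}\}$. A coloured diagram over $\mathcal{P}$ is a finite, simply connected planar van Kampen diagram with edge labels in $X$ (an edge read backwards has label $x^\sigma$), whose internal faces are labelled by elements of $V_P$ (coloured red; these are triangles) or of $\mathcal{R}^{\pm}$ (coloured green); the unique external face is green and its label is the boundary word. Incidences are counted with multiplicity. $F_G(\Gamma)$ is the set of internal green faces, $\mathrm{Area}(\Gamma)$ the total number of internal faces, and $\delta_G(v,\Gamma)$ the number of green faces (including the external one) incident with the vertex $v$. The coloured area $\mathrm{CArea}(\Gamma)$ is the pair (number of internal green faces, number of red triangles), and coloured areas are compared lexicographically. A $V^\sigma$-letter is an $x\in X$ such that $x^\sigma=x$ or $x$ occurs in an element of $V_P$. A coloured diagram $\Gamma$ over $\mathcal{P}$ is loop-minimal if every coloured diagram $\Delta$ over $\mathcal{P}$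 that contains a loop labelled by a $V^\sigma$-letter satisfies $\mathrm{CArea}(\Delta)\ge\mathrm{CArea}(\Gamma)$.
   Formalization: The boundary word is assumed to have length n ≥ 1; for n = 0 the only diagram is a single vertex, which is loop-minimal with area 0 and no internal green faces, so the stated bound would read 0 ≤ −2 and fail. *)

theory Defs
  imports Complex_Main "HOL-Library.Product_Lexorder" "HOL-Combinatorics.Orbits"
begin

section \<open>Pregroups and pregroup presentations\<close>

(* pmult is only meaningful on pairs in pdom. *)
record 'a pregroup =
  pset :: "'a set"
  pone :: 'a
  pdom :: "('a \<times> 'a) set"
  pmult :: "'a \<Rightarrow> 'a \<Rightarrow> 'a"
  pinv :: "'a \<Rightarrow> 'a"

definition is_pregroup :: "'a pregroup \<Rightarrow> bool" where
  "is_pregroup P \<longleftrightarrow>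
     (let C = pset P; e = pone P; D = pdom P; m = pmult P; s = pinv P in
       e \<in> C \<and> D \<subseteq> C \<times> C \<and>
       (\<forall>(x, y) \<in> D. m x y \<in> C) \<and>
       (\<forall>x \<in> C. s x \<in> C \<and> s (s x) = x) \<and>
       (\<forall>x \<in> C. (e, x) \<in> D \<and> (x, e) \<in> D \<and> m e x = x \<and> m x e = x) \<and>
       (\<forall>x \<in> C. (x, s x) \<in> D \<and> (s x, x) \<in> D \<and> m x (s x) = e \<and> m (s x) x = e) \<and>
       (\<forall>(x, y) \<in> D. (s y, s x) \<in> D \<and> s (m x y) = m (s y) (s x)) \<and>
       (\<forall>x y z. (x, y) \<in> D \<and> (y, z) \<in> D \<longrightarrow>
          ((m x y, z) \<in> D \<longleftrightarrow> (x, m y z) \<in> D) \<and>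
          ((m x y, z) \<in> D \<longrightarrow> m (m x y) z = m x (m y z))) \<and>
       (\<forall>x y z t. (x, y) \<in> D \<and> (y, z) \<in> D \<and> (z, t) \<in> D \<longrightarrow>
          (m x y, z) \<in> D \<or> (m y z, t) \<in> D))"

definition letters :: "'a pregroup \<Rightarrow> 'a set" where
  "letters P = pset P - {pone P}"

definition inv_word :: "'a pregroup \<Rightarrow> 'a list \<Rightarrow> 'a list" where
  "inv_word P w = rev (map (pinv P) w)"

definition V_relators :: "'a pregroup \<Rightarrow> 'a list set" where
  "V_relators P = {[x, y, pinv P (pmult P x y)] | x y.
     x \<in> letters P \<and> y \<in> letters P \<and> (x, y) \<in> pdom P \<and> x \<noteq> pinv P y}"

definition P_reduced :: "'a pregroup \<Rightarrow> 'a list \<Rightarrow> bool" where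
  "P_reduced P w \<longleftrightarrow> set w \<subseteq> letters P \<and>
     (\<forall>i. Suc i < length w \<longrightarrow> (w ! i, w ! Suc i) \<notin> pdom P)"

definition cyclically_P_reduced :: "'a pregroup \<Rightarrow> 'a list \<Rightarrow> bool" where
  "cyclically_P_reduced P w \<longleftrightarrow> P_reduced P w \<and>
     (length w \<le> 1 \<or> (last w, hd w) \<notin> pdom P)"

definition pregroup_presentation :: "'a pregroup \<Rightarrow> 'a list set \<Rightarrow> bool" where
  "pregroup_presentation P \<R> \<longleftrightarrow>
     is_pregroup P \<and> finite (pset P) \<and> finite \<R> \<and>
     (\<forall>w \<in> \<R>. cyclically_P_reduced P w) \<and>
     (\<forall>x \<in> letters P. [x, x] \<notin> \<R>)"

definition sym_relators :: "'a pregroup \<Rightarrow> 'a list set \<Rightarrow> 'a list set" where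
  "sym_relators P \<R> = \<R> \<union> inv_word P ` \<R>"

definition V_letter :: "'a pregroup \<Rightarrow> 'a \<Rightarrow> bool" where
  "V_letter P x \<longleftrightarrow> x \<in> letters P \<and>
     (pinv P x = x \<or> (\<exists>v \<in> V_relators P. x \<in> set v))"


section \<open>Planar diagrams\<close>

text \<open>
  A finite simply connected planar diagram is a connected plane graph together with all its
  bounded faces, i.e. a finite connected cell decomposition of the sphere with one distinguished
  (external) face. It is encoded as a combinatorial map. The elements of \<open>darts\<close> are the directed
  edges; \<open>opp\<close> reverses a directed edge; \<open>nxt d\<close> follows \<open>d\<close> on the boundary of the face lying to
  a fixed side of \<open>d\<close>. Hence the faces are the orbits of \<open>nxt\<close>, and the darts leaving a vertex
  form an orbit of \<open>nxt \<circ> opp\<close>. Since all objects are finite, naming vertices and darts by natural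
  numbers loses no isomorphism type.

  The diagram consisting of a single vertex is included: it has no darts, and its only (external)
  face, whose boundary is trivial, is represented by \<open>outer = {}\<close>.
\<close>

record 'a diagram =
  verts :: "nat set"
  darts :: "nat set"
  src :: "nat \<Rightarrow> nat"
  opp :: "nat \<Rightarrow> nat"
  nxt :: "nat \<Rightarrow> nat"
  outer :: "nat set"
  lab :: "nat \<Rightarrow> 'a"

definition edges :: "'a diagram \<Rightarrow> nat set set" where
  "edges \<Gamma> = {{d, opp \<Gamma> d} | d. d \<in> darts \<Gamma>}"

definition internal_faces :: "'a diagram \<Rightarrow> nat set set" where
  "internal_faces \<Gamma> = orbit (nxt \<Gamma>) ` darts \<Gamma> - {outer \<Gamma>}"

text \<open>
  The last conjunct is Euler's formula on the sphere, which for a connected combinatorial map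
  expresses planarity (genus 0); the external face is the summand 1 on the left.
\<close>
definition planar_diagram :: "'a diagram \<Rightarrow> bool" where
  "planar_diagram \<Gamma> \<longleftrightarrow>
     finite (verts \<Gamma>) \<and> verts \<Gamma> \<noteq> {} \<and> finite (darts \<Gamma>) \<and>
     opp \<Gamma> permutes darts \<Gamma> \<and>
     (\<forall>d \<in> darts \<Gamma>. opp \<Gamma> d \<noteq> d \<and> opp \<Gamma> (opp \<Gamma> d) = d) \<and>
     nxt \<Gamma> permutes darts \<Gamma> \<and>
     (\<forall>d \<in> darts \<Gamma>. src \<Gamma> d \<in> verts \<Gamma>) \<and>
     (\<forall>d \<in> darts \<Gamma>. \<forall>e \<in> darts \<Gamma>.
        src \<Gamma> d = src \<Gamma> e \<longleftrightarrow> e \<in> orbit (nxt \<Gamma> \<circ> opp \<Gamma>) d) \<and>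
     (if darts \<Gamma> = {} then outer \<Gamma> = {} else outer \<Gamma> \<in> orbit (nxt \<Gamma>) ` darts \<Gamma>) \<and>
     (\<forall>u \<in> verts \<Gamma>. \<forall>v \<in> verts \<Gamma>.
        (u, v) \<in> {(src \<Gamma> d, src \<Gamma> (opp \<Gamma> d)) | d. d \<in> darts \<Gamma>}\<^sup>*) \<and>
     card (verts \<Gamma>) + (card (internal_faces \<Gamma>) + 1) = card (edges \<Gamma>) + 2"

text \<open>The label of the face containing the dart \<open>d\<close>, read once around starting at \<open>d\<close>.\<close>
definition face_word :: "'a diagram \<Rightarrow> nat \<Rightarrow> 'a list" where
  "face_word \<Gamma> d = map (\<lambda>k. lab \<Gamma> ((nxt \<Gamma> ^^ k) d)) [0..<card (orbit (nxt \<Gamma>) d)]"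

definition red_faces :: "'a pregroup \<Rightarrow> 'a diagram \<Rightarrow> nat set set" where
  "red_faces P \<Gamma> = {f \<in> internal_faces \<Gamma>. \<exists>d \<in> f. face_word \<Gamma> d \<in> V_relators P}"

text \<open>The internal green faces; the external face, which is also green, is not included.\<close>
definition green_faces :: "'a pregroup \<Rightarrow> 'a list set \<Rightarrow> 'a diagram \<Rightarrow> nat set set" where
  "green_faces P \<R> \<Gamma> =
     {f \<in> internal_faces \<Gamma>. \<exists>d \<in> f. face_word \<Gamma> d \<in> sym_relators P \<R>}"

text \<open>
  The colour of a face is determined by its label: two cyclically consecutive letters of a word
  in \<open>V_relators P\<close> are always in \<open>pdom P\<close>, whereas this never happens in a word of length 3
  in \<open>sym_relators P \<R>\<close>.
\<close>
definition coloured_diagram :: "'a pregroup \<Rightarrow> 'a list set \<Rightarrow> 'a diagram \<Rightarrow> bool" where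
  "coloured_diagram P \<R> \<Gamma> \<longleftrightarrow> planar_diagram \<Gamma> \<and>
     (\<forall>d \<in> darts \<Gamma>. lab \<Gamma> d \<in> letters P \<and> lab \<Gamma> (opp \<Gamma> d) = pinv P (lab \<Gamma> d)) \<and>
     internal_faces \<Gamma> = red_faces P \<Gamma> \<union> green_faces P \<R> \<Gamma>"

text \<open>
  All orbits of \<open>nxt\<close>, including \<open>outer\<close>, are traversed with the face on the same side. Going
  around the whole diagram in the sense in which the internal faces are traversed therefore means
  following \<open>outer\<close> backwards. For instance, a diagram with a single internal face labelled \<open>R\<close>
  and bounded by a simple closed path has boundary word \<open>R\<close>.
\<close>
definition boundary_word :: "'a pregroup \<Rightarrow> 'a diagram \<Rightarrow> 'a list \<Rightarrow> bool" where
  "boundary_word P \<Gamma> w \<longleftrightarrow>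
     (if darts \<Gamma> = {} then w = []
      else \<exists>d \<in> outer \<Gamma>. w = inv_word P (face_word \<Gamma> d))"

definition Area :: "'a diagram \<Rightarrow> nat" where
  "Area \<Gamma> = card (internal_faces \<Gamma>)"

text \<open>Pairs are compared lexicographically, by the instance in \<open>Product_Lexorder\<close>.\<close>
definition CArea :: "'a pregroup \<Rightarrow> 'a list set \<Rightarrow> 'a diagram \<Rightarrow> nat \<times> nat" where
  "CArea P \<R> \<Gamma> = (card (green_faces P \<R> \<Gamma>), card (red_faces P \<Gamma>))"

text \<open>
  Incidences of faces with \<open>v\<close>, counted with multiplicity, correspond to the darts leaving \<open>v\<close>.
  The exception is the single vertex diagram, where the external face is incident once with the
  vertex although there are no darts.
\<close>
definition delta_G :: "'a pregroup \<Rightarrow> 'a list set \<Rightarrow> nat \<Rightarrow> 'a diagram \<Rightarrow> nat" where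
  "delta_G P \<R> v \<Gamma> =
     (if darts \<Gamma> = {} then 1
      else card {d \<in> darts \<Gamma>. src \<Gamma> d = v \<and>
                   orbit (nxt \<Gamma>) d \<in> insert (outer \<Gamma>) (green_faces P \<R> \<Gamma>)})"

definition has_V_loop :: "'a pregroup \<Rightarrow> 'a diagram \<Rightarrow> bool" where
  "has_V_loop P \<Gamma> \<longleftrightarrow>
     (\<exists>d \<in> darts \<Gamma>. src \<Gamma> (opp \<Gamma> d) = src \<Gamma> d \<and> V_letter P (lab \<Gamma> d))"

definition loop_minimal :: "'a pregroup \<Rightarrow> 'a list set \<Rightarrow> 'a diagram \<Rightarrow> bool" where
  "loop_minimal P \<R> \<Gamma> \<longleftrightarrow> coloured_diagram P \<R> \<Gamma> \<and>
     (\<forall>\<Delta>. coloured_diagram P \<R> \<Delta> \<and> has_V_loop P \<Delta> \<longrightarrow> CArea P \<R> \<Gamma> \<le> CArea P \<R> \<Delta>)"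

end

(*
An interior vertex with no green face is the centre of a star of red triangles. No edge of the star
is a loop: cutting the sphere along such a loop and keeping the side without the external face would
give a diagram of smaller coloured area containing a loop labelled by a V-letter. Axiom (P5) makes
the product of the labels of two consecutive rim edges defined. If the product is 1, the two
triangles cancel; otherwise their common spoke can be flipped into the other diagonal, which lowers
the degree of the centre. Hence a loop-minimal diagram of least coloured area for w has a green
incidence at every vertex, and then Euler's formula gives the bound.

Planarity is tracked by the genus defect of a pair of permutations, which is nonnegative and does
not increase under multiplication by a transposition (x y) if x, y lie in one face, in one vertex,
or in different components.
*)
theory Submission
  imports Defs
begin

section \<open>The genus defect of a pair of permutations\<close>

text \<open>For permutations \<open>f\<close>, \<open>g\<close> of \<open>D\<close>, write z for the
  number of cycles and c for the number of joint components. Then |D| + 2c - z(f) - z(g) - z(f g) is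
  twice the total genus (Riemann-Hurwitz); for a fixed-point-free involution \<open>g\<close> it is
  E + 2c - F - V. Surgery takes place on maps that may be disconnected, since cutting and cancelling
  break a sphere into several; a diagram is recovered as the component of a chosen dart.
  Nonnegativity of the defect does the work of the Jordan curve theorem: a transposition that splits
  both an edge cycle and a vertex cycle of a map of defect 0 would lead to defect -2 unless it also
  disconnects the map. A flip need not lower the coloured area, it only cannot raise it. What
  decreases is the degree of the centre, and loop-minimality passes to the flipped diagram, so loops
  can be excluded again at every stage. The descent ends in a cancellation at degree 2 at the
  latest, because there the two rim labels are inverse to each other.\<close>

definition conn :: "('d \<Rightarrow> 'd) set \<Rightarrow> ('d \<times> 'd) set" where
  "conn F = (\<Union>f\<in>F. {(x, f x) |x. True} \<union> {(f x, x) |x. True})\<^sup>*"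

definition ncls :: "('d \<Rightarrow> 'd) set \<Rightarrow> 'd set \<Rightarrow> nat" where
  "ncls F D = card ((\<lambda>d. conn F `` {d}) ` D)"

lemma conn_refl [simp]: "(x, x) \<in> conn F"
  by (simp add: conn_def)

lemma conn_trans: "(x, y) \<in> conn F \<Longrightarrow> (y, z) \<in> conn F \<Longrightarrow> (x, z) \<in> conn F"
  unfolding conn_def by (rule rtrancl_trans)

lemma conn_sym: "(x, y) \<in> conn F \<Longrightarrow> (y, x) \<in> conn F"
proof -
  have "sym (\<Union>f\<in>F. {(x, f x) |x. True} \<union> {(f x, x) |x. True})"
    by (auto simp: sym_def)
  then show "(x, y) \<in> conn F \<Longrightarrow> (y, x) \<in> conn F"
    unfolding conn_def by (meson sym_rtrancl symD)
qed

lemma conn_step: "f \<in> F \<Longrightarrow> (x, f x) \<in> conn F"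
  unfolding conn_def by (rule r_into_rtrancl) auto

lemma conn_step_rev: "f \<in> F \<Longrightarrow> (f x, x) \<in> conn F"
  by (simp add: conn_step conn_sym)

text \<open>Replaces induction on paths: non-connectedness and closure of sets are later shown by
  choosing a predicate that every generator preserves in both directions.\<close>

lemma conn_invariant:
  assumes "(x, y) \<in> conn F" and "\<And>f z. f \<in> F \<Longrightarrow> P (f z) \<longleftrightarrow> P z"
  shows "P x \<longleftrightarrow> P y"
  using assms(1) unfolding conn_def
  by (induction rule: rtrancl_induct) (use assms(2) in auto)

lemma conn_subset:
  assumes "(x, y) \<in> conn F" and "\<And>f z. f \<in> F \<Longrightarrow> (z, f z) \<in> conn G"
  shows "(x, y) \<in> conn G"
proof -
  have "(x, x) \<in> conn G \<longleftrightarrow> (x, y) \<in> conn G"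
    using assms(1)
    by (rule conn_invariant[where P = "\<lambda>v. (x, v) \<in> conn G"])
      (blast intro: conn_trans assms(2) conn_sym)
  then show ?thesis by simp
qed

lemma conn_mono: "F \<subseteq> G \<Longrightarrow> (x, y) \<in> conn F \<Longrightarrow> (x, y) \<in> conn G"
  by (erule conn_subset) (auto intro: conn_step)

lemma conn_class_eq_iff: "conn F `` {x} = conn F `` {y} \<longleftrightarrow> (x, y) \<in> conn F"
  by (auto intro: conn_trans conn_sym)

lemma conn_class_function: "\<exists>c :: 'd \<Rightarrow> 'd set. \<forall>x y. (x, y) \<in> conn F \<longleftrightarrow> c x = c y"
  by (intro exI[of _ "\<lambda>x. conn F `` {x}"]) (simp add: conn_class_eq_iff)

lemma conn_eq:
  assumes "\<And>f z. f \<in> F \<Longrightarrow> (z, f z) \<in> conn G" and "\<And>f z. f \<in> G \<Longrightarrow> (z, f z) \<in> conn F"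
  shows "conn F = conn G"
  using assms by (auto intro: conn_subset)

text \<open>A transposition moves only \<open>x\<close> and \<open>y\<close>, so as a generator it
  adds the single link between them. The right-hand side, as a predicate of \<open>v\<close>, is
  invariant under all generators.\<close>

lemma conn_insert_transpose:
  "(u, v) \<in> conn (insert (transpose x y) F) \<longleftrightarrow>
     (u, v) \<in> conn F \<or> (u, x) \<in> conn F \<and> (y, v) \<in> conn F \<or> (u, y) \<in> conn F \<and> (x, v) \<in> conn F"
    (is "?L \<longleftrightarrow> ?R v")
proof
  assume ?L
  then have "?R u \<longleftrightarrow> ?R v"
  proof (rule conn_invariant[where P = ?R])
    fix f z assume "f \<in> insert (transpose x y) F"
    then consider "f = transpose x y" | "f \<in> F" by blast
    then show "?R (f z) \<longleftrightarrow> ?R z"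
    proof cases
      case 1
      then show ?thesis
        by (cases "z = x"; cases "z = y") (auto intro: conn_sym conn_trans)
    next
      case 2
      then show ?thesis using conn_step conn_step_rev conn_trans by metis
    qed
  qed
  then show "?R v" by simp
next
  have *: "(x, y) \<in> conn (insert (transpose x y) F)"
    using conn_step[of "transpose x y" _ x] by simp
  have "(a, b) \<in> conn F \<Longrightarrow> (a, b) \<in> conn (insert (transpose x y) F)" for a b
    by (rule conn_mono[of F]) auto
  then show "?R v \<Longrightarrow> ?L"
    using * conn_sym conn_trans by metis
qed

lemma ncls_insert_transpose:
  fixes F :: "('d \<Rightarrow> 'd) set"
  assumes "finite D" "x \<in> D" "y \<in> D"
  shows "ncls F D = ncls (insert (transpose x y) F) D + (if (x, y) \<in> conn F then 0 else 1)"
proof -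
  \<comment> \<open>Turning connectivity into equality of values of \<open>c\<close> makes the old
    and the merged classes explicit preimages.\<close>
  obtain c :: "'d \<Rightarrow> 'd set" where "\<forall>u v. (u, v) \<in> conn F \<longleftrightarrow> c u = c v"
    by (rule exE[OF conn_class_function[of F]])
  then have c: "(u, v) \<in> conn F \<longleftrightarrow> c u = c v" for u v
    by simp
  have cls: "conn F `` {d} = {v. c v = c d}" for d
    unfolding Image_singleton c by auto
  have cls': "conn (insert (transpose x y) F) `` {d} =
    (if c d = c x \<or> c d = c y then {v. c v = c x \<or> c v = c y} else {v. c v = c d})" for d
    unfolding Image_singleton conn_insert_transpose c by auto
  show ?thesis
  proof (cases "c x = c y")
    case True
    have "conn (insert (transpose x y) F) `` {d} = conn F `` {d}" for d
      unfolding cls' cls using True by auto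
    then show ?thesis using True by (simp add: ncls_def c)
  next
    case False
    define k k' where "k = (\<lambda>d. {v. c v = c d})" 
      and "k' = (\<lambda>d. if c d = c x \<or> c d = c y then {v. c v = c x \<or> c v = c y} else {v. c v = c d})"
    let ?U = "{v. c v = c x \<or> c v = c y}"
    have k: "k d = k e \<longleftrightarrow> c d = c e" for d e
      unfolding k_def by auto
    have notin: "?U \<noteq> k d" for d
    proof
      assume "?U = k d"
      then have "x \<in> k d" "y \<in> k d" by auto
      then show False using False by (simp add: k_def)
    qed
    have k': "k' d = (if k d = k x \<or> k d = k y then ?U else k d)" for d
      unfolding k by (simp add: k_def k'_def)
    have img: "k' ` D = insert ?U (k ` D - {k x, k y})"
    proof
      show "k' ` D \<subseteq> insert ?U (k ` D - {k x, k y})"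
        by (auto simp: k')
      have "k d \<in> k' ` D" if "d \<in> D" "k d \<noteq> k x" "k d \<noteq> k y" for d
        using that by (intro image_eqI[of _ _ d]) (simp_all add: k')
      moreover have "?U \<in> k' ` D"
        using assms(2) by (intro image_eqI[of _ _ x]) (simp_all add: k')
      ultimately show "insert ?U (k ` D - {k x, k y}) \<subseteq> k' ` D"
        by blast
    qed
    have ne: "k x \<noteq> k y" using False k by simp
    have "card (k' ` D) = Suc (card (k ` D - {k x, k y}))"
    proof -
      have "?U \<notin> k ` D - {k x, k y}" using notin by blast
      then show ?thesis unfolding img using assms(1) by simp
    qed
    also have "card (k ` D - {k x, k y}) = card (k ` D) - card {k x, k y}"
      using assms by (intro card_Diff_subset) simp_all
    finally have "card (k' ` D) = Suc (card (k ` D) - 2)" using ne by simp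
    moreover have "card {k x, k y} \<le> card (k ` D)"
      using assms by (intro card_mono) simp_all
    ultimately show ?thesis
      using False ne unfolding ncls_def cls cls' c k_def [symmetric] k'_def [symmetric] by simp
  qed
qed

text \<open>With the transposition available as a generator, \<open>f\<close> and
  \<open>transpose x y \<circ> f\<close> are recovered from each other. Class numbers before and
  after a multiplication can thus be compared with a common third number.\<close>

lemma conn_swap_transpose:
  "conn (insert (transpose x y) (insert (transpose x y \<circ> f) G)) =
   conn (insert (transpose x y) (insert f G))"
proof (rule conn_eq)
  fix g z assume "g \<in> insert (transpose x y) (insert (transpose x y \<circ> f) G)"
  moreover have "(z, (transpose x y \<circ> f) z) \<in> conn (insert (transpose x y) (insert f G))"
    unfolding comp_apply by (rule conn_trans[OF conn_step[of f] conn_step[of "transpose x y"]]) simp_all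
  ultimately show "(z, g z) \<in> conn (insert (transpose x y) (insert f G))"
    by (auto intro: conn_step)
next
  fix g z assume "g \<in> insert (transpose x y) (insert f G)"
  moreover have "(z, f z) \<in> conn (insert (transpose x y) (insert (transpose x y \<circ> f) G))"
    using conn_trans[OF conn_step[of "transpose x y \<circ> f" _ z] conn_step[of "transpose x y" _ "(transpose x y \<circ> f) z"]]
    by simp
  ultimately show "(z, g z) \<in> conn (insert (transpose x y) (insert (transpose x y \<circ> f) G))"
    by (auto intro: conn_step)
qed

section \<open>Cycles of a permutation multiplied by a transposition\<close>

lemma self_in_orbit:
  assumes "finite D" "f permutes D"
  shows "x \<in> orbit f x"
proof (rule permutation_self_in_orbit)
  show "permutation f" unfolding permutation_permutes using assms by (intro exI[of _ D] conjI)
qed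

lemma conn_singleton:
  assumes "finite D" "f permutes D"
  shows "(x, y) \<in> conn {f} \<longleftrightarrow> y \<in> orbit f x"
proof
  assume "(x, y) \<in> conn {f}"
  then have "x \<in> orbit f x \<longleftrightarrow> y \<in> orbit f x"
  proof (rule conn_invariant[where P = "\<lambda>v. v \<in> orbit f x"])
    fix g z assume "g \<in> {f}"
    then show "g z \<in> orbit f x \<longleftrightarrow> z \<in> orbit f x"
      using cyclic_on_f_in[OF assms(2) cyclic_on_orbit[OF assms(2,1)]] orbit.step[of z f x] by auto
  qed
  moreover have "x \<in> orbit f x"
    using assms by (rule self_in_orbit)
  ultimately show "y \<in> orbit f x" by simp
next
  assume "y \<in> orbit f x"
  then show "(x, y) \<in> conn {f}"
  proof induction
    case base then show ?case by (rule conn_step) simp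
  next
    case (step y) show ?case by (rule conn_trans[OF step(2)]) (rule conn_step, simp)
  qed
qed

lemma conn_class_singleton:
  "finite D \<Longrightarrow> f permutes D \<Longrightarrow> conn {f} `` {x} = orbit f x"
  by (auto simp: conn_singleton)

text \<open>If \<open>y\<close> is first reached after \<open>k\<close> steps, the arc of the
  iterates below \<open>k\<close> closes up under the product: the step that would reach
  \<open>y\<close> is redirected to \<open>x\<close>. The point \<open>y\<close> is not on that
  arc.\<close>

lemma orbit_transpose_split:
  assumes "x \<noteq> y" and y: "y \<in> orbit f x"
  shows "y \<notin> orbit (transpose x y \<circ> f) x"
proof -
  define k where "k = funpow_dist1 f x y"
  have k: "(f ^^ k) x = y" "0 < k"
    using funpow_dist1_prop[OF y] by (simp_all add: k_def)
  have least: "(f ^^ i) x \<noteq> y" if "i < k" for i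
  proof (cases "i = 0")
    case True then show ?thesis using assms(1) by simp
  next
    case False then show ?thesis using that funpow_dist1_least[of i f x y] unfolding k_def by simp
  qed
  \<comment> \<open>An earlier return to \<open>x\<close> would make the iterates periodic, and
    \<open>y\<close> would occur before step \<open>k\<close>.\<close>
  have nox: "(f ^^ i) x \<noteq> x" if "0 < i" "i < k" for i
  proof
    assume "(f ^^ i) x = x"
    then have "(f ^^ (k mod i)) x = y"
      using k(1) by (simp add: funpow_mod_eq)
    moreover have "k mod i < k" using that mod_less_divisor[of i k] by linarith
    ultimately show False using least by simp
  qed
  let ?A = "(\<lambda>i. (f ^^ i) x) ` {..<k}"
  have step: "(transpose x y \<circ> f) ((f ^^ i) x) \<in> ?A" if "i < k" for i
  proof (cases "Suc i = k")
    case True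
    then have "f ((f ^^ i) x) = y" using k(1) by auto
    then show ?thesis using k(2) by (intro image_eqI[of _ _ 0]) simp_all
  next
    case False
    then have "Suc i < k" using that by simp
    then have "f ((f ^^ i) x) \<noteq> y" "f ((f ^^ i) x) \<noteq> x"
      using least[of "Suc i"] nox[of "Suc i"] by simp_all
    then show ?thesis using \<open>Suc i < k\<close> by (intro image_eqI[of _ _ "Suc i"]) simp_all
  qed
  have "z \<in> ?A" if "z \<in> orbit (transpose x y \<circ> f) x" for z
    using that
  proof induction
    case base show ?case using step[of 0] k(2) by simp
  next
    case (step z)
    from step(2) obtain i where "z = (f ^^ i) x" "i < k" by auto
    then show ?case using \<open>\<And>i. i < k \<Longrightarrow> (transpose x y \<circ> f) ((f ^^ i) x) \<in> ?A\<close> by simp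
  qed
  then show ?thesis using least by fastforce
qed

text \<open>The product follows the \<open>f\<close>-cycle of \<open>x\<close> until this is about
  to close; the step that would return to \<open>x\<close> goes to \<open>y\<close> instead.\<close>

lemma orbit_transpose_merge:
  assumes f: "finite D" "f permutes D" and y: "y \<notin> orbit f x"
  shows "y \<in> orbit (transpose x y \<circ> f) x"
proof -
  have x: "x \<in> orbit f x"
    using f by (rule self_in_orbit)
  define k where "k = funpow_dist1 f x x"
  have k: "(f ^^ k) x = x" "0 < k"
    using funpow_dist1_prop[OF x] by (simp_all add: k_def)
  have least: "(f ^^ i) x \<noteq> x" if "0 < i" "i < k" for i
    using that funpow_dist1_least[of i f x x] unfolding k_def by simp
  have noy: "(f ^^ i) x \<noteq> y" for i
    using y funpow_in_orbit[OF x, of i] by auto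
  have "((transpose x y \<circ> f) ^^ i) x = (f ^^ i) x" if "i < k" for i
    using that
  proof (induction i)
    case (Suc i)
    have "f ((f ^^ i) x) \<noteq> x" "f ((f ^^ i) x) \<noteq> y"
      using least[of "Suc i"] noy[of "Suc i"] Suc.prems by auto
    then show ?case using Suc by simp
  qed simp
  then have eq: "((transpose x y \<circ> f) ^^ (k - 1)) x = (f ^^ (k - 1)) x"
    using k by simp
  have "f ((f ^^ (k - 1)) x) = x"
  proof -
    have "(f ^^ Suc (k - 1)) x = x" using k by simp
    then show ?thesis unfolding funpow.simps by simp
  qed
  then have "((transpose x y \<circ> f) ^^ Suc (k - 1)) x = y"
    unfolding funpow.simps comp_apply eq by simp
  then show ?thesis
    unfolding orbit_altdef by (intro CollectI exI[of _ "Suc (k - 1)"]) simp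
qed

lemma permutes_transpose_comp:
  "f permutes D \<Longrightarrow> x \<in> D \<Longrightarrow> y \<in> D \<Longrightarrow> transpose x y \<circ> f permutes D"
  by (simp add: permutes_compose permutes_swap_id)

lemma conn_transpose_comp:
  assumes "finite D" "f permutes D" and "x \<in> D" "y \<in> D" "x \<noteq> y"
  shows "(x, y) \<in> conn {transpose x y \<circ> f} \<longleftrightarrow> (x, y) \<notin> conn {f}"
  using orbit_transpose_merge[OF assms(1,2), of y x] orbit_transpose_split[OF assms(5), of f]
  unfolding conn_singleton[OF assms(1,2)]
    conn_singleton[OF assms(1) permutes_transpose_comp[OF assms(2,3,4)]] by blast

text \<open>Both sides are the number of classes after the transposition has been added as a
  generator. Taking \<open>G\<close> empty counts cycles, taking \<open>G\<close> to be
  \<open>{g}\<close> counts components.\<close>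

lemma ncls_transpose_comp:
  assumes "finite D" "x \<in> D" "y \<in> D"
  shows "int (ncls (insert (transpose x y \<circ> f) G) D) - of_bool ((x, y) \<notin> conn (insert (transpose x y \<circ> f) G))
       = int (ncls (insert f G) D) - of_bool ((x, y) \<notin> conn (insert f G))"
  using ncls_insert_transpose[OF assms, of "insert (transpose x y \<circ> f) G"]
    ncls_insert_transpose[OF assms, of "insert f G"]
    conn_swap_transpose[of x y f G] by (simp add: ncls_def)

section \<open>The defect and its change under transpositions\<close>

definition defect :: "'d set \<Rightarrow> ('d \<Rightarrow> 'd) \<Rightarrow> ('d \<Rightarrow> 'd) \<Rightarrow> int" where
  "defect D f g = int (card D) + 2 * int (ncls {f, g} D)
     - int (ncls {f} D) - int (ncls {g} D) - int (ncls {f \<circ> g} D)"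

lemma conn_comp: "(x, y) \<in> conn {f \<circ> g} \<Longrightarrow> (x, y) \<in> conn {f, g}"
  using conn_trans[OF conn_step[of g "{f, g}"] conn_step[of f "{f, g}"]]
  by (elim conn_subset) simp

lemma conn_fst: "(x, y) \<in> conn {f} \<Longrightarrow> (x, y) \<in> conn {f, g}"
  by (erule conn_mono[rotated]) simp

text \<open>The cycle numbers of \<open>f\<close> and of \<open>f \<circ> g\<close> each change by
  exactly one, with the sign given by the alternative between splitting and merging. Multiplying on
  the left turns both into products with the same transposition.\<close>

lemma defect_transpose_comp:
  assumes "finite D" "f permutes D" "g permutes D" "x \<in> D" "y \<in> D" "x \<noteq> y"
  shows "defect D (transpose x y \<circ> f) g = defect D f g + 2
     - 2 * of_bool ((x, y) \<in> conn {f}) - 2 * of_bool ((x, y) \<in> conn {f \<circ> g})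
     + 2 * of_bool ((x, y) \<in> conn {f, g}) - 2 * of_bool ((x, y) \<in> conn {transpose x y \<circ> f, g})"
proof -
  have fg: "f \<circ> g permutes D" using assms by (simp add: permutes_compose)
  note n = ncls_transpose_comp[OF assms(1,4,5)]
  note c1 = conn_transpose_comp[OF assms(1,2,4,5,6)]
  note c2 = conn_transpose_comp[OF assms(1) fg assms(4,5,6)]
  show ?thesis
    using n[of f "{}"] n[of "f \<circ> g" "{}"] n[of f "{g}"]
    unfolding defect_def c1 c2 comp_assoc by (simp add: of_bool_def split: if_splits)
qed

text \<open>If the new pair does not connect \<open>x\<close> and \<open>y\<close>, then neither
  does the new \<open>f\<close> nor the new product with \<open>g\<close>. Hence both
  multiplications were splittings, which need a common cycle beforehand.\<close>

lemma conn_transpose_comp_cases: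
  assumes "finite D" "f permutes D" "g permutes D" "x \<in> D" "y \<in> D" "x \<noteq> y"
  shows "(x, y) \<in> conn {transpose x y \<circ> f, g} \<or> (x, y) \<in> conn {f} \<and> (x, y) \<in> conn {f \<circ> g}"
proof -
  have fg: "f \<circ> g permutes D" using assms by (simp add: permutes_compose)
  have "(x, y) \<in> conn {transpose x y \<circ> (f \<circ> g)} \<Longrightarrow> (x, y) \<in> conn {transpose x y \<circ> f, g}"
    using conn_comp[of x y "transpose x y \<circ> f" g] by (simp add: comp_assoc)
  then show ?thesis
    using conn_transpose_comp[OF assms(1,2,4,5,6)] conn_transpose_comp[OF assms(1) fg assms(4,5,6)]
      conn_fst[of x y "transpose x y \<circ> f" g] by blast
qed

text \<open>In the one case left out, connected points with neither a common \<open>f\<close>-cycle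
  nor a common cycle of \<open>f \<circ> g\<close>, the defect grows by 2: a handle is
  added.\<close>

lemma defect_transpose_comp_le:
  assumes "finite D" "f permutes D" "g permutes D" "x \<in> D" "y \<in> D"
    and "(x, y) \<in> conn {f} \<or> (x, y) \<in> conn {f \<circ> g} \<or> (x, y) \<notin> conn {f, g}"
  shows "defect D (transpose x y \<circ> f) g \<le> defect D f g"
proof (cases "x = y")
  case True
  then show ?thesis by simp
next
  case False
  show ?thesis
    using assms(6) conn_transpose_comp_cases[OF assms(1-5) False]
      conn_fst[of x y f g] conn_comp[of x y f g]
    unfolding defect_transpose_comp[OF assms(1-5) False] by (auto simp: of_bool_def)
qed

lemma conn_id [simp]: "conn {id} = (Id :: ('a \<times> 'a) set)" "conn {id, g} = conn {g}"
proof -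
  have "(x, y) \<in> conn {id} \<Longrightarrow> x = y" for x y :: 'a
    by (drule conn_invariant[where P = "\<lambda>v. v = x"]) auto
  then show "conn {id} = (Id :: ('a \<times> 'a) set)" by auto
  show "conn {id, g} = conn {g}" by (rule conn_eq) (auto intro: conn_step)
qed

text \<open>Multiplying by \<open>transpose x (f x)\<close> fixes \<open>x\<close>, moves no new
  point and acts within one cycle of \<open>f\<close>, so it does not raise the defect. At
  \<open>f = id\<close> the defect is 0.\<close>

lemma defect_nonneg:
  assumes "finite D" "f permutes D" "g permutes D"
  shows "0 \<le> defect D f g"
  using assms(2)
proof (induction "card {z. f z \<noteq> z}" arbitrary: f rule: less_induct)
  case less
  show ?case
  proof (cases "f = id")
    case True
    have "ncls {id} D = card D"
      by (simp add: ncls_def Image_singleton card_image)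
    moreover have "ncls {id, g} D = ncls {g} D" by (simp add: ncls_def)
    ultimately show ?thesis by (simp add: True defect_def)
  next
    case False
    then obtain x where x: "f x \<noteq> x" by (auto simp: fun_eq_iff)
    let ?f = "transpose x (f x) \<circ> f"
    have xD: "x \<in> D" using x less.prems permutes_not_in by fastforce
    have fxD: "f x \<in> D" using xD less.prems by (simp add: permutes_in_image)
    have f': "?f permutes D" using less.prems xD fxD by (rule permutes_transpose_comp)
    have fin: "finite {z. f z \<noteq> z}"
      using assms(1) by (rule finite_subset[rotated]) (use less.prems permutes_not_in in fastforce)
    have inj: "f u = f v \<Longrightarrow> u = v" for u v
      using permutes_inj[OF less.prems] by (simp add: inj_eq)
    have fixed: "?f z = z" if "f z = z" for z
    proof -
      have "z \<noteq> x" "z \<noteq> f x" using that x inj[of z x] by auto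
      then show ?thesis using that by simp
    qed
    have "{z. ?f z \<noteq> z} \<subset> {z. f z \<noteq> z}"
    proof
      show "{z. ?f z \<noteq> z} \<subseteq> {z. f z \<noteq> z}" using fixed by blast
      have "x \<in> {z. f z \<noteq> z}" "x \<notin> {z. ?f z \<noteq> z}" using x by simp_all
      then show "{z. ?f z \<noteq> z} \<noteq> {z. f z \<noteq> z}" by blast
    qed
    then have "0 \<le> defect D ?f g"
      by (intro less.hyps[OF _ f'] psubset_card_mono fin)
    also have "\<dots> \<le> defect D f g"
      using conn_step[of f "{f}" x]
      by (intro defect_transpose_comp_le assms less.prems xD fxD) simp
    finally show ?thesis .
  qed
qed

lemma conn_comp_swap: "(x, y) \<in> conn {f \<circ> g} \<Longrightarrow> (g x, g y) \<in> conn {g \<circ> f}"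
proof -
  assume "(x, y) \<in> conn {f \<circ> g}"
  then have "(g x, g x) \<in> conn {g \<circ> f} \<longleftrightarrow> (g x, g y) \<in> conn {g \<circ> f}"
  proof (rule conn_invariant[where P = "\<lambda>v. (g x, g v) \<in> conn {g \<circ> f}"])
    fix h z assume "h \<in> {f \<circ> g}"
    then have e: "g (h z) = (g \<circ> f) (g z)" by simp
    show "(g x, g (h z)) \<in> conn {g \<circ> f} \<longleftrightarrow> (g x, g z) \<in> conn {g \<circ> f}"
      unfolding e using conn_trans[OF _ conn_step[of "g \<circ> f" _ "g z"]]
        conn_trans[OF _ conn_step_rev[of "g \<circ> f" _ "g z"]] by blast
  qed
  then show ?thesis by simp
qed

text \<open>\<open>g\<close> conjugates \<open>f \<circ> g\<close> into \<open>g \<circ> f\<close>,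
  so it carries classes bijectively to classes.\<close>

lemma ncls_comp_swap:
  assumes "f permutes D" "g permutes D"
  shows "ncls {f \<circ> g} D = ncls {g \<circ> f} D"
proof -
  have bij: "bij g" using assms(2) by (rule permutes_bij)
  have inj: "inj g" using assms(2) by (rule permutes_inj)
  have 1: "conn {g \<circ> f} `` {g d} = g ` (conn {f \<circ> g} `` {d})" for d
  proof
    show "g ` (conn {f \<circ> g} `` {d}) \<subseteq> conn {g \<circ> f} `` {g d}"
      using conn_comp_swap[of d _ f g] by auto
    have "y \<in> g ` (conn {f \<circ> g} `` {d})" if "(g d, y) \<in> conn {g \<circ> f}" for y
    proof -
      obtain z where z: "y = g z" using bij by (metis bij_pointE)
      have "(f (g d), f (g z)) \<in> conn {f \<circ> g}"
        using conn_comp_swap[OF that] z by simp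
      moreover have "(d, f (g d)) \<in> conn {f \<circ> g}" "(f (g z), z) \<in> conn {f \<circ> g}"
        using conn_step[of "f \<circ> g" "{f \<circ> g}" d] conn_step_rev[of "f \<circ> g" "{f \<circ> g}" z] by simp_all
      ultimately have "(d, z) \<in> conn {f \<circ> g}" by (meson conn_trans)
      then show ?thesis using z by simp
    qed
    then show "conn {g \<circ> f} `` {g d} \<subseteq> g ` (conn {f \<circ> g} `` {d})" by auto
  qed
  have "(\<lambda>d. conn {g \<circ> f} `` {d}) ` D = (\<lambda>d. conn {g \<circ> f} `` {d}) ` g ` D"
    using permutes_image[OF assms(2)] by simp
  also have "\<dots> = (`) g ` ((\<lambda>d. conn {f \<circ> g} `` {d}) ` D)"
    unfolding image_image 1 ..
  finally show ?thesis
    unfolding ncls_def using card_image[OF inj_on_subset[OF inj_on_image_Pow]]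
    by (metis card_image inj inj_image_eq_iff inj_onI)
qed

lemma defect_commute:
  assumes "f permutes D" "g permutes D"
  shows "defect D f g = defect D g f"
  using ncls_comp_swap[OF assms] by (simp add: defect_def insert_commute)

lemma defect_transpose_comp_le_right:
  assumes "finite D" "f permutes D" "g permutes D" "x \<in> D" "y \<in> D"
    and "(x, y) \<in> conn {g} \<or> (x, y) \<in> conn {g \<circ> f} \<or> (x, y) \<notin> conn {f, g}"
  shows "defect D f (transpose x y \<circ> g) \<le> defect D f g"
  using defect_transpose_comp_le[OF assms(1,3,2,4,5)] assms(6)
    defect_commute[OF assms(2,3)] defect_commute[OF assms(2) permutes_transpose_comp[OF assms(3-5)]]
  by (simp add: insert_commute)

text \<open>By the exact change formula the defect would become -2 if the two points stayed
  connected. This is the combinatorial Jordan curve theorem used for cutting along a loop.\<close>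

lemma defect_split_disconnects:
  assumes "finite D" "f permutes D" "g permutes D" "x \<in> D" "y \<in> D" "x \<noteq> y"
    and "(x, y) \<in> conn {g}" "(x, y) \<in> conn {g \<circ> f}" "defect D f g = 0"
  shows "(x, y) \<notin> conn {f, transpose x y \<circ> g}"
proof
  assume c: "(x, y) \<in> conn {f, transpose x y \<circ> g}"
  have "defect D (transpose x y \<circ> g) f < 0"
    using assms(7-9) c defect_commute[OF assms(2,3)] conn_fst[of x y g f]
    unfolding defect_transpose_comp[OF assms(1,3,2,4,5,6)] by (simp add: insert_commute)
  then show False
    using defect_nonneg[OF assms(1) permutes_transpose_comp[OF assms(3-5)] assms(2)] by simp
qed

section \<open>Restriction to components\<close>

lemma conn_perm_restrict:
  assumes "\<And>f z. f \<in> F \<Longrightarrow> f z \<in> C \<longleftrightarrow> z \<in> C" and "d \<in> C"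
  shows "conn ((\<lambda>f. perm_restrict f C) ` F) `` {d} = conn F `` {d}" (is "conn ?G `` _ = _")
proof -
  have "(d, y) \<in> conn ?G" if "(d, y) \<in> conn F" for y
  proof -
    have "d \<in> C \<and> (d, d) \<in> conn ?G \<longleftrightarrow> y \<in> C \<and> (d, y) \<in> conn ?G"
      using that
    proof (rule conn_invariant[where P = "\<lambda>v. v \<in> C \<and> (d, v) \<in> conn ?G"])
      fix f z assume f: "f \<in> F"
      show "f z \<in> C \<and> (d, f z) \<in> conn ?G \<longleftrightarrow> z \<in> C \<and> (d, z) \<in> conn ?G"
      proof (cases "z \<in> C")
        case True
        then have "(z, f z) \<in> conn ?G"
          using conn_step[of "perm_restrict f C" ?G z] f by (simp add: perm_restrict_simps)
        then show ?thesis
          using True assms(1)[OF f] conn_trans[of d z ?G "f z"] conn_trans[of d "f z" ?G z]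
            conn_sym[of z "f z" ?G] by blast
      qed (use assms(1)[OF f] in simp)
    qed
    then show ?thesis using assms(2) by simp
  qed
  moreover have "(d, y) \<in> conn F" if "(d, y) \<in> conn ?G" for y
    using that
  proof (rule conn_subset)
    fix g z assume "g \<in> ?G"
    then obtain f where "f \<in> F" "g = perm_restrict f C" by auto
    then show "(z, g z) \<in> conn F"
      using conn_step[of f F z] by (simp add: perm_restrict_def)
  qed
  ultimately show ?thesis by auto
qed

lemma ncls_perm_restrict:
  assumes "\<And>f z. f \<in> F \<Longrightarrow> f z \<in> C \<longleftrightarrow> z \<in> C"
  shows "ncls ((\<lambda>f. perm_restrict f C) ` F) C = ncls F C"
proof -
  have "(\<lambda>d. conn ((\<lambda>f. perm_restrict f C) ` F) `` {d}) ` C = (\<lambda>d. conn F `` {d}) ` C"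
    by (intro image_cong refl conn_perm_restrict assms)
  then show ?thesis by (simp add: ncls_def)
qed

lemma conn_closed:
  assumes "\<And>f z. f \<in> F \<Longrightarrow> f z \<in> C \<longleftrightarrow> z \<in> C" and "(x, y) \<in> conn F"
  shows "x \<in> C \<longleftrightarrow> y \<in> C"
  using assms(2) by (rule conn_invariant[where P = "\<lambda>v. v \<in> C"]) (rule assms(1))

lemma ncls_Un:
  assumes "\<And>f z. f \<in> F \<Longrightarrow> f z \<in> C \<longleftrightarrow> z \<in> C" and "C \<subseteq> D" "finite D"
  shows "ncls F D = ncls F C + ncls F (D - C)"
proof -
  let ?c = "\<lambda>d. conn F `` {d}"
  have "?c ` C \<inter> ?c ` (D - C) = {}"
  proof -
    have "?c d \<noteq> ?c e" if "d \<in> C" "e \<in> D - C" for d e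
      using conn_closed[where F = F and C = C and x = d and y = e] assms(1) that
      by (auto simp: conn_class_eq_iff)
    then show ?thesis by blast
  qed
  moreover have "?c ` D = ?c ` C \<union> ?c ` (D - C)" using assms(2) by auto
  moreover have "finite C" using assms(2,3) finite_subset by blast
  ultimately show ?thesis
    unfolding ncls_def using assms(3) by (simp add: card_Un_disjoint)
qed

lemma perm_restrict_permutes:
  assumes "f permutes D" "finite C" "\<And>z. f z \<in> C \<longleftrightarrow> z \<in> C"
  shows "perm_restrict f C permutes C"
proof (rule bij_imp_permutes)
  have inj: "inj_on f C" using permutes_inj[OF assms(1)] inj_on_subset by blast
  have "bij_betw f C C"
    using inj assms(2,3) by (simp add: bij_betw_def endo_inj_surj image_subsetI)
  then show "bij_betw (perm_restrict f C) C C"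
    by (rule bij_betw_cong[THEN iffD1, rotated]) (simp add: perm_restrict_simps)
qed (simp add: perm_restrict_simps)

lemma defect_perm_restrict:
  assumes "\<And>z. f z \<in> C \<longleftrightarrow> z \<in> C" "\<And>z. g z \<in> C \<longleftrightarrow> z \<in> C"
  shows "defect C (perm_restrict f C) (perm_restrict g C) =
    int (card C) + 2 * int (ncls {f, g} C) - int (ncls {f} C) - int (ncls {g} C) - int (ncls {f \<circ> g} C)"
proof -
  have "perm_restrict f C \<circ> perm_restrict g C = perm_restrict (f \<circ> g) C"
    using assms(2) by (auto simp: perm_restrict_def fun_eq_iff)
  moreover have "ncls {perm_restrict f C, perm_restrict g C} C = ncls {f, g} C"
    using ncls_perm_restrict[of "{f, g}" C] assms by fastforce
  ultimately show ?thesis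
    using ncls_perm_restrict[of "{f}" C] ncls_perm_restrict[of "{g}" C]
      ncls_perm_restrict[of "{f \<circ> g}" C] assms
    by (simp add: defect_def)
qed

lemma defect_Un:
  assumes "f permutes D" "g permutes D" "finite D" "C \<subseteq> D"
    and "\<And>z. f z \<in> C \<longleftrightarrow> z \<in> C" "\<And>z. g z \<in> C \<longleftrightarrow> z \<in> C"
  shows "defect D f g = defect C (perm_restrict f C) (perm_restrict g C)
    + defect (D - C) (perm_restrict f (D - C)) (perm_restrict g (D - C))"
proof -
  have cl: "f z \<in> D - C \<longleftrightarrow> z \<in> D - C" "g z \<in> D - C \<longleftrightarrow> z \<in> D - C" for z
    using assms(1,2,5,6) by (simp_all add: permutes_in_image)
  have fin: "finite C" using assms(3,4) finite_subset by blast
  have "card D = card C + card (D - C)"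
    using assms(3,4) fin by (simp add: card_Diff_subset card_mono)
  moreover have "ncls {f, g} D = ncls {f, g} C + ncls {f, g} (D - C)"
    "ncls {f} D = ncls {f} C + ncls {f} (D - C)"
    "ncls {g} D = ncls {g} C + ncls {g} (D - C)"
    "ncls {f \<circ> g} D = ncls {f \<circ> g} C + ncls {f \<circ> g} (D - C)"
    using assms(3-6) by (intro ncls_Un; auto)+
  ultimately show ?thesis
    unfolding defect_perm_restrict[of f C g, OF assms(5,6)] defect_perm_restrict[of f "D - C" g, OF cl]
    by (simp add: defect_def)
qed

text \<open>The defect is the sum of the defects on \<open>C\<close> and on its complement. Both are
  nonnegative, so a total that is at most 0 leaves no room for either.\<close>

lemma defect_restrict_zero:
  assumes "f permutes D" "g permutes D" "finite D" "C \<subseteq> D" "defect D f g \<le> 0"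
    and "\<And>z. f z \<in> C \<longleftrightarrow> z \<in> C" "\<And>z. g z \<in> C \<longleftrightarrow> z \<in> C"
  shows "defect C (perm_restrict f C) (perm_restrict g C) = 0"
proof -
  have cl: "f z \<in> D - C \<longleftrightarrow> z \<in> D - C" "g z \<in> D - C \<longleftrightarrow> z \<in> D - C" for z
    using assms(1,2,6,7) by (simp_all add: permutes_in_image)
  have fin: "finite C" "finite (D - C)" using assms(3,4) finite_subset by auto
  have "0 \<le> defect C (perm_restrict f C) (perm_restrict g C)"
    using assms fin by (intro defect_nonneg perm_restrict_permutes[where D = D])
  moreover have "0 \<le> defect (D - C) (perm_restrict f (D - C)) (perm_restrict g (D - C))"
    using assms(1,2) fin cl by (intro defect_nonneg perm_restrict_permutes[where D = D])
  ultimately show ?thesis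
    using defect_Un[OF assms(1-4,6,7)] assms(5) by linarith
qed

section \<open>Planar maps and diagrams\<close>

text \<open>The last conjunct amounts to equality by \<open>defect_nonneg\<close>, and then each
  component is a sphere. In a diagram \<open>f\<close> is \<open>nxt\<close> and \<open>g\<close> is
  \<open>opp\<close>; connectedness is left out on purpose, because surgery destroys it.\<close>

definition planar_map :: "'d set \<Rightarrow> ('d \<Rightarrow> 'd) \<Rightarrow> ('d \<Rightarrow> 'd) \<Rightarrow> bool" where
  "planar_map D f g \<longleftrightarrow> finite D \<and> f permutes D \<and> g permutes D \<and>
     (\<forall>d\<in>D. g d \<noteq> d \<and> g (g d) = d) \<and> defect D f g \<le> 0"

lemma planar_mapD:
  assumes "planar_map D f g"
  shows "finite D" "f permutes D" "g permutes D" "defect D f g \<le> 0"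
    "d \<in> D \<Longrightarrow> g d \<noteq> d" "d \<in> D \<Longrightarrow> g (g d) = d"
  using assms by (auto simp: planar_map_def)

lemma orbit_eq_iff:
  assumes "finite D" "f permutes D"
  shows "orbit f x = orbit f y \<longleftrightarrow> y \<in> orbit f x"
  using conn_class_eq_iff[of "{f}" x y] unfolding conn_class_singleton[OF assms] conn_singleton[OF assms] .

lemma orbit_mem_eq:
  assumes "finite D" "f permutes D" "y \<in> orbit f x"
  shows "orbit f y = orbit f x"
  using assms(3) orbit_eq_iff[OF assms(1,2), of x y] by simp

lemma orbit_subset_closed:
  assumes "x \<in> A" "\<And>z. z \<in> A \<Longrightarrow> f z \<in> A"
  shows "orbit f x \<subseteq> A"
proof
  fix y assume "y \<in> orbit f x"
  then show "y \<in> A" by induction (use assms in auto)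
qed

lemma ncls_singleton: "finite D \<Longrightarrow> f permutes D \<Longrightarrow> ncls {f} D = card (orbit f ` D)"
  by (simp add: ncls_def conn_class_singleton)

text \<open>Lets vertices be counted as orbits of the rotation \<open>f \<circ> g\<close> whatever
  numbers name them.\<close>

lemma card_image_same_kernel:
  assumes "\<And>x y. x \<in> D \<Longrightarrow> y \<in> D \<Longrightarrow> h x = h y \<longleftrightarrow> k x = k y"
  shows "card (h ` D) = card (k ` D)"
proof (rule bij_betw_same_card)
  show "bij_betw (\<lambda>v. k (inv_into D h v)) (h ` D) (k ` D)"
    unfolding bij_betw_def
  proof
    show "inj_on (\<lambda>v. k (inv_into D h v)) (h ` D)"
      using assms by (intro inj_onI) (metis f_inv_into_f inv_into_into)
    show "(\<lambda>v. k (inv_into D h v)) ` h ` D = k ` D"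
      using assms by (auto simp: image_image image_iff) (metis f_inv_into_f imageI inv_into_into)+
  qed
qed

lemma orbit_involution: "g (g d) = d \<Longrightarrow> orbit g d = {d, g d}"
proof
  assume *: "g (g d) = d"
  show "orbit g d \<subseteq> {d, g d}" by (rule orbit_subset_closed) (use * in auto)
  show "{d, g d} \<subseteq> orbit g d"
    using orbit.base[of g d] orbit.step[OF orbit.base, of g d] * by simp
qed

lemma card_edges:
  assumes "finite D" "g permutes D" "\<And>d. d \<in> D \<Longrightarrow> g d \<noteq> d" "\<And>d. d \<in> D \<Longrightarrow> g (g d) = d"
  shows "ncls {g} D = card {{d, g d} |d. d \<in> D}" "card D = 2 * card {{d, g d} |d. d \<in> D}"
proof -
  have orb: "orbit g d = {d, g d}" if "d \<in> D" for d
    using assms(4)[OF that] by (rule orbit_involution)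
  have img: "orbit g ` D = {{d, g d} |d. d \<in> D}"
    using orb by auto
  show "ncls {g} D = card {{d, g d} |d. d \<in> D}"
    unfolding ncls_singleton[OF assms(1,2)] img ..
  have "2 * card (orbit g ` D) = card (\<Union>(orbit g ` D))"
  proof (rule card_partition)
    have "\<Union>(orbit g ` D) \<subseteq> D"
      using permutes_orbit_subset[OF assms(2)] by blast
    then show "finite (\<Union>(orbit g ` D))" using assms(1) finite_subset by blast
    show "c \<in> orbit g ` D \<Longrightarrow> card c = 2" for c
      using orb assms(3) by fastforce
    show "c \<inter> c' = {}" if "c \<in> orbit g ` D" "c' \<in> orbit g ` D" "c \<noteq> c'" for c c'
      using that orbit_mem_eq[OF assms(1,2)] by blast
  qed (use assms(1) in simp)
  moreover have "\<Union>(orbit g ` D) = D"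
    using permutes_orbit_subset[OF assms(2)] self_in_orbit[OF assms(1,2)] by blast
  ultimately show "card D = 2 * card {{d, g d} |d. d \<in> D}"
    unfolding img by simp
qed

lemma ncls_connected:
  assumes "b \<in> D" "\<And>d. d \<in> D \<Longrightarrow> (b, d) \<in> conn F"
  shows "ncls F D = 1"
proof -
  have "(\<lambda>d. conn F `` {d}) ` D = {conn F `` {b}}"
    using assms conn_class_eq_iff[of F b] by auto
  then show ?thesis by (simp add: ncls_def)
qed

lemma defect_connected:
  assumes "finite D" "f permutes D" "g permutes D"
    "\<And>d. d \<in> D \<Longrightarrow> g d \<noteq> d" "\<And>d. d \<in> D \<Longrightarrow> g (g d) = d" "b \<in> D" "\<And>d. d \<in> D \<Longrightarrow> (b, d) \<in> conn {f, g}"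
  shows "defect D f g = int (card {{d, g d} |d. d \<in> D}) + 2
     - int (card (orbit f ` D)) - int (card (orbit (f \<circ> g) ` D))"
  using card_edges[OF assms(1,3,4,5)] ncls_connected[OF assms(6,7)]
    ncls_singleton[OF assms(1,2)] ncls_singleton[OF assms(1) permutes_compose[OF assms(3,2)]]
  unfolding defect_def by simp

lemma planar_diagram_parts:
  assumes "planar_diagram \<Gamma>"
  shows "finite (verts \<Gamma>)" "finite (darts \<Gamma>)" "opp \<Gamma> permutes darts \<Gamma>" "nxt \<Gamma> permutes darts \<Gamma>"
    "d \<in> darts \<Gamma> \<Longrightarrow> opp \<Gamma> d \<noteq> d" "d \<in> darts \<Gamma> \<Longrightarrow> opp \<Gamma> (opp \<Gamma> d) = d"
    "d \<in> darts \<Gamma> \<Longrightarrow> src \<Gamma> d \<in> verts \<Gamma>"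
    "d \<in> darts \<Gamma> \<Longrightarrow> e \<in> darts \<Gamma> \<Longrightarrow> src \<Gamma> d = src \<Gamma> e \<longleftrightarrow> e \<in> orbit (nxt \<Gamma> \<circ> opp \<Gamma>) d"
    "darts \<Gamma> \<noteq> {} \<Longrightarrow> outer \<Gamma> \<in> orbit (nxt \<Gamma>) ` darts \<Gamma>"
    "u \<in> verts \<Gamma> \<Longrightarrow> v \<in> verts \<Gamma> \<Longrightarrow>
       (u, v) \<in> {(src \<Gamma> d, src \<Gamma> (opp \<Gamma> d)) | d. d \<in> darts \<Gamma>}\<^sup>*"
    "card (verts \<Gamma>) + (card (internal_faces \<Gamma>) + 1) = card (edges \<Gamma>) + 2"
  using assms unfolding planar_diagram_def by (auto split: if_splits)

lemma planar_diagram_verts: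
  assumes \<Gamma>: "planar_diagram \<Gamma>" and ne: "darts \<Gamma> \<noteq> {}"
  shows "src \<Gamma> ` darts \<Gamma> = verts \<Gamma>"
proof
  show "src \<Gamma> ` darts \<Gamma> \<subseteq> verts \<Gamma>" using planar_diagram_parts(7)[OF \<Gamma>] by blast
  show "verts \<Gamma> \<subseteq> src \<Gamma> ` darts \<Gamma>"
  proof
    fix v assume v: "v \<in> verts \<Gamma>"
    obtain d where d: "d \<in> darts \<Gamma>" using ne by blast
    have "(v, src \<Gamma> d) \<in> {(src \<Gamma> d, src \<Gamma> (opp \<Gamma> d)) | d. d \<in> darts \<Gamma>}\<^sup>*"
      using planar_diagram_parts(7,10)[OF \<Gamma>] v d by blast
    then show "v \<in> src \<Gamma> ` darts \<Gamma>"
      by (cases rule: converse_rtranclE) (use d in auto)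
  qed
qed

text \<open>Darts leaving one vertex are linked by the rotation \<open>nxt \<circ> opp\<close>, and
  \<open>opp\<close> moves to the other end of an edge. A path of vertices thus lifts to a chain of
  darts.\<close>

lemma planar_diagram_connected:
  assumes \<Gamma>: "planar_diagram \<Gamma>" and "d \<in> darts \<Gamma>" "e \<in> darts \<Gamma>"
  shows "(d, e) \<in> conn {nxt \<Gamma>, opp \<Gamma>}"
proof -
  note p = planar_diagram_parts[OF \<Gamma>]
  have \<sigma>: "nxt \<Gamma> \<circ> opp \<Gamma> permutes darts \<Gamma>" using p(3,4) by (rule permutes_compose)
  have same: "(a, b) \<in> conn {nxt \<Gamma>, opp \<Gamma>}"
    if "a \<in> darts \<Gamma>" "b \<in> darts \<Gamma>" "src \<Gamma> a = src \<Gamma> b" for a b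
  proof -
    have "(a, b) \<in> conn {nxt \<Gamma> \<circ> opp \<Gamma>}"
      using that p(8)[OF that(1,2)] by (simp add: conn_singleton[OF p(2) \<sigma>])
    then show ?thesis by (rule conn_comp)
  qed
  have "(src \<Gamma> d, src \<Gamma> e) \<in> {(src \<Gamma> d, src \<Gamma> (opp \<Gamma> d)) | d. d \<in> darts \<Gamma>}\<^sup>*"
    using p(7,10) assms(2,3) by blast
  then have "\<forall>e'\<in>darts \<Gamma>. src \<Gamma> e' = src \<Gamma> e \<longrightarrow> (d, e') \<in> conn {nxt \<Gamma>, opp \<Gamma>}"
  proof (induction rule: rtrancl_induct)
    case base
    then show ?case using same assms(2) by simp
  next
    case (step u v)
    from step(2) obtain a where a: "a \<in> darts \<Gamma>" "u = src \<Gamma> a" "v = src \<Gamma> (opp \<Gamma> a)" by blast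
    have "(d, a) \<in> conn {nxt \<Gamma>, opp \<Gamma>}" using step(3) a by simp
    then have "(d, opp \<Gamma> a) \<in> conn {nxt \<Gamma>, opp \<Gamma>}"
      by (rule conn_trans) (rule conn_step, simp)
    moreover have "opp \<Gamma> a \<in> darts \<Gamma>" using a p(3) by (simp add: permutes_in_image)
    ultimately show ?case using a(3) same[of "opp \<Gamma> a"] conn_trans[of d "opp \<Gamma> a"] by simp
  qed
  then show ?thesis using assms(3) by simp
qed

lemma card_faces:
  assumes "planar_diagram \<Gamma>" "darts \<Gamma> \<noteq> {}"
  shows "card (orbit (nxt \<Gamma>) ` darts \<Gamma>) = card (internal_faces \<Gamma>) + 1"
  using planar_diagram_parts(2)[OF assms(1)]
    card_Suc_Diff1[OF _ planar_diagram_parts(9)[OF assms]]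
  unfolding internal_faces_def by simp

lemma planar_diagram_map:
  assumes \<Gamma>: "planar_diagram \<Gamma>"
  shows "planar_map (darts \<Gamma>) (nxt \<Gamma>) (opp \<Gamma>)"
proof (cases "darts \<Gamma> = {}")
  case True
  then show ?thesis
    using planar_diagram_parts[OF \<Gamma>] by (simp add: planar_map_def defect_def ncls_def)
next
  case False
  note p = planar_diagram_parts[OF \<Gamma>]
  have \<sigma>: "nxt \<Gamma> \<circ> opp \<Gamma> permutes darts \<Gamma>" using p(3,4) by (rule permutes_compose)
  obtain b where b: "b \<in> darts \<Gamma>" using False by blast
  have "card (src \<Gamma> ` darts \<Gamma>) = card (orbit (nxt \<Gamma> \<circ> opp \<Gamma>) ` darts \<Gamma>)"
    by (rule card_image_same_kernel) (simp add: p(8) orbit_eq_iff[OF p(2) \<sigma>])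
  then have "defect (darts \<Gamma>) (nxt \<Gamma>) (opp \<Gamma>) = 0"
    using defect_connected[OF p(2,4,3,5,6) b planar_diagram_connected[OF \<Gamma> b]] p(11)
      card_faces[OF \<Gamma> False]
    unfolding planar_diagram_verts[OF \<Gamma> False] edges_def by simp
  then show ?thesis using p by (simp add: planar_map_def)
qed

text \<open>The sources of darts are named by the least dart leaving the vertex.\<close>
definition component_diagram :: "(nat \<Rightarrow> nat) \<Rightarrow> (nat \<Rightarrow> nat) \<Rightarrow> (nat \<Rightarrow> 'a) \<Rightarrow> nat \<Rightarrow> 'a diagram" where
  "component_diagram f g l b =
     \<lparr>verts = (\<lambda>d. Min (orbit (f \<circ> g) d)) ` (conn {f, g} `` {b}),
      darts = conn {f, g} `` {b},
      src = (\<lambda>d. Min (orbit (f \<circ> g) d)),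
      opp = perm_restrict g (conn {f, g} `` {b}),
      nxt = perm_restrict f (conn {f, g} `` {b}),
      outer = orbit f b,
      lab = l\<rparr>"

lemma component_closed:
  "f z \<in> conn {f, g} `` {b} \<longleftrightarrow> z \<in> conn {f, g} `` {b}"
  "g z \<in> conn {f, g} `` {b} \<longleftrightarrow> z \<in> conn {f, g} `` {b}"
proof -
  have "(b, h z) \<in> conn {f, g} \<longleftrightarrow> (b, z) \<in> conn {f, g}" if "h \<in> {f, g}" for h
    using conn_trans[OF _ conn_step[OF that, of z]] conn_trans[OF _ conn_step_rev[OF that, of z]]
    by blast
  then show "f z \<in> conn {f, g} `` {b} \<longleftrightarrow> z \<in> conn {f, g} `` {b}"
    "g z \<in> conn {f, g} `` {b} \<longleftrightarrow> z \<in> conn {f, g} `` {b}" by auto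
qed

lemma component_subset:
  assumes "planar_map D f g" "b \<in> D"
  shows "conn {f, g} `` {b} \<subseteq> D"
proof
  fix d assume "d \<in> conn {f, g} `` {b}"
  then have "(b, d) \<in> conn {f, g}" by simp
  then have "b \<in> D \<longleftrightarrow> d \<in> D"
  proof (rule conn_closed[rotated])
    fix h z assume "h \<in> {f, g}"
    then have "h permutes D" using planar_mapD(2,3)[OF assms(1)] by auto
    then show "h z \<in> D \<longleftrightarrow> z \<in> D" by (rule permutes_in_image)
  qed
  then show "d \<in> D" using assms(2) by simp
qed

lemma orbit_perm_restrict:
  assumes "d \<in> C" "\<And>z. z \<in> C \<Longrightarrow> f z \<in> C"
  shows "orbit (perm_restrict f C) d = orbit f d"
  using assms by (intro orbit_cong0[symmetric, of d C]) (auto simp: perm_restrict_simps)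

definition fword :: "('d \<Rightarrow> 'd) \<Rightarrow> ('d \<Rightarrow> 'a) \<Rightarrow> 'd \<Rightarrow> 'a list" where
  "fword f l d = map (\<lambda>k. l ((f ^^ k) d)) [0..<card (orbit f d)]"

lemma face_word_fword: "face_word \<Gamma> d = fword (nxt \<Gamma>) (lab \<Gamma>) d"
  by (simp add: face_word_def fword_def)

lemma fword_cong:
  assumes "d \<in> A" "\<And>z. z \<in> A \<Longrightarrow> f z \<in> A" "\<And>z. z \<in> A \<Longrightarrow> f z = f' z" "\<And>z. z \<in> A \<Longrightarrow> l z = l' z"
  shows "fword f l d = fword f' l' d"
proof -
  have "orbit f d = orbit f' d"
    using assms by (intro orbit_cong0[of d A]) auto
  moreover have k: "(f ^^ k) d = (f' ^^ k) d \<and> (f ^^ k) d \<in> A" for k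
    using assms by (induction k) auto
  have "l ((f ^^ k) d) = l' ((f' ^^ k) d)" for k
    using assms(4)[OF conjunct2[OF k]] conjunct1[OF k] by simp
  ultimately show ?thesis by (simp add: fword_def)
qed

lemma component_diagram_orbit:
  assumes "d \<in> darts (component_diagram f g l b)"
  shows "orbit (nxt (component_diagram f g l b)) d = orbit f d"
    "face_word (component_diagram f g l b) d = fword f l d"
proof -
  let ?C = "conn {f, g} `` {b}"
  have d: "d \<in> ?C" using assms by (simp add: component_diagram_def)
  have "orbit (perm_restrict f ?C) d = orbit f d"
    using d component_closed(1)[of f _ g b] by (rule orbit_perm_restrict[OF _ iffD2])
  then show "orbit (nxt (component_diagram f g l b)) d = orbit f d"
    by (simp add: component_diagram_def)
  show "face_word (component_diagram f g l b) d = fword f l d"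
    unfolding face_word_fword component_diagram_def using d component_closed(1)[of f _ g b]
    by (intro fword_cong[where A = ?C]) (simp_all add: perm_restrict_simps)
qed

lemma component_diagram_internal_faces:
  "internal_faces (component_diagram f g l b) = orbit f ` (conn {f, g} `` {b}) - {orbit f b}"
proof -
  have "orbit (nxt (component_diagram f g l b)) ` darts (component_diagram f g l b)
    = orbit f ` darts (component_diagram f g l b)"
    by (rule image_cong) (simp_all add: component_diagram_orbit)
  then show ?thesis unfolding internal_faces_def by (simp add: component_diagram_def)
qed

text \<open>The component of \<open>b\<close> inherits defect 0, and for a single component this
  equation is Euler's formula.\<close>

lemma planar_component_diagram:
  assumes m: "planar_map D f g" and b: "b \<in> D"
  shows "planar_diagram (component_diagram f g l b)"
proof -
  let ?C = "conn {f, g} `` {b}" and ?\<Gamma> = "component_diagram f g l b"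
  let ?f = "perm_restrict f ?C" and ?g = "perm_restrict g ?C" and ?\<sigma> = "f \<circ> g"
  let ?s = "\<lambda>d. Min (orbit ?\<sigma> d)"
  note [simp] = component_closed[of f _ g b, simplified]
  note p = planar_mapD[OF m]
  have CD: "?C \<subseteq> D" using m b by (rule component_subset)
  have finC: "finite ?C" using CD p(1) finite_subset by blast
  have \<sigma>: "?\<sigma> permutes D" using p(3,2) by (rule permutes_compose)
  have bC: "b \<in> ?C" by simp
  have cl: "f z \<in> ?C \<longleftrightarrow> z \<in> ?C" "g z \<in> ?C \<longleftrightarrow> z \<in> ?C" for z by (rule component_closed)+
  have f: "?f permutes ?C" using p(2) finC cl(1) by (rule perm_restrict_permutes)
  have g: "?g permutes ?C" using p(3) finC cl(2) by (rule perm_restrict_permutes)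
  have gg: "?g d \<noteq> d" "?g (?g d) = d" if "d \<in> ?C" for d
    using that CD p(5,6)[of d] cl(2) by (auto simp: perm_restrict_simps)
  have orb\<sigma>: "orbit (?f \<circ> ?g) d = orbit ?\<sigma> d" if "d \<in> ?C" for d
    using that cl by (intro orbit_cong0[symmetric, of d ?C]) (auto simp: perm_restrict_simps)
  have orbf: "orbit ?f d = orbit f d" if "d \<in> ?C" for d
    using that cl by (intro orbit_perm_restrict) auto
  have conn: "(d, e) \<in> conn {?f, ?g}" if "d \<in> ?C" "e \<in> ?C" for d e
  proof -
    have "conn ((\<lambda>h. perm_restrict h ?C) ` {f, g}) `` {d} = conn {f, g} `` {d}"
    proof (rule conn_perm_restrict)
      fix h z assume "h \<in> {f, g}"
      then consider "h = f" | "h = g" by blast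
      then show "h z \<in> ?C \<longleftrightarrow> z \<in> ?C" by cases (simp_all only: cl)
    qed (rule that)
    moreover have "(d, e) \<in> conn {f, g}"
      using that conn_trans[OF conn_sym[of b d]] by simp
    ultimately show ?thesis by auto
  qed
  have srcs: "?s d = ?s e \<longleftrightarrow> e \<in> orbit ?\<sigma> d" for d e
  proof -
    have "finite (orbit ?\<sigma> x) \<and> orbit ?\<sigma> x \<noteq> {}" for x
      using finite_orbit[OF self_in_orbit[OF p(1) \<sigma>]] orbit_nonempty[of ?\<sigma> x] by simp
    then have "?s x \<in> orbit ?\<sigma> x" for x using Min_in by blast
    then have "?s d = ?s e \<Longrightarrow> orbit ?\<sigma> d = orbit ?\<sigma> e"
      using orbit_mem_eq[OF p(1) \<sigma>] by metis
    then show ?thesis using orbit_eq_iff[OF p(1) \<sigma>, of d e] by auto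
  qed
  have "defect ?C ?f ?g = 0"
    using p(2,3,1) CD p(4) cl by (rule defect_restrict_zero)
  then have euler: "int (card {{d, ?g d} |d. d \<in> ?C}) + 2
     - int (card (orbit ?f ` ?C)) - int (card (orbit (?f \<circ> ?g) ` ?C)) = 0"
    using defect_connected[OF finC f g gg bC conn[OF bC]] by simp
  have cs: "card (?s ` ?C) = card (orbit (?f \<circ> ?g) ` ?C)"
  proof (rule card_image_same_kernel)
    fix x y assume "x \<in> ?C" "y \<in> ?C"
    then show "?s x = ?s y \<longleftrightarrow> orbit (?f \<circ> ?g) x = orbit (?f \<circ> ?g) y"
      by (simp only: srcs orb\<sigma> orbit_eq_iff[OF p(1) \<sigma>])
  qed
  have "orbit ?f ` ?C = orbit f ` ?C" using orbf by (rule image_cong[OF refl])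
  moreover have "orbit f b \<in> orbit f ` ?C" using bC by blast
  ultimately have cf: "card (orbit ?f ` ?C) = card (orbit f ` ?C - {orbit f b}) + 1"
    using card_Suc_Diff1[of "orbit f ` ?C" "orbit f b"] finC by simp
  define s where "s = ?s"
  define E where "E = {(s d, s (?g d)) | d. d \<in> ?C}"
  have E: "(s d, s (g d)) \<in> E" if "d \<in> ?C" for d
    unfolding E_def using that by (intro CollectI exI[of _ d]) (simp add: perm_restrict_simps)
  have E2: "(s (g d), s d) \<in> E" if "d \<in> ?C" for d
  proof -
    have "g d \<in> ?C" using that by (simp only: cl)
    moreover have "g (g d) = d" using that CD p(6)[of d] by auto
    ultimately show ?thesis using E[of "g d"] by (simp only:)
  qed
  have "sym E"
  proof (rule symI)
    fix u v assume "(u, v) \<in> E"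
    then obtain d where d: "d \<in> ?C" "u = s d" "v = s (g d)"
      unfolding E_def by (auto simp: perm_restrict_def)
    then show "(v, u) \<in> E" using E2[OF d(1)] by simp
  qed
  then have symE: "sym (E\<^sup>*)" by (rule sym_rtrancl)
  \<comment> \<open>Both \<open>f z\<close> and \<open>g z\<close> leave the end of
    \<open>z\<close>, so a step along a face is an edge step in the graph of vertices.\<close>
  have fstep: "s (f z) = s (g z)" if "z \<in> ?C" for z
  proof -
    have "f z = ?\<sigma> (g z)" using that CD p(6)[of z] by auto
    then have "f z \<in> orbit ?\<sigma> (g z)" using orbit.base[of ?\<sigma> "g z"] by simp
    then show ?thesis using srcs[of "g z" "f z"] by (simp add: s_def)
  qed
  have reach: "(s b, s d) \<in> E\<^sup>*" if "d \<in> ?C" for d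
  proof -
    have step: "(s b, s (h z)) \<in> E\<^sup>* \<longleftrightarrow> (s b, s z) \<in> E\<^sup>*" if "z \<in> ?C" "s (h z) = s (g z)" for h z
      using rtrancl_into_rtrancl[OF _ E[OF that(1)], of "s b"]
        rtrancl_into_rtrancl[OF _ E2[OF that(1)], of "s b"] that(2) by auto
    have "(b, d) \<in> conn {f, g}" using that by simp
    then have "b \<in> ?C \<and> (s b, s b) \<in> E\<^sup>* \<longleftrightarrow> d \<in> ?C \<and> (s b, s d) \<in> E\<^sup>*"
    proof (rule conn_invariant[where P = "\<lambda>v. v \<in> ?C \<and> (s b, s v) \<in> E\<^sup>*"])
      fix h z assume "h \<in> {f, g}"
      then have "h = f \<or> h = g" by blast
      then have "h z \<in> ?C \<longleftrightarrow> z \<in> ?C" "z \<in> ?C \<Longrightarrow> s (h z) = s (g z)"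
        using cl[of z] fstep[of z] by auto
      then show "h z \<in> ?C \<and> (s b, s (h z)) \<in> E\<^sup>* \<longleftrightarrow> z \<in> ?C \<and> (s b, s z) \<in> E\<^sup>*"
        using step[of z h] by blast
    qed
    then show ?thesis using bC by blast
  qed
  have reach': "(u, v) \<in> E\<^sup>*" if uv: "u \<in> s ` ?C" "v \<in> s ` ?C" for u v
  proof -
    have "(s b, u) \<in> E\<^sup>*" "(s b, v) \<in> E\<^sup>*" using uv reach by blast+
    then show ?thesis using symD[OF symE] by (blast intro: rtrancl_trans)
  qed
  show ?thesis
    unfolding planar_diagram_def
  proof (intro conjI)
    show "card (verts ?\<Gamma>) + (card (internal_faces ?\<Gamma>) + 1) = card (edges ?\<Gamma>) + 2"
      using euler cs cf
      unfolding component_diagram_internal_faces edges_def by (simp add: component_diagram_def)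
    show "\<forall>d\<in>darts ?\<Gamma>. \<forall>e\<in>darts ?\<Gamma>.
       (src ?\<Gamma> d = src ?\<Gamma> e) = (e \<in> orbit (nxt ?\<Gamma> \<circ> opp ?\<Gamma>) d)"
      using srcs orb\<sigma> by (simp add: component_diagram_def)
    show "\<forall>u\<in>verts ?\<Gamma>. \<forall>v\<in>verts ?\<Gamma>. (u, v) \<in> {(src ?\<Gamma> d, src ?\<Gamma> (opp ?\<Gamma> d)) |d. d \<in> darts ?\<Gamma>}\<^sup>*"
      using reach' unfolding E_def s_def by (simp only: component_diagram_def diagram.simps) blast
    show "if darts ?\<Gamma> = {} then outer ?\<Gamma> = {} else outer ?\<Gamma> \<in> orbit (nxt ?\<Gamma>) ` darts ?\<Gamma>"
    proof -
      have "?C \<noteq> {}" using bC by blast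
      moreover have "orbit f b \<in> orbit ?f ` ?C" using orbf[OF bC] bC by (metis image_eqI)
      ultimately show ?thesis by (simp add: component_diagram_def)
    qed
    have "?C \<noteq> {}" using bC by blast
    then show "verts ?\<Gamma> \<noteq> {}" by (simp add: component_diagram_def)
  qed (use finC f g gg in \<open>auto simp: component_diagram_def\<close>)
qed

section \<open>Coloured areas of subdiagrams\<close>

lemma finite_faces:
  assumes "planar_diagram \<Gamma>"
  shows "finite (internal_faces \<Gamma>)" "finite (red_faces P \<Gamma>)" "finite (green_faces P \<R> \<Gamma>)"
  using planar_diagram_parts(2)[OF assms]
  unfolding internal_faces_def red_faces_def green_faces_def by simp_all

lemma coloured_diagram_parts:
  assumes "coloured_diagram P \<R> \<Gamma>"
  shows "planar_diagram \<Gamma>" "d \<in> darts \<Gamma> \<Longrightarrow> lab \<Gamma> d \<in> letters P"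
    "d \<in> darts \<Gamma> \<Longrightarrow> lab \<Gamma> (opp \<Gamma> d) = pinv P (lab \<Gamma> d)"
    "internal_faces \<Gamma> = red_faces P \<Gamma> \<union> green_faces P \<R> \<Gamma>"
  using assms unfolding coloured_diagram_def by auto

lemma component_diagram_faces:
  "red_faces P (component_diagram f g l b) =
    {F \<in> orbit f ` (conn {f, g} `` {b}) - {orbit f b}. \<exists>d\<in>F. fword f l d \<in> V_relators P}"
  "green_faces P \<R> (component_diagram f g l b) =
    {F \<in> orbit f ` (conn {f, g} `` {b}) - {orbit f b}. \<exists>d\<in>F. fword f l d \<in> sym_relators P \<R>}"
proof -
  have "face_word (component_diagram f g l b) e = fword f l e"
    if "F \<in> orbit f ` (conn {f, g} `` {b}) - {orbit f b}" "e \<in> F" for F e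
  proof -
    have "F \<in> orbit f ` (conn {f, g} `` {b})" using that(1) by simp
    then obtain d where "F = orbit f d" "d \<in> conn {f, g} `` {b}" by (rule imageE)
    then have "F \<subseteq> conn {f, g} `` {b}"
      using orbit_subset_closed[of d "conn {f, g} `` {b}" f] component_closed(1)[of f _ g b] by simp
    then show ?thesis
      using that(2) by (intro component_diagram_orbit(2)) (auto simp: component_diagram_def)
  qed
  then show "red_faces P (component_diagram f g l b) =
    {F \<in> orbit f ` (conn {f, g} `` {b}) - {orbit f b}. \<exists>d\<in>F. fword f l d \<in> V_relators P}"
  "green_faces P \<R> (component_diagram f g l b) =
    {F \<in> orbit f ` (conn {f, g} `` {b}) - {orbit f b}. \<exists>d\<in>F. fword f l d \<in> sym_relators P \<R>}"
    unfolding red_faces_def green_faces_def component_diagram_internal_faces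
    by (intro Collect_cong conj_cong refl bex_cong; simp)+
qed

lemma coloured_component_diagram:
  assumes m: "planar_map D f g" "b \<in> D"
    and l: "\<And>d. (b, d) \<in> conn {f, g} \<Longrightarrow> l d \<in> letters P \<and> l (g d) = pinv P (l d)"
    and W: "\<And>d. (b, d) \<in> conn {f, g} \<Longrightarrow> orbit f d \<noteq> orbit f b \<Longrightarrow>
      \<exists>e\<in>orbit f d. fword f l e \<in> V_relators P \<union> sym_relators P \<R>"
  shows "coloured_diagram P \<R> (component_diagram f g l b)"
  unfolding coloured_diagram_def
proof (intro conjI ballI)
  show "planar_diagram (component_diagram f g l b)" using m by (rule planar_component_diagram)
  show "internal_faces (component_diagram f g l b) =
    red_faces P (component_diagram f g l b) \<union> green_faces P \<R> (component_diagram f g l b)"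
    unfolding component_diagram_internal_faces component_diagram_faces using W by fastforce
  fix d assume "d \<in> darts (component_diagram f g l b)"
  then have "(b, d) \<in> conn {f, g}" by (simp add: component_diagram_def)
  then show "lab (component_diagram f g l b) d \<in> letters P"
    "lab (component_diagram f g l b) (opp (component_diagram f g l b) d) =
      pinv P (lab (component_diagram f g l b) d)"
    using l[of d] by (simp_all add: component_diagram_def perm_restrict_def)
qed

lemma CArea_less:
  assumes "planar_diagram \<Gamma>" "green_faces P \<R> \<Delta> \<subseteq> green_faces P \<R> \<Gamma>"
    "red_faces P \<Delta> \<subset> red_faces P \<Gamma>"
  shows "CArea P \<R> \<Delta> < CArea P \<R> \<Gamma>"
  using card_mono[OF finite_faces(3)[OF assms(1)] assms(2)]
    psubset_card_mono[OF finite_faces(2)[OF assms(1)] assms(3)]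
  by (simp add: CArea_def)

text \<open>Only the face of \<open>b\<close>, which becomes the external one, may be new. All other
  faces of the component are old internal faces with their old words, so no face changes colour, and
  the triangle \<open>T\<close> is lost.\<close>

lemma subdiagram:
  assumes \<Gamma>: "coloured_diagram P \<R> \<Gamma>" and m: "planar_map D f g" "b \<in> D"
    and l: "\<And>d. (b, d) \<in> conn {f, g} \<Longrightarrow> l d \<in> letters P \<and> l (g d) = pinv P (l d)"
    and W: "\<And>d. (b, d) \<in> conn {f, g} \<Longrightarrow> orbit f d \<noteq> orbit f b \<Longrightarrow>
      d \<in> darts \<Gamma> \<and> orbit (nxt \<Gamma>) d \<noteq> outer \<Gamma>"
    and eq: "\<And>d. d \<in> darts \<Gamma> \<Longrightarrow> f d = nxt \<Gamma> d \<and> l d = lab \<Gamma> d"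
    and T: "T \<in> red_faces P \<Gamma>" "\<And>d. d \<in> T \<Longrightarrow> (b, d) \<notin> conn {f, g}"
  shows "coloured_diagram P \<R> (component_diagram f g l b) \<and>
    CArea P \<R> (component_diagram f g l b) < CArea P \<R> \<Gamma>"
proof -
  note c = coloured_diagram_parts[OF \<Gamma>]
  note p = planar_diagram_parts[OF c(1)]
  have orb: "orbit f d = orbit (nxt \<Gamma>) d" "d \<in> darts \<Gamma>" "orbit (nxt \<Gamma>) d \<in> internal_faces \<Gamma>"
    if "(b, d) \<in> conn {f, g}" "orbit f d \<noteq> orbit f b" for d
  proof -
    show d: "d \<in> darts \<Gamma>" using W[OF that] by simp
    show "orbit f d = orbit (nxt \<Gamma>) d"
      by (intro orbit_cong0[of d "darts \<Gamma>", symmetric]) (use d eq p(4) in \<open>auto simp: permutes_in_image\<close>)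
    show "orbit (nxt \<Gamma>) d \<in> internal_faces \<Gamma>"
      using d W[OF that] by (simp add: internal_faces_def)
  qed
  have word: "fword f l e = face_word \<Gamma> e" if "e \<in> darts \<Gamma>" for e
    unfolding face_word_fword
    by (rule fword_cong[where A = "darts \<Gamma>"]) (use that eq p(4) in \<open>auto simp: permutes_in_image\<close>)
  have word': "fword f l e = face_word \<Gamma> e" if "d \<in> darts \<Gamma>" "e \<in> orbit (nxt \<Gamma>) d" for d e
    using word permutes_orbit_subset[OF p(4) that(1)] that(2) by blast
  have col: "coloured_diagram P \<R> (component_diagram f g l b)"
    using m l
  proof (rule coloured_component_diagram)
    fix d assume d: "(b, d) \<in> conn {f, g}" "orbit f d \<noteq> orbit f b"
    have "orbit (nxt \<Gamma>) d \<in> red_faces P \<Gamma> \<union> green_faces P \<R> \<Gamma>"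
      using orb(3)[OF d] c(4) by simp
    then obtain e where "e \<in> orbit (nxt \<Gamma>) d" "face_word \<Gamma> e \<in> V_relators P \<union> sym_relators P \<R>"
      unfolding red_faces_def green_faces_def by blast
    then show "\<exists>e\<in>orbit f d. fword f l e \<in> V_relators P \<union> sym_relators P \<R>"
      using orb(1,2)[OF d] word'[of d e] by (intro bexI[of _ e]) simp_all
  qed
  define X where "X = orbit f ` (conn {f, g} `` {b}) - {orbit f b}"
  note faces = component_diagram_faces[where f = f and g = g and b = b, folded X_def]
  have sub: "F \<in> internal_faces \<Gamma> \<and> (\<exists>d. (b, d) \<in> conn {f, g} \<and> F = orbit (nxt \<Gamma>) d) \<and>
      (\<forall>e\<in>F. fword f l e = face_word \<Gamma> e)"
    if "F \<in> X" for F
  proof -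
    have "F \<in> orbit f ` (conn {f, g} `` {b})" "F \<noteq> orbit f b" using that by (simp_all add: X_def)
    from this(1) obtain d where d: "F = orbit f d" "d \<in> conn {f, g} `` {b}" by (rule imageE)
    then have "(b, d) \<in> conn {f, g}" "orbit f d \<noteq> orbit f b" using \<open>F \<noteq> orbit f b\<close> by simp_all
    from orb[OF this] this(1) show ?thesis using word'[of d] d(1) by auto
  qed
  have "CArea P \<R> (component_diagram f g l b) < CArea P \<R> \<Gamma>"
  proof (rule CArea_less[OF c(1)])
    show "green_faces P \<R> (component_diagram f g l b) \<subseteq> green_faces P \<R> \<Gamma>"
      unfolding faces using sub by (auto simp: green_faces_def)
    have "red_faces P (component_diagram f g l b) \<subseteq> red_faces P \<Gamma>"
      unfolding faces using sub by (auto simp: red_faces_def)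
    moreover have "T \<notin> red_faces P (component_diagram f g l b)"
    proof
      assume "T \<in> red_faces P (component_diagram f g l b)"
      then obtain d where d: "(b, d) \<in> conn {f, g}" "T = orbit (nxt \<Gamma>) d"
        unfolding faces using sub by blast
      then show False using T(2)[of d] self_in_orbit[OF p(2,4)] by blast
    qed
    ultimately show "red_faces P (component_diagram f g l b) \<subset> red_faces P \<Gamma>"
      using T(1) by blast
  qed
  then show ?thesis using col by simp
qed

section \<open>Triangles in pregroups\<close>

definition triangle :: "'a pregroup \<Rightarrow> 'a \<Rightarrow> 'a \<Rightarrow> 'a \<Rightarrow> bool" where
  "triangle P a b c \<longleftrightarrow> a \<in> letters P \<and> b \<in> letters P \<and> c \<in> letters P \<and>
     (a, b) \<in> pdom P \<and> pmult P a b = pinv P c"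

lemma V_relators_length: "v \<in> V_relators P \<Longrightarrow> length v = 3"
  by (auto simp: V_relators_def)

context
  fixes P :: "'a pregroup"
  assumes P: "is_pregroup P"
begin

lemma pregroup_one: "pone P \<in> pset P"
  using P unfolding is_pregroup_def Let_def by (elim conjE) assumption

lemma pregroup_dom:
  assumes "(x, y) \<in> pdom P"
  shows "x \<in> pset P" "y \<in> pset P"
proof -
  have "pdom P \<subseteq> pset P \<times> pset P"
    using P unfolding is_pregroup_def Let_def by (elim conjE)
  then show "x \<in> pset P" "y \<in> pset P" using assms by auto
qed

lemma pregroup_mult_closed: "(x, y) \<in> pdom P \<Longrightarrow> pmult P x y \<in> pset P"
  using P unfolding is_pregroup_def Let_def by (elim conjE) (drule (1) bspec, simp)

lemma pregroup_inv:
  assumes "x \<in> pset P"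
  shows "pinv P x \<in> pset P" "pinv P (pinv P x) = x"
proof -
  have "\<forall>x \<in> pset P. pinv P x \<in> pset P \<and> pinv P (pinv P x) = x"
    using P unfolding is_pregroup_def Let_def by (elim conjE)
  then show "pinv P x \<in> pset P" "pinv P (pinv P x) = x" using assms by auto
qed

lemma pregroup_P1:
  assumes "x \<in> pset P"
  shows "(pone P, x) \<in> pdom P \<and> (x, pone P) \<in> pdom P \<and>
     pmult P (pone P) x = x \<and> pmult P x (pone P) = x"
  using P assms unfolding is_pregroup_def Let_def by (elim conjE) blast

lemma pregroup_P2:
  assumes "x \<in> pset P"
  shows "(x, pinv P x) \<in> pdom P \<and> (pinv P x, x) \<in> pdom P \<and>
     pmult P x (pinv P x) = pone P \<and> pmult P (pinv P x) x = pone P"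
  using P assms unfolding is_pregroup_def Let_def by (elim conjE) blast

lemma pregroup_P3:
  assumes "(x, y) \<in> pdom P"
  shows "(pinv P y, pinv P x) \<in> pdom P \<and> pinv P (pmult P x y) = pmult P (pinv P y) (pinv P x)"
  using P assms unfolding is_pregroup_def Let_def by (elim conjE) blast

lemma pregroup_P4:
  assumes "(x, y) \<in> pdom P" "(y, z) \<in> pdom P"
  shows "(pmult P x y, z) \<in> pdom P \<longleftrightarrow> (x, pmult P y z) \<in> pdom P"
    "(pmult P x y, z) \<in> pdom P \<Longrightarrow> pmult P (pmult P x y) z = pmult P x (pmult P y z)"
  using P assms unfolding is_pregroup_def Let_def by blast+

lemma pregroup_P5:
  assumes "(x, y) \<in> pdom P" "(y, z) \<in> pdom P" "(z, t) \<in> pdom P"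
  shows "(pmult P x y, z) \<in> pdom P \<or> (pmult P y z, t) \<in> pdom P"
  using P assms unfolding is_pregroup_def Let_def by blast

lemma pinv_one: "pinv P (pone P) = pone P"
  using pregroup_P2[OF pregroup_one] pregroup_P1[OF pregroup_inv(1)[OF pregroup_one]] by simp

lemma pinv_letters: "x \<in> letters P \<Longrightarrow> pinv P x \<in> letters P"
  using pregroup_inv[of x] pinv_one by (auto simp: letters_def)

lemma pinv_pinv: "x \<in> letters P \<Longrightarrow> pinv P (pinv P x) = x"
  using pregroup_inv[of x] by (auto simp: letters_def)

text \<open>(P4) for the inverse of \<open>x\<close>, \<open>x\<close> and \<open>y\<close>:
  bracketing on the left gives \<open>y\<close>, bracketing on the right gives the inverse of
  \<open>x\<close>.\<close>

lemma mult_eq_one: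
  assumes "(x, y) \<in> pdom P" "pmult P x y = pone P"
  shows "y = pinv P x"
proof -
  note d = pregroup_dom[OF assms(1)]
  have x: "(pinv P x, x) \<in> pdom P" "pmult P (pinv P x) x = pone P"
    using pregroup_P2[of x] d by simp_all
  have "(pmult P (pinv P x) x, y) \<in> pdom P" using x(2) pregroup_P1[of y] d by simp
  then have "pmult P (pone P) y = pmult P (pinv P x) (pone P)"
    using pregroup_P4(2)[OF x(1) assms(1)] x(2) assms(2) by simp
  then show ?thesis using d pregroup_P1[of y] pregroup_P1[of "pinv P x"] pregroup_inv(1)[of x] by simp
qed

lemma V_relators_iff_triangle: "[a, b, c] \<in> V_relators P \<longleftrightarrow> triangle P a b c"
proof
  assume "[a, b, c] \<in> V_relators P"
  then have *: "a \<in> letters P" "b \<in> letters P" "(a, b) \<in> pdom P" "a \<noteq> pinv P b" "c = pinv P (pmult P a b)"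
    by (auto simp: V_relators_def)
  have "pmult P a b \<noteq> pone P"
    using mult_eq_one[OF *(3)] *(4) pinv_pinv[OF *(1)] by metis
  then have "pmult P a b \<in> letters P" using pregroup_mult_closed[OF *(3)] by (simp add: letters_def)
  then show "triangle P a b c"
    using * by (simp add: triangle_def pinv_pinv pinv_letters)
next
  assume t: "triangle P a b c"
  have "a \<noteq> pinv P b"
  proof
    assume "a = pinv P b"
    then have "pinv P c = pone P"
      using t pregroup_P2[of b] by (simp add: triangle_def letters_def)
    then show False using t pinv_letters[of c] by (simp add: triangle_def letters_def)
  qed
  moreover have "pinv P (pmult P a b) = c" using t pinv_pinv[of c] by (simp add: triangle_def)
  ultimately show "[a, b, c] \<in> V_relators P" using t by (auto simp: triangle_def V_relators_def)
qed

text \<open>By (P3) the letter \<open>c\<close> is the inverse of \<open>b\<close> times the inverse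
  of \<open>a\<close>. Multiplying by \<open>b\<close> on the left and rebracketing by (P4) leaves
  the inverse of \<open>a\<close>.\<close>

lemma triangle_rotate:
  assumes "triangle P a b c"
  shows "triangle P b c a"
proof -
  have ab: "(a, b) \<in> pdom P" "pmult P a b = pinv P c" and l: "a \<in> letters P" "b \<in> letters P" "c \<in> letters P"
    using assms by (simp_all add: triangle_def)
  have s: "a \<in> pset P" "b \<in> pset P" "c \<in> pset P" using l by (simp_all add: letters_def)
  have c: "c = pmult P (pinv P b) (pinv P a)" "(pinv P b, pinv P a) \<in> pdom P"
    using pregroup_P3[OF ab(1)] ab(2) pregroup_inv(2)[OF s(3)] by simp_all
  have b: "(b, pinv P b) \<in> pdom P" "pmult P b (pinv P b) = pone P" using pregroup_P2[OF s(2)] by simp_all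
  have a: "(pone P, pinv P a) \<in> pdom P" "pmult P (pone P) (pinv P a) = pinv P a"
    using pregroup_P1[OF pregroup_inv(1)[OF s(1)]] by simp_all
  have "(b, c) \<in> pdom P \<and> pmult P b c = pinv P a"
    using pregroup_P4[OF b(1) c(2)] a b(2) c(1) by simp
  then show ?thesis using l by (simp add: triangle_def)
qed

text \<open>In the following lemmas \<open>e\<^sub>1, e\<^sub>2, \<dots>\<close> label consecutive spokes of a star of triangles whose
  outer edges are labelled \<open>a, b, \<dots>\<close>.\<close>

lemma triangle_quotient:
  assumes "triangle P e1 a (pinv P e2)" "e2 \<in> letters P"
  shows "(pinv P e1, e2) \<in> pdom P" "pmult P (pinv P e1) e2 = a"
proof -
  have "triangle P (pinv P e2) e1 a" using triangle_rotate[OF triangle_rotate[OF assms(1)]] .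
  then have *: "(pinv P e2, e1) \<in> pdom P" "pmult P (pinv P e2) e1 = pinv P a" "a \<in> letters P"
    by (simp_all add: triangle_def)
  then show "(pinv P e1, e2) \<in> pdom P" "pmult P (pinv P e1) e2 = a"
    using pregroup_P3[OF *(1)] pinv_pinv[OF *(3)] pinv_pinv[OF assms(2)] by simp_all
qed

text \<open>Excludes a star of degree one: its rim label would be the quotient of \<open>e\<close>
  by itself, which is 1 and so not a letter.\<close>

lemma triangle_spokes_distinct:
  assumes "triangle P e a (pinv P e)" "e \<in> letters P"
  shows False
  using triangle_quotient(2)[OF assms] pregroup_P2[of e] assms by (simp add: triangle_def letters_def)

text \<open>The star of degree two: the rim labels are the quotient of the two spokes and the same
  quotient in the opposite order.\<close>

lemma triangle_spokes_two:
  assumes "triangle P e1 a (pinv P e2)" "triangle P e2 b (pinv P e1)" "e1 \<in> letters P" "e2 \<in> letters P"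
  shows "b = pinv P a"
  using triangle_quotient[OF assms(1,4)] triangle_quotient[OF assms(2,3)]
    pregroup_P3[OF triangle_quotient(1)[OF assms(1,4)]] pinv_pinv[OF assms(3)] by simp

text \<open>(P5) is applied to \<open>a\<close>, the inverse of \<open>e2\<close>, \<open>e3\<close>
  and \<open>c\<close>, where the product of the middle two is \<open>b\<close>. The second
  alternative is literally \<open>(b, c)\<close>; the first becomes \<open>(a, b)\<close> after
  rebracketing by (P4).\<close>

lemma triangle_spokes_P5:
  assumes "triangle P e1 a (pinv P e2)" "triangle P e2 b (pinv P e3)" "triangle P e3 c (pinv P e4)"
    "e1 \<in> letters P" "e2 \<in> letters P" "e3 \<in> letters P"
  shows "(a, b) \<in> pdom P \<or> (b, c) \<in> pdom P"
proof -
  have "triangle P a (pinv P e2) e1" using assms(1) by (rule triangle_rotate)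
  then have a: "(a, pinv P e2) \<in> pdom P" by (simp add: triangle_def)
  note b = triangle_quotient[OF assms(2,6)]
  have c: "(e3, c) \<in> pdom P" using assms(3) by (simp add: triangle_def)
  show ?thesis
    using pregroup_P5[OF a b(1) c] pregroup_P4(1)[OF a b(1)] b(2) by auto
qed

text \<open>The triangles say \<open>e1 a = e2\<close> and \<open>e2 b = e3\<close>, which (P4)
  combines to \<open>e1 (a b) = e3\<close>. A trivial product identifies the outer spokes; otherwise
  it labels the other diagonal of the quadrilateral.\<close>

lemma triangle_flip:
  assumes "triangle P e1 a (pinv P e2)" "triangle P e2 b (pinv P e3)" "(a, b) \<in> pdom P"
    "e2 \<in> letters P" "e3 \<in> letters P"
  shows "pmult P a b = pone P \<Longrightarrow> b = pinv P a \<and> e3 = e1"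
    "pmult P a b \<noteq> pone P \<Longrightarrow> pmult P a b \<in> letters P \<and>
       triangle P a b (pinv P (pmult P a b)) \<and> triangle P e1 (pmult P a b) (pinv P e3)"
proof -
  have 1: "(e1, a) \<in> pdom P" "pmult P e1 a = e2" and 2: "(e2, b) \<in> pdom P" "pmult P e2 b = e3"
    using assms by (simp_all add: triangle_def pinv_pinv)
  have *: "(e1, pmult P a b) \<in> pdom P" "pmult P e1 (pmult P a b) = e3"
    using pregroup_P4[OF 1(1) assms(3)] 1 2 by simp_all
  have e1: "e1 \<in> pset P" using assms(1) by (simp add: triangle_def letters_def)
  show "b = pinv P a \<and> e3 = e1" if "pmult P a b = pone P"
    using mult_eq_one[OF assms(3) that] * that pregroup_P1[OF e1] by simp
  show "pmult P a b \<in> letters P \<and> triangle P a b (pinv P (pmult P a b)) \<and>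
      triangle P e1 (pmult P a b) (pinv P e3)" if "pmult P a b \<noteq> pone P"
  proof -
    have "pmult P a b \<in> letters P" using that pregroup_mult_closed[OF assms(3)] by (simp add: letters_def)
    then show ?thesis
      using assms * by (simp add: triangle_def pinv_pinv pinv_letters)
  qed
qed

end

text \<open>Consecutive letters of a relator, and by (P3) of its inverse, never have a product in
  \<open>P\<close>, whereas those of a triangle do. This ensures that the triangles created by a
  flip do not count as green.\<close>

lemma triangle_not_sym_relator:
  assumes "pregroup_presentation P \<R>" "triangle P a b c"
  shows "[a, b, c] \<notin> sym_relators P \<R>"
proof
  have P: "is_pregroup P" and red: "u \<in> \<R> \<Longrightarrow> P_reduced P u" for u
    using assms(1) by (auto simp: pregroup_presentation_def cyclically_P_reduced_def)
  have ab: "(a, b) \<in> pdom P" using assms(2) by (simp add: triangle_def)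
  assume "[a, b, c] \<in> sym_relators P \<R>"
  then consider "[a, b, c] \<in> \<R>" | u where "u \<in> \<R>" "[a, b, c] = inv_word P u"
    by (auto simp: sym_relators_def)
  then show False
  proof cases
    case 1
    then have "\<forall>i. Suc i < 3 \<longrightarrow> ([a, b, c] ! i, [a, b, c] ! Suc i) \<notin> pdom P"
      using red[of "[a, b, c]"] by (simp add: P_reduced_def)
    then show False using ab by (elim allE[of _ 0]) simp
  next
    case 2
    have "length u = 3" using arg_cong[OF 2(2), of length] by (simp add: inv_word_def)
    then obtain p q r where u: "u = [p, q, r]" by (auto simp: length_Suc_conv numeral_3_eq_3)
    have "\<forall>i. Suc i < 3 \<longrightarrow> (u ! i, u ! Suc i) \<notin> pdom P" "q \<in> letters P" "r \<in> letters P"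
      using red[OF 2(1)] u by (simp_all add: P_reduced_def)
    then have "(q, r) \<notin> pdom P" "q \<in> letters P" "r \<in> letters P" using u by (auto elim!: allE[of _ 1])
    moreover have "a = pinv P r" "b = pinv P q" using 2(2) u by (simp_all add: inv_word_def)
    ultimately show False using pregroup_P3[OF P ab] pinv_pinv[OF P] by simp
  qed
qed

section \<open>Triangular faces\<close>

lemma funpow_card_orbit:
  assumes "x \<in> orbit f x"
  shows "(f ^^ card (orbit f x)) x = x"
proof -
  have "card (orbit f x) = funpow_dist1 f x x"
    using orbit_conv_funpow_dist1[OF assms] inj_on_funpow_dist1[OF assms] by (simp add: card_image)
  then show ?thesis using funpow_dist1_prop[OF assms] by simp
qed

lemma orbit_three:
  assumes "f a = b" "f b = c" "f c = a"
  shows "orbit f a = {a, b, c}"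
proof
  show "orbit f a \<subseteq> {a, b, c}" by (rule orbit_subset_closed) (use assms in auto)
  have "b \<in> orbit f a" using orbit.base[of f a] assms by simp
  moreover from this have "c \<in> orbit f a" using orbit.step[of b f a] assms by simp
  moreover from this have "a \<in> orbit f a" using orbit.step[of c f a] assms by simp
  ultimately show "{a, b, c} \<subseteq> orbit f a" by blast
qed

lemma fword_three:
  assumes "f a = b" "f b = c" "f c = a" "a \<noteq> b" "b \<noteq> c" "a \<noteq> c"
  shows "card (orbit f a) = 3" "fword f l a = [l a, l b, l c]"
proof -
  show "card (orbit f a) = 3" using orbit_three[OF assms(1-3)] assms(4-6) by simp
  then show "fword f l a = [l a, l b, l c]"
    using assms by (simp add: fword_def upt_rec numeral_2_eq_2)
qed

lemma orbit_card_three: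
  assumes "x \<in> orbit f x" "card (orbit f x) = 3"
  shows "f (f (f x)) = x" "orbit f x = {x, f x, f (f x)}" "x \<noteq> f x" "f x \<noteq> f (f x)" "x \<noteq> f (f x)"
proof -
  show 1: "f (f (f x)) = x" using funpow_card_orbit[OF assms(1)] assms(2) by (simp add: eval_nat_numeral)
  show 2: "orbit f x = {x, f x, f (f x)}" by (rule orbit_three) (simp_all add: 1)
  have "card {x, f x, f (f x)} = 3" using 2 assms(2) by simp
  then show "x \<noteq> f x" "f x \<noteq> f (f x)" "x \<noteq> f (f x)" by (auto simp: card_insert_if split: if_splits)
qed

text \<open>The defining relator may start at any of the three darts; invariance of triangles under
  rotation frees the statement from that choice.\<close>

lemma red_face:
  assumes P: "is_pregroup P" and \<Gamma>: "planar_diagram \<Gamma>" and F: "orbit (nxt \<Gamma>) d \<in> red_faces P \<Gamma>"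
  shows "card (orbit (nxt \<Gamma>) d) = 3" "triangle P (lab \<Gamma> d) (lab \<Gamma> (nxt \<Gamma> d)) (lab \<Gamma> (nxt \<Gamma> (nxt \<Gamma> d)))"
proof -
  note p = planar_diagram_parts(2,4)[OF \<Gamma>]
  obtain e where e: "e \<in> orbit (nxt \<Gamma>) d" "face_word \<Gamma> e \<in> V_relators P"
    using F by (auto simp: red_faces_def)
  have oe: "orbit (nxt \<Gamma>) e = orbit (nxt \<Gamma>) d" using p e(1) by (rule orbit_mem_eq)
  have "length (face_word \<Gamma> e) = 3" using e(2) by (rule V_relators_length)
  then have c: "card (orbit (nxt \<Gamma>) e) = 3" by (simp add: face_word_def)
  then show "card (orbit (nxt \<Gamma>) d) = 3" using oe by simp
  note o = orbit_card_three[OF self_in_orbit[OF p] c]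
  have "face_word \<Gamma> e = [lab \<Gamma> e, lab \<Gamma> (nxt \<Gamma> e), lab \<Gamma> (nxt \<Gamma> (nxt \<Gamma> e))]"
    unfolding face_word_fword using o by (intro fword_three(2)) auto
  then have t: "triangle P (lab \<Gamma> e) (lab \<Gamma> (nxt \<Gamma> e)) (lab \<Gamma> (nxt \<Gamma> (nxt \<Gamma> e)))"
    using e(2) V_relators_iff_triangle[OF P] by simp
  have "d \<in> {e, nxt \<Gamma> e, nxt \<Gamma> (nxt \<Gamma> e)}"
    using self_in_orbit[OF p, of d] oe o(2) by simp
  then show "triangle P (lab \<Gamma> d) (lab \<Gamma> (nxt \<Gamma> d)) (lab \<Gamma> (nxt \<Gamma> (nxt \<Gamma> d)))"
    using t triangle_rotate[OF P t] triangle_rotate[OF P triangle_rotate[OF P t]] o(1) by auto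
qed

section \<open>Cutting along a loop\<close>

lemma permutes_closed_iff:
  assumes "f permutes D" "finite U" "\<And>z. z \<in> U \<Longrightarrow> f z \<in> U"
  shows "f z \<in> U \<longleftrightarrow> z \<in> U"
proof
  have inj: "inj f" using assms(1) by (rule permutes_inj)
  have "f ` U = U" using assms(2,3) inj by (intro endo_inj_surj) (auto intro: inj_on_subset)
  then show "f z \<in> U \<Longrightarrow> z \<in> U" using inj_image_mem_iff[OF inj, of z U] by simp
qed (rule assms(3))

lemma conn_transpose_comp_mono:
  assumes "(x, y) \<in> conn {transpose x y \<circ> h}" "(u, v) \<in> conn {h}"
  shows "(u, v) \<in> conn {transpose x y \<circ> h}"
  using assms(2)
proof (rule conn_subset)
  fix f z assume "f \<in> {h}"
  define t where "t = transpose x y \<circ> h"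
  have "(z, t z) \<in> conn {t}" by (rule conn_step) simp
  moreover have "(t z, h z) \<in> conn {t}"
    using assms(1) conn_sym[OF assms(1)] unfolding t_def[symmetric]
    by (cases "h z = x"; cases "h z = y") (simp_all add: t_def)
  ultimately have "(z, h z) \<in> conn {t}" by (rule conn_trans)
  then show "(z, f z) \<in> conn {transpose x y \<circ> h}" using \<open>f \<in> {h}\<close> by (simp add: t_def)
qed

text \<open>The edge with darts \<open>p\<close>, \<open>q\<close> is doubled: \<open>p\<close> is
  paired with a new dart \<open>x\<close>, and \<open>q\<close> with a new dart \<open>y\<close>. As
  \<open>f\<close> fixes \<open>x\<close> and \<open>y\<close>, each of them is a face of length
  one: the sphere is cut along the loop and both holes are capped by monogons.\<close>

definition cut_loop :: "('d \<Rightarrow> 'd) \<Rightarrow> 'd \<Rightarrow> 'd \<Rightarrow> 'd \<Rightarrow> 'd \<Rightarrow> 'd \<Rightarrow> 'd" where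
  "cut_loop g p q x y z =
     (if z = p then x else if z = x then p else if z = q then y else if z = y then q else g z)"

text \<open>Doubling a loop separates the two sides: both the vertex and the edge split, so a map of
  defect 0 must fall into two components.\<close>
lemma cut_loop_planar_map:
  assumes m: "planar_map D f g" and p: "p \<in> D" and q: "q = g p" and pq: "(p, q) \<in> conn {f \<circ> g}"
    and xy: "x \<notin> D" "y \<notin> D" "x \<noteq> y"
  shows "planar_map (insert x (insert y D)) f (cut_loop g p q x y)"
    "(p, y) \<notin> conn {f, cut_loop g p q x y}"
proof -
  let ?E = "insert x (insert y D)" and ?g = "cut_loop g p q x y"
  note P = planar_mapD[OF m]
  have qD: "q \<in> D" "g q = p" "q \<noteq> p" using p q P by (simp_all add: permutes_in_image)
  have ne: "x \<noteq> p" "x \<noteq> q" "y \<noteq> p" "y \<noteq> q" using xy p qD by auto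
  have finE: "finite ?E" using P(1) by simp
  have DE: "D \<subseteq> ?E" by blast
  have f: "f permutes ?E" and gE: "g permutes ?E"
    using permutes_subset[OF P(2) DE] permutes_subset[OF P(3) DE] by simp_all
  have fix_: "f x = x" "f y = y" "g x = x" "g y = y" using P(2,3) xy by (simp_all add: permutes_not_in)
  have cl: "f z \<in> D \<longleftrightarrow> z \<in> D" "g z \<in> D \<longleftrightarrow> z \<in> D" for z
    using P(2,3) by (simp_all add: permutes_in_image)
  have "?E - D = {x, y}" using xy by auto
  moreover have "perm_restrict f {x, y} = id" "perm_restrict g {x, y} = id"
    using fix_ by (auto simp: perm_restrict_def)
  moreover have "defect {x, y} id id = 0"
    using xy by (simp add: defect_def ncls_def Image_singleton)
  ultimately have d0: "defect ?E f g \<le> 0"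
    using defect_Un[OF f gE finE DE cl] P by simp
  \<comment> \<open>The new darts start as two isolated spheres of defect 0; joining them to one
    isolated edge links different components.\<close>
  let ?h = "transpose x y \<circ> g"
  have g0: "?h permutes ?E" using gE by (rule permutes_transpose_comp) simp_all
  have "(x, y) \<notin> conn {f, g}"
  proof
    assume "(x, y) \<in> conn {f, g}"
    then have "x \<in> {x} \<longleftrightarrow> y \<in> {x}"
    proof (rule conn_closed[rotated])
      fix h z assume "h \<in> {f, g}"
      then have "h permutes ?E" "h x = x" using f gE fix_ by auto
      then show "h z \<in> {x} \<longleftrightarrow> z \<in> {x}" by (intro permutes_closed_iff[of _ ?E]) auto
    qed
    then show False using xy by simp
  qed
  then have d1: "defect ?E f ?h \<le> 0"
    using defect_transpose_comp_le_right[OF finE f gE, of x y] d0 by simp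
  have g0v: "?h p = q" "?h q = p" "?h x = y" "?h y = x" "z \<in> D \<Longrightarrow> ?h z = g z" for z
  proof -
    show *: "?h z = g z" if "z \<in> D" for z
      using xy that cl(2)[of z] by (metis comp_apply transpose_apply_other)
    show "?h p = q" "?h q = p" using *[OF p] *[OF qD(1)] q qD by simp_all
  qed (simp_all add: fix_)
  \<comment> \<open>Hooking that edge to the loop, again across components, makes \<open>p\<close>,
    \<open>x\<close>, \<open>y\<close>, \<open>q\<close> a 4-cycle of the edge permutation. The
    final transposition of \<open>p\<close> and \<open>y\<close> will split it into the pairs
    \<open>p\<close>, \<open>x\<close> and \<open>q\<close>, \<open>y\<close>.\<close>
  let ?g1 = "transpose q x \<circ> ?h"
  have g1: "?g1 permutes ?E" using g0 by (rule permutes_transpose_comp) (use qD in simp_all)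
  have "(q, x) \<notin> conn {f, ?h}"
  proof
    assume "(q, x) \<in> conn {f, ?h}"
    then have "q \<in> D \<longleftrightarrow> x \<in> D"
    proof (rule conn_closed[rotated])
      fix h z assume h: "h \<in> {f, ?h}"
      have "?h z \<in> D" if "z \<in> D" for z using g0v(5)[OF that] iffD2[OF cl(2) that] by simp
      then have hD: "h z \<in> D" if "z \<in> D" for z
        using h that iffD2[OF cl(1), OF that] by blast
      have "h permutes ?E" using h f g0 by blast
      then show "h z \<in> D \<longleftrightarrow> z \<in> D" using P(1) hD by (rule permutes_closed_iff)
    qed
    then show False using xy qD by simp
  qed
  note nc = this
  have d2: "defect ?E f ?g1 \<le> 0"
    using defect_transpose_comp_le_right[OF finE f g0, of q x] d1 nc qD by simp
  have d2': "defect ?E f ?g1 = 0"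
    using d2 defect_nonneg[OF finE f g1] by simp
  have g1v: "?g1 p = x" "?g1 x = y" "?g1 q = p" "?g1 y = q"
    using g0v(1-4) ne qD(3) xy(3) by simp_all
  have c1: "(p, y) \<in> conn {?g1}"
  proof -
    have "(z, ?g1 z) \<in> conn {?g1}" for z by (rule conn_step) (rule insertI1)
    from this[of p] this[of x] show ?thesis unfolding g1v by (rule conn_trans)
  qed
  have h: "?h \<circ> f permutes ?E" using f g0 by (rule permutes_compose)
  have "(q, x) \<notin> conn {?h \<circ> f}"
    using nc conn_comp[of q x ?h f] unfolding insert_commute[of ?h f] by blast
  then have qx: "(q, x) \<in> conn {transpose q x \<circ> (?h \<circ> f)}"
    using conn_transpose_comp[OF finE h, of q x] qD ne by simp
  have pq0: "(p, q) \<in> conn {?h \<circ> f}"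
  proof -
    have "(g q, g p) \<in> conn {g \<circ> f}" using conn_comp_swap[OF conn_sym[OF pq]] .
    then have pq': "(p, q) \<in> conn {g \<circ> f}" using q qD by simp
    have gf: "g \<circ> f permutes D" using P(2,3) by (rule permutes_compose)
    have "orbit (g \<circ> f) p = orbit (?h \<circ> f) p"
      using cl g0v(5) p by (intro orbit_cong0[of p D]) auto
    then show ?thesis using pq' conn_singleton[OF P(1) gf] conn_singleton[OF finE h] by metis
  qed
  have xy0: "(x, y) \<in> conn {?h \<circ> f}"
    using conn_step[of "?h \<circ> f" "{?h \<circ> f}" x] g0v(3) fix_ by simp
  note mono = conn_transpose_comp_mono[OF qx]
  \<comment> \<open>The second condition for disconnecting: \<open>p\<close> and \<open>q\<close>
    share a cycle because the edge is a loop, the hook merged the cycles of \<open>q\<close> and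
    \<open>x\<close>, and \<open>x\<close> is followed by \<open>y\<close>.\<close>
  have c2: "(p, y) \<in> conn {?g1 \<circ> f}"
    using conn_trans[OF mono[OF pq0] conn_trans[OF qx mono[OF xy0]]] by (simp add: comp_assoc)
  let ?g2 = "transpose p y \<circ> ?g1"
  have g2: "?g2 permutes ?E" using g1 by (rule permutes_transpose_comp) (use p in simp_all)
  have eq: "?g2 = ?g"
  proof
    fix z
    have inj: "?g1 z = ?g1 u \<longleftrightarrow> z = u" for u
      using permutes_inj[OF g1] by (rule inj_eq)
    consider "z = p" | "z = x" | "z = q" | "z = y" | "z \<noteq> p" "z \<noteq> x" "z \<noteq> q" "z \<noteq> y" by blast
    then show "?g2 z = ?g z"
    proof cases
      case 5
      then have "?g1 z \<noteq> p" "?g1 z \<noteq> y" using inj[of q] inj[of x] g1v by auto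
      then have "?g2 z = ?g1 z" unfolding comp_apply by (intro transpose_apply_other) simp_all
      also have "\<dots> = g z"
      proof (cases "z \<in> D")
        case True
        have "g z \<noteq> q" "g z \<noteq> x"
          using 5 True cl(2)[of z] xy P(6)[OF True] qD by auto
        then have "?g1 z = ?h z" using g0v(5)[OF True] by simp
        then show ?thesis using g0v(5)[OF True] by (rule trans)
      next
        case False
        then have gz: "g z = z" using P(3) by (simp add: permutes_not_in)
        then have "?h z = z" using 5 by simp
        then show ?thesis using 5 gz by simp
      qed
      finally have e: "?g2 z = g z" .
      have "g z = ?g z" using 5 by (simp add: cut_loop_def)
      with e show ?thesis by (rule trans)
    qed (use g1v ne qD(3) xy(3) in \<open>simp_all add: cut_loop_def\<close>)
  qed
  have d3: "defect ?E f ?g \<le> 0"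
    using defect_transpose_comp_le_right[OF finE f g1, of p y] d2 c1 p eq by simp
  have "(p, y) \<notin> conn {f, ?g2}"
    using defect_split_disconnects[OF finE f g1 _ _ _ c1 c2 d2'] p ne by simp
  then show "(p, y) \<notin> conn {f, ?g}" unfolding eq .
  have "?g d \<noteq> d \<and> ?g (?g d) = d" if "d \<in> ?E" for d
  proof (cases "d \<in> {p, q, x, y}")
    case True
    then show ?thesis using ne qD(3) xy(3) by (auto simp: cut_loop_def)
  next
    case False
    then have d: "d \<in> D" "g d \<in> D" using that cl by auto
    then have "g d \<noteq> p" "g d \<noteq> q" "g d \<noteq> x" "g d \<noteq> y"
      using False xy P(6)[OF d(1)] q qD by auto
    then show ?thesis using False P(5,6)[OF d(1)] by (simp add: cut_loop_def)
  qed
  then show "planar_map ?E f ?g"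
    unfolding planar_map_def using finE f g2[unfolded eq] d3 by blast
qed

lemma conn_orbit: "d' \<in> orbit f d \<Longrightarrow> (d, d') \<in> conn {f, g}"
proof (induction rule: orbit.induct)
  case base show ?case by (rule conn_step) simp
next
  case (step z) show ?case by (rule conn_trans[OF step(2)]) (rule conn_step, simp)
qed

text \<open>The component of \<open>x\<close> is kept, with the monogon \<open>x\<close> as its
  external face. It contains \<open>p\<close> but not \<open>q\<close>, so it lacks the triangle at
  \<open>q\<close>; the edge of \<open>p\<close> and \<open>x\<close> is still a loop, since the
  rotation sends \<open>p\<close> to \<open>x\<close>.\<close>

lemma cut_loop_side:
  assumes \<Gamma>: "coloured_diagram P \<R> \<Gamma>" and p: "p \<in> darts \<Gamma>" "q = opp \<Gamma> p"
    and V: "V_letter P (lab \<Gamma> p)" and T: "orbit (nxt \<Gamma>) q \<in> red_faces P \<Gamma>"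
    and xy: "x \<notin> darts \<Gamma>" "y \<notin> darts \<Gamma>" "x \<noteq> y"
    and m: "planar_map (insert x (insert y (darts \<Gamma>))) (nxt \<Gamma>) (cut_loop (opp \<Gamma>) p q x y)"
    and disc: "(p, y) \<notin> conn {nxt \<Gamma>, cut_loop (opp \<Gamma>) p q x y}"
    and out: "b \<in> darts \<Gamma>" "outer \<Gamma> = orbit (nxt \<Gamma>) b"
      "(x, b) \<notin> conn {nxt \<Gamma>, cut_loop (opp \<Gamma>) p q x y}"
  shows "\<exists>\<Delta>. coloured_diagram P \<R> \<Delta> \<and> has_V_loop P \<Delta> \<and> CArea P \<R> \<Delta> < CArea P \<R> \<Gamma>"
proof -
  let ?g = "cut_loop (opp \<Gamma>) p q x y" and ?f = "nxt \<Gamma>"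
  let ?l = "(lab \<Gamma>)(x := lab \<Gamma> q, y := lab \<Gamma> p)"
  let ?\<Delta> = "component_diagram ?f ?g ?l x"
  note c = coloured_diagram_parts[OF \<Gamma>]
  note pl = planar_diagram_parts[OF c(1)]
  have q: "q \<in> darts \<Gamma>" "opp \<Gamma> q = p" "q \<noteq> p" "lab \<Gamma> q = pinv P (lab \<Gamma> p)" "lab \<Gamma> p = pinv P (lab \<Gamma> q)"
    using p pl(3,5,6) c(3)[of p] c(3)[of q] by (simp_all add: permutes_in_image)
  have ne: "x \<noteq> p" "x \<noteq> q" "y \<noteq> p" "y \<noteq> q" using xy p q by auto
  have gv: "?g p = x" "?g x = p" "?g q = y" "?g y = q"
    using ne q(3) xy(3) by (simp_all add: cut_loop_def)
  have fx: "?f x = x" using pl(4) xy by (simp add: permutes_not_in)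
  have xp: "(x, p) \<in> conn {?f, ?g}"
    using conn_step[of ?g "{?f, ?g}" x] gv by simp
  have xy': "(x, y) \<notin> conn {?f, ?g}"
    using disc conn_trans[OF conn_sym[OF xp]] by blast
  have yq: "(q, y) \<in> conn {?f, ?g}"
    using conn_step[of ?g "{?f, ?g}" q] gv by simp
  have xq: "(x, q) \<notin> conn {?f, ?g}" using xy' conn_trans[OF _ yq] by blast
  have E: "d \<in> darts \<Gamma> \<or> d = x" if "(x, d) \<in> conn {?f, ?g}" for d
    using component_subset[OF m, of x] that xy' by auto
  have sub: "coloured_diagram P \<R> ?\<Delta> \<and> CArea P \<R> ?\<Delta> < CArea P \<R> \<Gamma>"
  proof (rule subdiagram[OF \<Gamma> m])
    show "x \<in> insert x (insert y (darts \<Gamma>))" by simp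
    show "?l d \<in> letters P \<and> ?l (?g d) = pinv P (?l d)" if d: "(x, d) \<in> conn {?f, ?g}" for d
    proof (cases "d = x \<or> d = p")
      case True
      then show ?thesis using gv ne xy(3) q(4,5) c(2)[OF q(1)] c(2)[OF p(1)] by auto
    next
      case False
      then have d': "d \<in> darts \<Gamma>" "d \<noteq> q" "d \<noteq> y" "d \<noteq> x" "d \<noteq> p" using E[OF d] d xq xy' by auto
      then have "?g d = opp \<Gamma> d" by (simp add: cut_loop_def)
      moreover have "opp \<Gamma> d \<in> darts \<Gamma>" using pl(3) d' by (simp add: permutes_in_image)
      ultimately show ?thesis using d' xy c(2,3)[OF d'(1)] by auto
    qed
    show "d \<in> darts \<Gamma> \<and> orbit ?f d \<noteq> outer \<Gamma>"
      if d: "(x, d) \<in> conn {?f, ?g}" "orbit ?f d \<noteq> orbit ?f x" for d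
    proof -
      have "d \<in> darts \<Gamma>" using E[OF d(1)] d(2) by blast
      moreover have "orbit ?f d \<noteq> outer \<Gamma>"
      proof
        assume "orbit ?f d = outer \<Gamma>"
        then have "b \<in> orbit ?f d" using out(2) self_in_orbit[OF pl(2,4)] by simp
        then show False using out(3) conn_trans[OF d(1) conn_orbit] by blast
      qed
      ultimately show ?thesis ..
    qed
    show "?f d = ?f d \<and> ?l d = lab \<Gamma> d" if "d \<in> darts \<Gamma>" for d using that xy by auto
    show "orbit ?f q \<in> red_faces P \<Gamma>" by (rule T)
    show "(x, d) \<notin> conn {?f, ?g}" if "d \<in> orbit ?f q" for d
      using xq conn_trans[OF _ conn_sym[OF conn_orbit[OF that, of ?g]]] by blast
  qed
  have "has_V_loop P ?\<Delta>"
    unfolding has_V_loop_def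
  proof (intro bexI conjI)
    have C: "p \<in> conn {?f, ?g} `` {x}" "x \<in> conn {?f, ?g} `` {x}" using xp by simp_all
    show "p \<in> darts ?\<Delta>" using xp by (simp add: component_diagram_def)
    show "V_letter P (lab ?\<Delta> p)" using V ne by (simp add: component_diagram_def)
    have pm: "?f \<circ> ?g permutes insert x (insert y (darts \<Gamma>))"
      using planar_mapD(2,3)[OF m] by (intro permutes_compose)
    have "x \<in> orbit (?f \<circ> ?g) p" using orbit.base[of "?f \<circ> ?g" p] gv fx by simp
    then have "orbit (?f \<circ> ?g) x = orbit (?f \<circ> ?g) p"
      by (rule orbit_mem_eq[OF planar_mapD(1)[OF m] pm])
    moreover have "opp ?\<Delta> p = x" using C gv by (simp add: component_diagram_def perm_restrict_def)
    ultimately show "src ?\<Delta> (opp ?\<Delta> p) = src ?\<Delta> p" by (simp add: component_diagram_def)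
  qed
  then show ?thesis using sub by blast
qed

lemma triangle_V_letter:
  assumes "is_pregroup P" "triangle P a b c"
  shows "V_letter P a"
proof -
  have "[a, b, c] \<in> V_relators P" using V_relators_iff_triangle[OF assms(1)] assms(2) by simp
  moreover have "a \<in> letters P" using assms(2) by (simp add: triangle_def)
  ultimately show ?thesis unfolding V_letter_def by force
qed

lemma outer_dart:
  assumes "planar_diagram \<Gamma>" "darts \<Gamma> \<noteq> {}"
  obtains b where "b \<in> darts \<Gamma>" "outer \<Gamma> = orbit (nxt \<Gamma>) b"
  using planar_diagram_parts(9)[OF assms] by (elim imageE)

text \<open>The external face lies on at most one side of the cut. Both faces along the loop are
  red, so whichever side is discarded takes a triangle with it.\<close>

lemma red_loop_shrinks:
  assumes P: "is_pregroup P" and \<Gamma>: "coloured_diagram P \<R> \<Gamma>" and p: "p \<in> darts \<Gamma>"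
    and loop: "src \<Gamma> (opp \<Gamma> p) = src \<Gamma> p"
    and red: "orbit (nxt \<Gamma>) p \<in> red_faces P \<Gamma>" "orbit (nxt \<Gamma>) (opp \<Gamma> p) \<in> red_faces P \<Gamma>"
  shows "\<exists>\<Delta>. coloured_diagram P \<R> \<Delta> \<and> has_V_loop P \<Delta> \<and> CArea P \<R> \<Delta> < CArea P \<R> \<Gamma>"
proof -
  note c = coloured_diagram_parts(1)[OF \<Gamma>]
  note pl = planar_diagram_parts[OF c]
  define q where "q = opp \<Gamma> p"
  have q: "q \<in> darts \<Gamma>" "opp \<Gamma> q = p" using pl(3,6) p by (simp_all add: q_def permutes_in_image)
  obtain b where b: "b \<in> darts \<Gamma>" "outer \<Gamma> = orbit (nxt \<Gamma>) b"
    using outer_dart[OF c] p by blast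
  obtain x where x: "x \<notin> darts \<Gamma>" using ex_new_if_finite[OF infinite_UNIV_nat pl(2)] by blast
  obtain y where y: "y \<notin> insert x (darts \<Gamma>)"
    using ex_new_if_finite[OF infinite_UNIV_nat, of "insert x (darts \<Gamma>)"] pl(2) by blast
  have \<sigma>: "nxt \<Gamma> \<circ> opp \<Gamma> permutes darts \<Gamma>" using pl(3,4) by (rule permutes_compose)
  have pq: "(p, q) \<in> conn {nxt \<Gamma> \<circ> opp \<Gamma>}"
    using pl(8)[OF p q(1)] loop by (simp add: conn_singleton[OF pl(2) \<sigma>] q_def)
  let ?g = "cut_loop (opp \<Gamma>) p q x y"
  have m: "planar_map (insert x (insert y (darts \<Gamma>))) (nxt \<Gamma>) ?g" "(p, y) \<notin> conn {nxt \<Gamma>, ?g}"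
    using cut_loop_planar_map[OF planar_diagram_map[OF c] p q_def pq, of x y] x y by auto
  have ne: "x \<noteq> p" "x \<noteq> q" "y \<noteq> p" "y \<noteq> q" "x \<noteq> y" "p \<noteq> q"
    using x y p q pl(5)[OF p] by (auto simp: q_def)
  have V: "V_letter P (lab \<Gamma> p)" "V_letter P (lab \<Gamma> q)"
    using red_face(2)[OF P c] red triangle_V_letter[OF P] by (auto simp: q_def)
  have xp: "(x, p) \<in> conn {nxt \<Gamma>, ?g}" "(y, q) \<in> conn {nxt \<Gamma>, ?g}"
    using conn_step[of ?g "{nxt \<Gamma>, ?g}" x] conn_step[of ?g "{nxt \<Gamma>, ?g}" y] ne
    by (simp_all add: cut_loop_def)
  have xq: "(q, x) \<notin> conn {nxt \<Gamma>, ?g}"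
  proof
    assume "(q, x) \<in> conn {nxt \<Gamma>, ?g}"
    then have "(y, p) \<in> conn {nxt \<Gamma>, ?g}"
      using conn_trans[OF xp(2) conn_trans[OF _ xp(1)]] by blast
    then have "(p, y) \<in> conn {nxt \<Gamma>, ?g}" by (rule conn_sym)
    then show False using m(2) by contradiction
  qed
  \<comment> \<open>Exchanging \<open>p\<close>, \<open>x\<close> with \<open>q\<close>,
    \<open>y\<close> describes the same cut, so one lemma serves both sides.\<close>
  have swap: "cut_loop (opp \<Gamma>) q p y x = ?g"
    using ne by (auto simp: cut_loop_def fun_eq_iff)
  show ?thesis
  proof (cases "(x, b) \<in> conn {nxt \<Gamma>, ?g}")
    case False
    show ?thesis
      using cut_loop_side[OF \<Gamma> p q_def V(1) red(2)[folded q_def] x _ ne(5) m b False] y by blast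
  next
    case True
    have "(y, b) \<notin> conn {nxt \<Gamma>, ?g}"
    proof
      assume "(y, b) \<in> conn {nxt \<Gamma>, ?g}"
      then have "(q, x) \<in> conn {nxt \<Gamma>, ?g}"
        using conn_trans[OF conn_sym[OF xp(2)] conn_trans[OF _ conn_sym[OF True]]] by blast
      then show False using xq by blast
    qed
    moreover have "planar_map (insert y (insert x (darts \<Gamma>))) (nxt \<Gamma>) ?g"
      using m(1) by (simp add: insert_commute)
    ultimately show ?thesis
      using cut_loop_side[OF \<Gamma> q(1) q(2)[symmetric] V(2) red(1), of y x, unfolded swap, OF _ x _ _ xq b]
        y ne(5) by blast
  qed
qed

section \<open>Cancelling a pair of triangles\<close>

text \<open>Two edges are sewn together: \<open>p\<close> is paired with \<open>q\<close>, and their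
  former partners with each other. If \<open>q = g p\<close> and \<open>g\<close> is an involution,
  nothing changes.\<close>

definition glue :: "('d \<Rightarrow> 'd) \<Rightarrow> 'd \<Rightarrow> 'd \<Rightarrow> 'd \<Rightarrow> 'd" where
  "glue g p q z =
     (if z = p then q else if z = q then p else if z = g p then g q else if z = g q then g p else g z)"

text \<open>The last hypothesis says that \<open>q\<close> leaves the vertex where \<open>p\<close>
  ends. The first transposition acts at that vertex, the second within one edge cycle, so neither
  raises the defect.\<close>

lemma glue_planar_map:
  assumes m: "planar_map D f g" and pq: "p \<in> D" "q \<in> D" "p \<noteq> q" "(q, g p) \<in> conn {f \<circ> g}"
  shows "planar_map D f (glue g p q)"
proof -
  note P = planar_mapD[OF m]
  have D: "g p \<in> D" "g q \<in> D" using pq P(3) by (simp_all add: permutes_in_image)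
  have inj: "g z = g u \<longleftrightarrow> z = u" for z u using permutes_inj[OF P(3)] by (simp add: inj_eq)
  have ne: "g p \<noteq> p" "g q \<noteq> q" "g p \<noteq> g q" "g (g p) = p" "g (g q) = q"
    using P(5,6) pq inj by auto
  have qp: "g q = p \<longleftrightarrow> q = g p" using ne by metis
  let ?g1 = "transpose (g q) p \<circ> g"
  let ?g2 = "transpose (g p) q \<circ> ?g1"
  have g1: "?g1 permutes D" using P(3) D(2) pq(1) by (rule permutes_transpose_comp)
  then have g2: "?g2 permutes D" using D(1) pq(2) by (rule permutes_transpose_comp)
  have "(g q, p) \<in> conn {g \<circ> f}" using conn_comp_swap[OF pq(4)] ne by simp
  then have d1: "defect D f ?g1 \<le> 0"
    using defect_transpose_comp_le_right[OF P(1-3) D(2) pq(1)] P(4) by simp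
  \<comment> \<open>For \<open>q \<noteq> g p\<close> the first transposition has fused the two
    edges into one 4-cycle, which the second splits into the new pairs.\<close>
  have "(g p, q) \<in> conn {?g1}"
  proof (cases "q = g p")
    case False
    have step: "(z, ?g1 z) \<in> conn {?g1}" for z by (rule conn_step) (rule insertI1)
    have "?g1 q = p" "?g1 p = g p" using ne False by simp_all
    then have "(q, p) \<in> conn {?g1}" "(p, g p) \<in> conn {?g1}" using step[of q] step[of p] by metis+
    then show ?thesis by (rule conn_sym[OF conn_trans])
  qed simp
  then have d2: "defect D f ?g2 \<le> 0"
    using defect_transpose_comp_le_right[OF P(1,2) g1 D(1) pq(2)] d1 by simp
  have eq: "?g2 = glue g p q"
  proof
    fix z
    show "?g2 z = glue g p q z"
    proof (cases "q = g p")
      case True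
      then show ?thesis using ne inj by (auto simp: glue_def)
    next
      case False
      consider "z = p" | "z = q" | "z = g p" | "z = g q" | "z \<noteq> p" "z \<noteq> q" "z \<noteq> g p" "z \<noteq> g q"
        by blast
      then show ?thesis
      proof cases
        case 5
        then have "g z \<noteq> p" "g z \<noteq> q" "g z \<noteq> g p" "g z \<noteq> g q"
          using inj ne by metis+
        then show ?thesis using 5 by (simp add: glue_def)
      qed (use False ne pq(3) qp in \<open>auto simp: glue_def\<close>)
    qed
  qed
  have "glue g p q d \<noteq> d \<and> glue g p q (glue g p q d) = d" if "d \<in> D" for d
  proof (cases "d \<in> {p, q, g p, g q}")
    case True
    then show ?thesis using ne pq(3) qp by (auto simp: glue_def)
  next
    case False
    then have "g d \<noteq> p" "g d \<noteq> q" "g d \<noteq> g p" "g d \<noteq> g q" using inj ne by auto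
    then show ?thesis using False P(5,6)[OF that] by (auto simp: glue_def)
  qed
  then show ?thesis using P g2 d2 unfolding eq planar_map_def by blast
qed

lemma component_diagram_boundary:
  assumes \<Gamma>: "planar_diagram \<Gamma>" and b: "b \<in> darts \<Gamma>" "outer \<Gamma> = orbit (nxt \<Gamma>) b"
    and w: "boundary_word P \<Gamma> w"
    and eq: "\<And>z. z \<in> outer \<Gamma> \<Longrightarrow> f z = nxt \<Gamma> z \<and> l z = lab \<Gamma> z"
  shows "orbit f b = outer \<Gamma>" "boundary_word P (component_diagram f g l b) w"
proof -
  note p = planar_diagram_parts(2,4)[OF \<Gamma>]
  have bo: "b \<in> outer \<Gamma>" using self_in_orbit[OF p] b(2) by simp
  have cl: "nxt \<Gamma> z \<in> outer \<Gamma>" if "z \<in> outer \<Gamma>" for z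
    using that unfolding b(2) by (rule orbit.step)
  show ob: "orbit f b = outer \<Gamma>"
    unfolding b(2) by (rule orbit_cong0[of _ "outer \<Gamma>", symmetric]) (use bo cl eq in auto)
  have "darts \<Gamma> \<noteq> {}" using b by blast
  then obtain d where d: "d \<in> outer \<Gamma>" "w = inv_word P (face_word \<Gamma> d)"
    using w unfolding boundary_word_def by auto
  have "d \<in> conn {f, g} `` {b}" using conn_orbit[of d f b g] d(1) ob by simp
  then have C: "d \<in> darts (component_diagram f g l b)" by (simp add: component_diagram_def)
  have "fword (nxt \<Gamma>) (lab \<Gamma>) d = fword f l d"
    by (rule fword_cong[where A = "outer \<Gamma>"]) (use d(1) cl eq in auto)
  then have "w = inv_word P (face_word (component_diagram f g l b) d)"
    using d(2) component_diagram_orbit(2)[OF C] by (simp add: face_word_fword)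
  moreover have "d \<in> outer (component_diagram f g l b)"
    using d(1) ob by (simp add: component_diagram_def)
  ultimately show "boundary_word P (component_diagram f g l b) w"
    using C unfolding boundary_word_def by auto
qed

text \<open>Two triangles \<open>e\<^sub>1 a e\<^sub>2\<inverse>\<close> and \<open>e\<^sub>2 b e\<^sub>3\<inverse>\<close> sharing the edge \<open>e\<^sub>2\<close>.\<close>
locale adjacent_triangles =
  fixes P :: "'a pregroup" and \<R> :: "'a list set" and \<Gamma> :: "'a diagram"
    and e1 e2 e3 a b :: nat
  assumes P: "is_pregroup P" and \<Gamma>: "coloured_diagram P \<R> \<Gamma>"
    and darts: "e1 \<in> darts \<Gamma>" "e2 \<in> darts \<Gamma>" "e3 \<in> darts \<Gamma>"
    and nxt1: "nxt \<Gamma> e1 = a" "nxt \<Gamma> a = opp \<Gamma> e2" "nxt \<Gamma> (opp \<Gamma> e2) = e1"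
    and nxt2: "nxt \<Gamma> e2 = b" "nxt \<Gamma> b = opp \<Gamma> e3" "nxt \<Gamma> (opp \<Gamma> e3) = e2"
    and red: "orbit (nxt \<Gamma>) e1 \<in> red_faces P \<Gamma>" "orbit (nxt \<Gamma>) e2 \<in> red_faces P \<Gamma>"
    and distinct_faces: "e2 \<notin> {e1, a, opp \<Gamma> e2}"
    and no_loop: "e3 \<noteq> a" "e3 \<noteq> b"
begin

abbreviation "U \<equiv> {e1, a, opp \<Gamma> e2, e2, b, opp \<Gamma> e3}"

lemmas planar = coloured_diagram_parts(1)[OF \<Gamma>]
lemmas parts = planar_diagram_parts[OF planar]

section \<open>Incidences in a pair of adjacent triangles\<close>

lemma opp_inj: "opp \<Gamma> x = opp \<Gamma> y \<longleftrightarrow> x = y"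
  using permutes_inj[OF parts(3)] by (simp add: inj_eq)

lemma U_darts: "U \<subseteq> darts \<Gamma>"
proof -
  have "nxt \<Gamma> e1 \<in> darts \<Gamma>" "nxt \<Gamma> e2 \<in> darts \<Gamma>" "opp \<Gamma> e2 \<in> darts \<Gamma>" "opp \<Gamma> e3 \<in> darts \<Gamma>"
    using darts parts(3,4) by (simp_all add: permutes_in_image)
  then show ?thesis using darts nxt1(1) nxt2(1) by simp
qed

lemma orbits: "orbit (nxt \<Gamma>) e1 = {e1, a, opp \<Gamma> e2}" "orbit (nxt \<Gamma>) e2 = {e2, b, opp \<Gamma> e3}"
  using orbit_three[OF nxt1] orbit_three[OF nxt2] .

lemma disjoint: "{e1, a, opp \<Gamma> e2} \<inter> {e2, b, opp \<Gamma> e3} = {}"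
proof (rule ccontr)
  assume "{e1, a, opp \<Gamma> e2} \<inter> {e2, b, opp \<Gamma> e3} \<noteq> {}"
  then obtain z where "z \<in> orbit (nxt \<Gamma>) e1" "z \<in> orbit (nxt \<Gamma>) e2" using orbits by auto
  then have "orbit (nxt \<Gamma>) e1 = orbit (nxt \<Gamma>) e2"
    using orbit_mem_eq[OF parts(2,4)] by metis
  then have "e2 \<in> orbit (nxt \<Gamma>) e1" using self_in_orbit[OF parts(2,4)] by simp
  then show False using distinct_faces orbits by simp
qed

lemma distinct: "distinct [e1, a, opp \<Gamma> e2, e2, b, opp \<Gamma> e3]"
proof -
  have "card (orbit (nxt \<Gamma>) e1) = 3" "card (orbit (nxt \<Gamma>) e2) = 3"
    using red_face(1)[OF P planar] red by auto
  from orbit_card_three(3-5)[OF self_in_orbit[OF parts(2,4)] this(1)]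
    orbit_card_three(3-5)[OF self_in_orbit[OF parts(2,4)] this(2)]
  show ?thesis unfolding nxt1 nxt2 using disjoint by auto
qed

lemma dist:
  shows
    "e1 \<noteq> a" "e1 \<noteq> opp \<Gamma> e2" "e1 \<noteq> e2" "e1 \<noteq> b" "e1 \<noteq> opp \<Gamma> e3"
    "a \<noteq> e1" "a \<noteq> opp \<Gamma> e2" "a \<noteq> e2" "a \<noteq> b" "a \<noteq> opp \<Gamma> e3"
    "opp \<Gamma> e2 \<noteq> e1" "opp \<Gamma> e2 \<noteq> a" "opp \<Gamma> e2 \<noteq> e2" "opp \<Gamma> e2 \<noteq> b" "opp \<Gamma> e2 \<noteq> opp \<Gamma> e3"
    "e2 \<noteq> e1" "e2 \<noteq> a" "e2 \<noteq> opp \<Gamma> e2" "e2 \<noteq> b" "e2 \<noteq> opp \<Gamma> e3"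
    "b \<noteq> e1" "b \<noteq> a" "b \<noteq> opp \<Gamma> e2" "b \<noteq> e2" "b \<noteq> opp \<Gamma> e3"
    "opp \<Gamma> e3 \<noteq> e1" "opp \<Gamma> e3 \<noteq> a" "opp \<Gamma> e3 \<noteq> opp \<Gamma> e2" "opp \<Gamma> e3 \<noteq> e2" "opp \<Gamma> e3 \<noteq> b"
  using distinct by auto

lemma triangles:
  "triangle P (lab \<Gamma> e1) (lab \<Gamma> a) (pinv P (lab \<Gamma> e2))"
  "triangle P (lab \<Gamma> e2) (lab \<Gamma> b) (pinv P (lab \<Gamma> e3))"
  using red_face(2)[OF P planar red(1)] red_face(2)[OF P planar red(2)] nxt1 nxt2
    coloured_diagram_parts(3)[OF \<Gamma>] darts by simp_all

lemma letters_lab: "d \<in> darts \<Gamma> \<Longrightarrow> lab \<Gamma> d \<in> letters P"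
  using coloured_diagram_parts(2)[OF \<Gamma>] .

lemma nxt_U: "nxt \<Gamma> z \<in> U \<longleftrightarrow> z \<in> U"
  by (rule permutes_closed_iff[OF parts(4)]) (use nxt1 nxt2 in auto)

lemma outer_U: "outer \<Gamma> \<inter> U = {}"
proof -
  have "orbit (nxt \<Gamma>) e1 \<noteq> outer \<Gamma>" "orbit (nxt \<Gamma>) e2 \<noteq> outer \<Gamma>"
    using red by (auto simp: red_faces_def internal_faces_def)
  moreover have "outer \<Gamma> \<in> orbit (nxt \<Gamma>) ` darts \<Gamma>" using parts(9) darts by blast
  ultimately have "z \<notin> outer \<Gamma>" if "z \<in> orbit (nxt \<Gamma>) e1 \<union> orbit (nxt \<Gamma>) e2" for z
    using that orbit_mem_eq[OF parts(2,4)] by (metis UnE imageE)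
  then show ?thesis unfolding orbits by auto
qed

text \<open>Gluing \<open>a\<close> to \<open>b\<close> and \<open>e1\<close> to
  \<open>opp \<Gamma> e3\<close> closes the two triangles up to a sphere of their own:
  \<open>U\<close> becomes invariant under both permutations. The component of the external face
  therefore loses both triangles and keeps its boundary.\<close>

lemma collapse:
  assumes lab: "lab \<Gamma> b = pinv P (lab \<Gamma> a)" "lab \<Gamma> e3 = lab \<Gamma> e1"
    and w: "boundary_word P \<Gamma> w"
  shows "\<exists>\<Delta>. coloured_diagram P \<R> \<Delta> \<and> boundary_word P \<Delta> w \<and> CArea P \<R> \<Delta> < CArea P \<R> \<Gamma>"
proof -
  let ?f = "nxt \<Gamma>" and ?g = "opp \<Gamma>"
  define g1 where "g1 = glue ?g a b"
  define g2 where "g2 = glue g1 (?g e3) e1"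
  have D: "a \<in> darts \<Gamma>" "b \<in> darts \<Gamma>" "?g e3 \<in> darts \<Gamma>" using U_darts by auto
  have opp2: "?g (?g e2) = e2" "?g (?g e3) = e3" "?g (?g a) = a" "?g (?g b) = b"
    using parts(6) darts D by auto
  have step: "(z, (h \<circ> k) z) \<in> conn {h \<circ> k}" for z :: nat and h k
    by (rule conn_step) (rule insertI1)
  have "(?g a, b) \<in> conn {?f \<circ> ?g}"
    using conn_trans[of "?g a" "?g e2" "{?f \<circ> ?g}" b] step[of "?g a" ?f ?g] step[of "?g e2" ?f ?g]
      opp2 nxt1 nxt2 by simp
  then have m1: "planar_map (darts \<Gamma>) ?f g1"
    unfolding g1_def using D dist
    by (intro glue_planar_map planar_diagram_map[OF planar]) (auto intro: conn_sym)
  \<comment> \<open>Here \<open>no_loop\<close> enters: the first gluing must leave the edge of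
    \<open>e3\<close> intact.\<close>
  have e3n: "?g e3 \<notin> {a, b, ?g a, ?g b}" "e3 \<notin> {a, b, ?g a, ?g b}"
    using dist no_loop opp_inj opp2 by auto
  have e2n: "e2 \<notin> {a, b, ?g a, ?g b}" "?g e2 \<notin> {a, b, ?g a, ?g b}"
    using dist opp_inj opp2 by auto
  have g1v: "g1 a = b" "g1 b = a" "g1 e3 = ?g e3" "g1 (?g e3) = e3" "g1 e2 = ?g e2" "g1 (?g e2) = e2"
    unfolding g1_def glue_def using e3n e2n dist opp2 by auto
  have "(e3, e1) \<in> conn {?f \<circ> g1}"
    using conn_trans[of e3 e2 "{?f \<circ> g1}" e1] step[of e3 ?f g1] step[of e2 ?f g1] g1v nxt1 nxt2
    by simp
  \<comment> \<open>If \<open>e1 = e3\<close>, the two darts are already paired and the second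
    gluing changes nothing.\<close>
  then have m2: "planar_map (darts \<Gamma>) ?f g2"
    unfolding g2_def using D dist m1 darts g1v
    by (intro glue_planar_map) (auto intro: conn_sym)
  note pm2 = planar_mapD[OF m2]
  have g2v: "g2 a = b" "g2 b = a" "g2 e1 = ?g e3" "g2 (?g e3) = e1" "g2 e2 = ?g e2" "g2 (?g e2) = e2"
  proof -
    have inj: "g1 x = g1 y \<longleftrightarrow> x = y" for x y
      using permutes_inj[OF planar_mapD(3)[OF m1]] by (rule inj_eq)
    have "g1 e1 \<noteq> a" "g1 e1 \<noteq> b" "g1 e1 \<noteq> e2" "g1 e1 \<noteq> ?g e2"
      using inj[of e1] g1v dist by metis+
    moreover have "e3 \<noteq> a" "e3 \<noteq> b" "e3 \<noteq> e2" "e3 \<noteq> ?g e2"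
      using no_loop dist opp2 by auto
    ultimately show "g2 a = b" "g2 b = a" "g2 e1 = ?g e3" "g2 (?g e3) = e1" "g2 e2 = ?g e2" "g2 (?g e2) = e2"
      unfolding g2_def glue_def using g1v dist by auto
  qed
  have g2U: "g2 z \<in> U \<longleftrightarrow> z \<in> U" for z
    by (rule permutes_closed_iff[OF pm2(3)]) (use g2v in auto)
  have glue_lab: "lab \<Gamma> (glue h p q d) = pinv P (lab \<Gamma> d)"
    if h: "\<And>d. d \<in> darts \<Gamma> \<Longrightarrow> lab \<Gamma> (h d) = pinv P (lab \<Gamma> d)"
      and pq: "p \<in> darts \<Gamma>" "q \<in> darts \<Gamma>" "lab \<Gamma> q = pinv P (lab \<Gamma> p)" and d: "d \<in> darts \<Gamma>" for h p q d
    using h[OF d] h[OF pq(1)] h[OF pq(2)] pq pinv_pinv[OF P letters_lab[OF pq(1)]]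
    unfolding glue_def by auto
  have lab1: "lab \<Gamma> (g1 d) = pinv P (lab \<Gamma> d)" if "d \<in> darts \<Gamma>" for d
    unfolding g1_def using coloured_diagram_parts(3)[OF \<Gamma>] D lab(1) that by (intro glue_lab)
  have "lab \<Gamma> e1 = pinv P (lab \<Gamma> (?g e3))"
    using coloured_diagram_parts(3)[OF \<Gamma> darts(3)] pinv_pinv[OF P letters_lab[OF darts(3)]] lab(2) by simp
  then have lab2: "lab \<Gamma> (g2 d) = pinv P (lab \<Gamma> d)" if "d \<in> darts \<Gamma>" for d
    unfolding g2_def using lab1 D darts that by (intro glue_lab)
  obtain v where v: "v \<in> darts \<Gamma>" "outer \<Gamma> = orbit ?f v" using outer_dart[OF planar] darts(1) by blast
  have vU: "v \<notin> U" using outer_U self_in_orbit[OF parts(2,4), of v] v(2) by blast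
  have CU: "z \<notin> U" if "(v, z) \<in> conn {?f, g2}" for z
  proof -
    have "v \<in> U \<longleftrightarrow> z \<in> U"
      using that by (rule conn_closed[rotated]) (use nxt_U g2U in blast)
    then show ?thesis using vU by blast
  qed
  have "coloured_diagram P \<R> (component_diagram ?f g2 (lab \<Gamma>) v) \<and>
    CArea P \<R> (component_diagram ?f g2 (lab \<Gamma>) v) < CArea P \<R> \<Gamma>"
  proof (rule subdiagram[OF \<Gamma> m2 v(1)])
    show "orbit ?f e1 \<in> red_faces P \<Gamma>" by (rule red)
    show "(v, d) \<notin> conn {?f, g2}" if "d \<in> orbit ?f e1" for d
      using CU[of d] that orbits by auto
    fix d assume "(v, d) \<in> conn {?f, g2}"
    then have d: "d \<in> darts \<Gamma>" using component_subset[OF m2 v(1)] by auto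
    then show "lab \<Gamma> d \<in> letters P \<and> lab \<Gamma> (g2 d) = pinv P (lab \<Gamma> d)"
      using lab2 letters_lab by simp
    assume "orbit ?f d \<noteq> orbit ?f v"
    then show "d \<in> darts \<Gamma> \<and> orbit ?f d \<noteq> outer \<Gamma>" using d v(2) by simp
  qed simp
  moreover have "boundary_word P (component_diagram ?f g2 (lab \<Gamma>) v) w"
    using planar v w by (rule component_diagram_boundary) simp
  ultimately show ?thesis by blast
qed

end

section \<open>Flipping an edge\<close>

context adjacent_triangles
begin

text \<open>The darts of the old diagonal are reused for the new one, so \<open>darts\<close> and
  \<open>opp\<close> stay the same. The new faces are \<open>e1\<close>, \<open>e2\<close>,
  \<open>opp \<Gamma> e3\<close> and \<open>a\<close>, \<open>b\<close>,
  \<open>opp \<Gamma> e2\<close>.\<close>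

definition flip_nxt :: "nat \<Rightarrow> nat" where
  "flip_nxt = (nxt \<Gamma>)(e1 := e2, e2 := opp \<Gamma> e3, opp \<Gamma> e3 := e1, a := b, b := opp \<Gamma> e2, opp \<Gamma> e2 := a)"

lemma flip_nxt_simps:
  "flip_nxt e1 = e2" "flip_nxt e2 = opp \<Gamma> e3" "flip_nxt (opp \<Gamma> e3) = e1"
  "flip_nxt a = b" "flip_nxt b = opp \<Gamma> e2" "flip_nxt (opp \<Gamma> e2) = a"
  "z \<notin> U \<Longrightarrow> flip_nxt z = nxt \<Gamma> z"
  using dist by (auto simp: flip_nxt_def)

text \<open>Two transpositions detach the ends of the diagonal, leaving a quadrilateral and an
  isolated edge; two more attach it at the other corners. In turn they act at one vertex, in one
  face, between two components, and in one face.\<close>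

lemma flip_planar_map: "planar_map (darts \<Gamma>) flip_nxt (opp \<Gamma>)"
proof -
  let ?f = "nxt \<Gamma>" and ?g = "opp \<Gamma>"
  define f1 where "f1 = transpose e2 e1 \<circ> ?f"
  define f2 where "f2 = transpose (?g e2) b \<circ> f1"
  define f3 where "f3 = transpose e2 a \<circ> f2"
  define f4 where "f4 = transpose (?g e2) (?g e3) \<circ> f3"
  note m = planar_mapD[OF planar_diagram_map[OF planar]]
  have D: "a \<in> darts \<Gamma>" "b \<in> darts \<Gamma>" "?g e3 \<in> darts \<Gamma>" "?g e2 \<in> darts \<Gamma>" using U_darts by auto
  have perm: "f1 permutes darts \<Gamma>" "f2 permutes darts \<Gamma>" "f3 permutes darts \<Gamma>" "f4 permutes darts \<Gamma>"
    unfolding f1_def f2_def f3_def f4_def using m D darts by (intro permutes_transpose_comp; simp)+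
  have step: "(z, h z) \<in> conn {h}" for z :: nat and h
    by (rule conn_step) (rule insertI1)
  have v1: "f1 e1 = a" "f1 e2 = b" "f1 (?g e3) = e1" "f1 a = ?g e2" "f1 b = ?g e3" "f1 (?g e2) = e2"
    unfolding f1_def using nxt1 nxt2 dist by simp_all
  have v2: "f2 e1 = a" "f2 e2 = ?g e2" "f2 (?g e3) = e1" "f2 a = b" "f2 b = ?g e3" "f2 (?g e2) = e2"
    unfolding f2_def using v1 dist by simp_all
  have v3: "f3 e1 = e2" "f3 e2 = ?g e2" "f3 (?g e3) = e1" "f3 a = b" "f3 b = ?g e3" "f3 (?g e2) = a"
    unfolding f3_def using v2 dist by simp_all
  have v4: "f4 e1 = e2" "f4 e2 = ?g e3" "f4 (?g e3) = e1" "f4 a = b" "f4 b = ?g e2" "f4 (?g e2) = a"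
    unfolding f4_def using v3 dist by simp_all
  have opp2: "?g (?g e2) = e2" using m(6) darts by blast
  have "(e2, e1) \<in> conn {?f \<circ> ?g}"
    using step[of e2 "?f \<circ> ?g"] nxt1 by simp
  then have d1: "defect (darts \<Gamma>) f1 ?g \<le> 0"
    using defect_transpose_comp_le[OF m(1-3) darts(2,1)] m(4) unfolding f1_def by simp
  have "(?g e2, b) \<in> conn {f1}"
    using conn_trans[of "?g e2" e2 "{f1}" b] step[of "?g e2" f1] step[of e2 f1] v1 by simp
  then have d2: "defect (darts \<Gamma>) f2 ?g \<le> 0"
    using defect_transpose_comp_le[OF m(1) perm(1) m(3) D(4,2)] d1 unfolding f2_def by simp
  \<comment> \<open>At this stage the diagonal is a component by itself.\<close>
  have "(e2, a) \<notin> conn {f2, ?g}"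
  proof
    assume "(e2, a) \<in> conn {f2, ?g}"
    then have "e2 \<in> {e2, ?g e2} \<longleftrightarrow> a \<in> {e2, ?g e2}"
    proof (rule conn_closed[rotated])
      fix h z assume "h \<in> {f2, ?g}"
      then have "h permutes darts \<Gamma>" "z \<in> {e2, ?g e2} \<Longrightarrow> h z \<in> {e2, ?g e2}" for z
        using perm(2) m(3) v2 opp2 by auto
      then show "h z \<in> {e2, ?g e2} \<longleftrightarrow> z \<in> {e2, ?g e2}"
        by (intro permutes_closed_iff[of h "darts \<Gamma>"]) simp_all
    qed
    then show False using dist by auto
  qed
  then have d3: "defect (darts \<Gamma>) f3 ?g \<le> 0"
    using defect_transpose_comp_le[OF m(1) perm(2) m(3) darts(2) D(1)] d2 unfolding f3_def by simp
  have "(?g e2, ?g e3) \<in> conn {f3}"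
    using conn_trans[of "?g e2" a "{f3}" "?g e3"] conn_trans[of a b "{f3}" "?g e3"]
      step[of "?g e2" f3] step[of a f3] step[of b f3] v3 by simp
  then have d4: "defect (darts \<Gamma>) f4 ?g \<le> 0"
    using defect_transpose_comp_le[OF m(1) perm(3) m(3) D(4,3)] d3 unfolding f4_def by simp
  have "f4 = flip_nxt"
  proof
    fix z
    show "f4 z = flip_nxt z"
    proof (cases "z \<in> U")
      case True
      then show ?thesis using v4 flip_nxt_simps by auto
    next
      case False
      then have "?f z \<notin> U" using nxt_U[of z] by blast
      then have "f4 z = ?f z" unfolding f4_def f3_def f2_def f1_def by simp
      then show ?thesis using flip_nxt_simps(7)[OF False] by simp
    qed
  qed
  then show ?thesis using m perm(4) d4 by (simp add: planar_map_def)
qed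

text \<open>The defect does not see connectedness, so it needs its own argument. The six darts of
  \<open>U\<close> stay linked through the edge of \<open>e2\<close>, so every step of the old
  \<open>nxt\<close> can be imitated.\<close>

lemma flip_connected:
  assumes "v \<in> darts \<Gamma>"
  shows "conn {flip_nxt, opp \<Gamma>} `` {v} = darts \<Gamma>"
proof
  show "conn {flip_nxt, opp \<Gamma>} `` {v} \<subseteq> darts \<Gamma>"
    using flip_planar_map assms by (rule component_subset)
  let ?c = "conn {flip_nxt, opp \<Gamma>}"
  have st: "(z, flip_nxt z) \<in> ?c" "(z, opp \<Gamma> z) \<in> ?c" for z by (simp_all add: conn_step)
  have s: "(e1, e2) \<in> ?c" "(e2, opp \<Gamma> e3) \<in> ?c" "(a, b) \<in> ?c" "(b, opp \<Gamma> e2) \<in> ?c" "(e2, opp \<Gamma> e2) \<in> ?c"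
    using st[of e1] st[of e2] st[of a] st[of b] unfolding flip_nxt_simps by auto
  have U: "(e2, z) \<in> ?c" if "z \<in> U" for z
  proof -
    have "(e2, b) \<in> ?c" using conn_trans[OF s(5) conn_sym[OF s(4)]] .
    then show ?thesis
      using that s conn_sym[OF s(1)] conn_trans[OF _ conn_sym[OF s(3)], of e2] by auto
  qed
  have "(v, z) \<in> ?c" if "z \<in> darts \<Gamma>" for z
    using planar_diagram_connected[OF planar assms that]
  proof (rule conn_subset)
    fix h u assume "h \<in> {nxt \<Gamma>, opp \<Gamma>}"
    then consider "h = nxt \<Gamma>" | "h = opp \<Gamma>" by blast
    then show "(u, h u) \<in> ?c"
    proof cases
      case 1
      show ?thesis
      proof (cases "u \<in> U")
        case True
        then have "h u \<in> U" using nxt_U 1 by simp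
        then show ?thesis using conn_trans[OF conn_sym[OF U[OF True]] U] by simp
      next
        case False
        then show ?thesis using st(1)[of u] flip_nxt_simps(7) 1 by simp
      qed
    qed (use st(2) in simp)
  qed
  then show "darts \<Gamma> \<subseteq> ?c `` {v}" by auto
qed

text \<open>At most two triangles replace two, and no green face is added. The explicit
  \<open>darts\<close>, \<open>opp\<close>, \<open>nxt\<close> and the surviving red faces are
  recorded for the induction on the degree of the star.\<close>

lemma flip:
  assumes PR: "pregroup_presentation P \<R>"
    and ab: "(lab \<Gamma> a, lab \<Gamma> b) \<in> pdom P" "pmult P (lab \<Gamma> a) (lab \<Gamma> b) \<noteq> pone P"
    and w: "boundary_word P \<Gamma> w"
  shows "\<exists>\<Delta>. coloured_diagram P \<R> \<Delta> \<and> boundary_word P \<Delta> w \<and> CArea P \<R> \<Delta> \<le> CArea P \<R> \<Gamma> \<and>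
    darts \<Delta> = darts \<Gamma> \<and> opp \<Delta> = opp \<Gamma> \<and> nxt \<Delta> = flip_nxt \<and>
    (\<forall>d\<in>darts \<Gamma>. d \<in> U \<or> orbit (nxt \<Gamma>) d \<in> red_faces P \<Gamma> \<longrightarrow> orbit (nxt \<Delta>) d \<in> red_faces P \<Delta>)"
proof -
  let ?f = "nxt \<Gamma>" and ?g = "opp \<Gamma>"
  \<comment> \<open>The new diagonal runs from the end of \<open>e1\<close> to the end of
    \<open>e3\<close>, so its label must be the product of the two rim labels.\<close>
  define z where "z = pmult P (lab \<Gamma> a) (lab \<Gamma> b)"
  define l where "l = (lab \<Gamma>)(e2 := z, ?g e2 := pinv P z)"
  have D: "a \<in> darts \<Gamma>" "b \<in> darts \<Gamma>" "?g e3 \<in> darts \<Gamma>" "?g e2 \<in> darts \<Gamma>" using U_darts by auto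
  have ze: "z \<in> letters P \<and> triangle P (lab \<Gamma> a) (lab \<Gamma> b) (pinv P z) \<and>
      triangle P (lab \<Gamma> e1) z (pinv P (lab \<Gamma> e3))"
    unfolding z_def using triangle_flip(2)[OF P triangles ab(1)] ab(2) letters_lab darts by blast
  have lv: "l e1 = lab \<Gamma> e1" "l e2 = z" "l (?g e3) = pinv P (lab \<Gamma> e3)" "l a = lab \<Gamma> a" "l b = lab \<Gamma> b"
    "l (?g e2) = pinv P z"
    unfolding l_def using dist coloured_diagram_parts(3)[OF \<Gamma> darts(3)] by simp_all
  have lother: "l d = lab \<Gamma> d" if "d \<notin> U" for d using that unfolding l_def by simp
  have t: "triangle P (l e1) (l e2) (l (?g e3))" "triangle P (l a) (l b) (l (?g e2))"
    using ze unfolding lv by blast+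
  obtain v where v: "v \<in> darts \<Gamma>" "outer \<Gamma> = orbit ?f v" using outer_dart[OF planar] darts(1) by blast
  let ?\<Delta> = "component_diagram flip_nxt ?g l v"
  note m = flip_planar_map
  have C: "conn {flip_nxt, ?g} `` {v} = darts \<Gamma>" using v(1) by (rule flip_connected)
  have flds: "darts ?\<Delta> = darts \<Gamma>" "opp ?\<Delta> = ?g" "nxt ?\<Delta> = flip_nxt" "lab ?\<Delta> = l"
    unfolding component_diagram_def C using planar_mapD(2,3)[OF m] by simp_all
  have bw: "orbit flip_nxt v = outer \<Gamma>" "boundary_word P ?\<Delta> w"
  proof -
    have *: "flip_nxt z = ?f z \<and> l z = lab \<Gamma> z" if "z \<in> outer \<Gamma>" for z
    proof -
      have "z \<notin> U" using that outer_U by blast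
      then show ?thesis using flip_nxt_simps(7) lother by simp
    qed
    show "orbit flip_nxt v = outer \<Gamma>" using planar v w * by (rule component_diagram_boundary)
    show "boundary_word P ?\<Delta> w" using planar v w * by (rule component_diagram_boundary)
  qed
  have T1: "orbit flip_nxt d = {e1, e2, ?g e3}" if "d \<in> {e1, e2, ?g e3}" for d
    using that orbit_three[of flip_nxt, OF flip_nxt_simps(1,2,3)]
      orbit_three[of flip_nxt, OF flip_nxt_simps(2,3,1)] orbit_three[of flip_nxt, OF flip_nxt_simps(3,1,2)]
    by auto
  have T2: "orbit flip_nxt d = {a, b, ?g e2}" if "d \<in> {a, b, ?g e2}" for d
    using that orbit_three[of flip_nxt, OF flip_nxt_simps(4,5,6)]
      orbit_three[of flip_nxt, OF flip_nxt_simps(5,6,4)] orbit_three[of flip_nxt, OF flip_nxt_simps(6,4,5)]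
    by auto
  have fw: "triangle P (l d) (l (flip_nxt d)) (l (flip_nxt (flip_nxt d))) \<and>
      fword flip_nxt l d = [l d, l (flip_nxt d), l (flip_nxt (flip_nxt d))]" if dU: "d \<in> U" for d
  proof -
    have "flip_nxt (flip_nxt (flip_nxt d)) = d \<and> d \<noteq> flip_nxt d \<and> flip_nxt d \<noteq> flip_nxt (flip_nxt d) \<and>
      d \<noteq> flip_nxt (flip_nxt d)"
    proof -
      consider "d = e1" | "d = e2" | "d = ?g e3" | "d = a" | "d = b" | "d = ?g e2" using dU by blast
      then show ?thesis by cases (simp_all add: flip_nxt_simps dist)
    qed
    then have "fword flip_nxt l d = [l d, l (flip_nxt d), l (flip_nxt (flip_nxt d))]"
      by (intro fword_three(2)) auto
    moreover have "triangle P (l d) (l (flip_nxt d)) (l (flip_nxt (flip_nxt d)))"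
    proof -
      note t' = t triangle_rotate[OF P t(1)] triangle_rotate[OF P t(2)]
        triangle_rotate[OF P triangle_rotate[OF P t(1)]] triangle_rotate[OF P triangle_rotate[OF P t(2)]]
      consider "d = e1" | "d = e2" | "d = ?g e3" | "d = a" | "d = b" | "d = ?g e2" using dU by blast
      then show ?thesis by cases (simp_all only: flip_nxt_simps t')
    qed
    ultimately show ?thesis by blast
  qed
  have old: "orbit flip_nxt d = orbit ?f d \<and> fword flip_nxt l d = face_word \<Gamma> d \<and> orbit ?f d \<inter> U = {}"
    if "d \<notin> U" for d
  proof -
    have cl: "?f x \<notin> U" if "x \<notin> U" for x using nxt_U[of x] that by blast
    have "orbit ?f d \<subseteq> - U" by (rule orbit_subset_closed) (use that cl in auto)
    moreover have "orbit ?f d = orbit flip_nxt d"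
      by (rule orbit_cong0[of _ "- U"]) (use that cl flip_nxt_simps(7) in auto)
    moreover have "fword ?f (lab \<Gamma>) d = fword flip_nxt l d"
      by (rule fword_cong[where A = "- U"]) (use that cl flip_nxt_simps(7) lother in auto)
    ultimately show ?thesis by (auto simp: face_word_fword)
  qed
  have outU: "outer \<Gamma> \<inter> U = {}" by (rule outer_U)
  have notout: "orbit flip_nxt d \<noteq> outer \<Gamma>" if "d \<in> U" for d
    using self_in_orbit[OF planar_mapD(1,2)[OF m], of d] outU that by blast
  have int: "orbit ?f d \<in> internal_faces \<Gamma>" if "d \<in> darts \<Gamma>" "orbit ?f d \<noteq> outer \<Gamma>" for d
    using that by (simp add: internal_faces_def)
  have col: "coloured_diagram P \<R> ?\<Delta>"
    using m v(1)
  proof (rule coloured_component_diagram)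
    fix d assume "(v, d) \<in> conn {flip_nxt, ?g}"
    then have d: "d \<in> darts \<Gamma>" using C by auto
    have e2: "?g (?g e2) = e2" using parts(6) darts by blast
    show "l d \<in> letters P \<and> l (?g d) = pinv P (l d)"
    proof (cases "d = e2 \<or> d = ?g e2")
      case True
      then show ?thesis using ze lv e2 pinv_letters[OF P] pinv_pinv[OF P] by auto
    next
      case False
      then have "?g d \<noteq> e2" "?g d \<noteq> ?g e2" using e2 opp_inj by metis+
      then show ?thesis using False letters_lab[OF d] coloured_diagram_parts(3)[OF \<Gamma> d]
        by (simp add: l_def)
    qed
    assume o: "orbit flip_nxt d \<noteq> orbit flip_nxt v"
    have self: "d \<in> orbit flip_nxt d" using self_in_orbit[OF planar_mapD(1,2)[OF m]] .
    show "\<exists>e\<in>orbit flip_nxt d. fword flip_nxt l e \<in> V_relators P \<union> sym_relators P \<R>"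
    proof (cases "d \<in> U")
      case True
      then show ?thesis using fw[OF True] V_relators_iff_triangle[OF P] self by (intro bexI[of _ d]) simp_all
    next
      case False
      then have "orbit ?f d \<in> red_faces P \<Gamma> \<union> green_faces P \<R> \<Gamma>"
        using int[OF d] o old[OF False] bw(1) coloured_diagram_parts(4)[OF \<Gamma>] by simp
      then obtain e where e: "e \<in> orbit ?f d" "face_word \<Gamma> e \<in> V_relators P \<union> sym_relators P \<R>"
        unfolding red_faces_def green_faces_def by blast
      moreover have "e \<notin> U" using e(1) old[OF False] by blast
      ultimately show ?thesis using old[OF False] old[of e] by (intro bexI[of _ e]) simp_all
    qed
  qed
  note faces = component_diagram_faces[where f = flip_nxt and g = ?g and b = v, unfolded C bw(1)]
  let ?T1 = "{e1, e2, ?g e3}" and ?T2 = "{a, b, ?g e2}"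
  have F: "F = ?T1 \<or> F = ?T2 \<or> (F \<in> internal_faces \<Gamma> \<and> F \<inter> U = {} \<and>
      (\<forall>e\<in>F. fword flip_nxt l e = face_word \<Gamma> e))" if "F \<in> orbit flip_nxt ` darts \<Gamma> - {outer \<Gamma>}" for F
  proof -
    have "F \<in> orbit flip_nxt ` darts \<Gamma>" "F \<noteq> outer \<Gamma>" using that by simp_all
    then obtain d where d: "d \<in> darts \<Gamma>" "F = orbit flip_nxt d" "F \<noteq> outer \<Gamma>" by (elim imageE)
    show ?thesis
    proof (cases "d \<in> U")
      case True
      then have "d \<in> ?T1 \<or> d \<in> ?T2" by blast
      then show ?thesis using T1[of d] T2[of d] d(2) by blast
    next
      case False
      have "fword flip_nxt l e = face_word \<Gamma> e" if "e \<in> F" for e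
        using that d(2) old[OF False] old[of e] by blast
      then show ?thesis using int[OF d(1)] d(2,3) old[OF False] by simp
    qed
  qed
  have green: "green_faces P \<R> ?\<Delta> \<subseteq> green_faces P \<R> \<Gamma>"
  proof
    fix F assume "F \<in> green_faces P \<R> ?\<Delta>"
    then obtain d where d: "F \<in> orbit flip_nxt ` darts \<Gamma> - {outer \<Gamma>}" "d \<in> F" "fword flip_nxt l d \<in> sym_relators P \<R>"
      unfolding faces by blast
    have "d \<notin> U" using fw[of d] triangle_not_sym_relator[OF PR] d(3) by metis
    then show "F \<in> green_faces P \<R> \<Gamma>"
      using F[OF d(1)] d(2,3) unfolding green_faces_def by auto
  qed
  have red_sub: "red_faces P ?\<Delta> \<subseteq> insert ?T1 (insert ?T2 (red_faces P \<Gamma> - {orbit ?f e1, orbit ?f e2}))"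
  proof
    fix F assume "F \<in> red_faces P ?\<Delta>"
    then obtain d where d: "F \<in> orbit flip_nxt ` darts \<Gamma> - {outer \<Gamma>}" "d \<in> F" "fword flip_nxt l d \<in> V_relators P"
      unfolding faces by blast
    consider "F = ?T1" | "F = ?T2" | "F \<in> red_faces P \<Gamma>" "F \<inter> U = {}"
      using F[OF d(1)] d(2,3) unfolding red_faces_def by fastforce
    then show "F \<in> insert ?T1 (insert ?T2 (red_faces P \<Gamma> - {orbit ?f e1, orbit ?f e2}))"
    proof cases
      case 3
      have "F \<noteq> orbit ?f e1" "F \<noteq> orbit ?f e2"
        using 3(2) unfolding orbits by blast+
      then show ?thesis using 3(1) by simp
    qed simp_all
  qed
  have fin: "finite (red_faces P \<Gamma>)" "finite (green_faces P \<R> \<Gamma>)" using finite_faces[OF planar] by blast+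
  have ne: "orbit ?f e1 \<noteq> orbit ?f e2" unfolding orbits using disjoint by blast
  have "card (red_faces P ?\<Delta>) \<le> card (insert ?T1 (insert ?T2 (red_faces P \<Gamma> - {orbit ?f e1, orbit ?f e2})))"
    using red_sub fin by (intro card_mono) auto
  also have "\<dots> \<le> Suc (Suc (card (red_faces P \<Gamma> - {orbit ?f e1, orbit ?f e2})))"
    using fin(1) by (simp add: card_insert_if)
  also have "\<dots> = Suc (Suc (card (red_faces P \<Gamma>) - 2))"
    using ne red fin by (subst card_Diff_subset) auto
  also have "\<dots> = card (red_faces P \<Gamma>)"
  proof -
    have "card {orbit ?f e1, orbit ?f e2} \<le> card (red_faces P \<Gamma>)"
      using red fin by (intro card_mono) auto
    then show ?thesis using ne by simp
  qed
  finally have ca: "CArea P \<R> ?\<Delta> \<le> CArea P \<R> \<Gamma>"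
    using card_mono[OF fin(2) green] by (simp add: CArea_def)
  have redD: "orbit flip_nxt d \<in> red_faces P ?\<Delta>"
    if d: "d \<in> darts \<Gamma>" "d \<in> U \<or> orbit ?f d \<in> red_faces P \<Gamma>" for d
  proof (cases "d \<in> U")
    case True
    have "fword flip_nxt l d \<in> V_relators P" using fw[OF True] V_relators_iff_triangle[OF P] by simp
    moreover have "d \<in> orbit flip_nxt d" using self_in_orbit[OF planar_mapD(1,2)[OF m]] .
    ultimately show ?thesis unfolding faces using d(1) notout[OF True] by blast
  next
    case False
    then obtain e where e: "e \<in> orbit ?f d" "face_word \<Gamma> e \<in> V_relators P" "orbit ?f d \<noteq> outer \<Gamma>"
      using d(2) unfolding red_faces_def internal_faces_def by blast
    have "e \<notin> U" using e(1) old[OF False] by blast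
    then have "fword flip_nxt l e \<in> V_relators P" "orbit flip_nxt d = orbit ?f d"
      using e(2) old[OF False] old[of e] by simp_all
    then show ?thesis unfolding faces using e(1,3) d(1) by blast
  qed
  show ?thesis
    using col bw(2) ca flds redD by (intro exI[of _ ?\<Delta>]) simp
qed

end

section \<open>Removing vertices without green faces\<close>

lemma loop_minimal_le:
  assumes "loop_minimal P \<R> \<Gamma>" "coloured_diagram P \<R> \<Delta>" "CArea P \<R> \<Delta> \<le> CArea P \<R> \<Gamma>"
  shows "loop_minimal P \<R> \<Delta>"
  using assms unfolding loop_minimal_def by (meson order_trans)

lemma mult_inverse_letter: "is_pregroup P \<Longrightarrow> x \<in> letters P \<Longrightarrow> pmult P x (pinv P x) = pone P"
  using pregroup_P2[of P x] by (simp add: letters_def)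

text \<open>The induction carries loop-minimality and not minimality for \<open>w\<close>, because
  the former survives a flip: the coloured area does not grow.\<close>

lemma red_star_reducible:
  assumes PR: "pregroup_presentation P \<R>" and "loop_minimal P \<R> \<Gamma>" "boundary_word P \<Gamma> w" "d \<in> darts \<Gamma>"
    and "\<And>x. x \<in> orbit (nxt \<Gamma> \<circ> opp \<Gamma>) d \<Longrightarrow> orbit (nxt \<Gamma>) x \<in> red_faces P \<Gamma>"
  shows "\<exists>\<Delta>. coloured_diagram P \<R> \<Delta> \<and> boundary_word P \<Delta> w \<and> CArea P \<R> \<Delta> < CArea P \<R> \<Gamma>"
  using assms(2-)
proof (induction "card (orbit (nxt \<Gamma> \<circ> opp \<Gamma>) d)" arbitrary: \<Gamma> d rule: less_induct)
  case less
  have P: "is_pregroup P" using PR by (simp add: pregroup_presentation_def)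
  have col: "coloured_diagram P \<R> \<Gamma>" using less.prems(1) by (simp add: loop_minimal_def)
  note pd = coloured_diagram_parts(1)[OF col]
  note p = planar_diagram_parts[OF pd]
  let ?f = "nxt \<Gamma>" and ?g = "opp \<Gamma>"
  define \<sigma> where "\<sigma> = ?f \<circ> ?g"
  define S where "S = orbit \<sigma> d"
  have \<sigma>: "\<sigma> permutes darts \<Gamma>" unfolding \<sigma>_def using p(3,4) by (rule permutes_compose)
  have inj: "\<sigma> x = \<sigma> y \<longleftrightarrow> x = y" for x y using permutes_inj[OF \<sigma>] by (rule inj_eq)
  have fin: "finite S" unfolding S_def using self_in_orbit[OF p(2) \<sigma>] by (rule finite_orbit)
  have SD: "S \<subseteq> darts \<Gamma>" unfolding S_def using \<sigma> less.prems(3) by (rule permutes_orbit_subset)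
  have dS: "d \<in> S" unfolding S_def using p(2) \<sigma> by (rule self_in_orbit)
  have S\<sigma>: "\<sigma> x \<in> S \<longleftrightarrow> x \<in> S" for x
    using \<sigma> fin by (rule permutes_closed_iff) (simp add: S_def orbit.step)
  have redS: "orbit ?f x \<in> red_faces P \<Gamma>" if "x \<in> S" for x
    using less.prems(4) that by (simp add: S_def \<sigma>_def)
  have gg: "?g (?g x) = x" "?g x \<noteq> x" "?g x \<in> darts \<Gamma>" if "x \<in> S" for x
    using p(5,6) p(3) that SD by (auto simp: permutes_in_image)
  \<comment> \<open>A spoke with both ends at the centre would be a loop with red triangles on both
    sides.\<close>
  have noloop: "?g x \<notin> S" if x: "x \<in> S" for x
  proof
    assume g: "?g x \<in> S"
    have "orbit \<sigma> x = S" "orbit \<sigma> (?g x) = S"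
      using orbit_mem_eq[OF p(2) \<sigma>] x g unfolding S_def by blast+
    then have "src \<Gamma> (?g x) = src \<Gamma> x"
      using p(8)[of "?g x" x] x SD gg(3)[OF x] by (auto simp: \<sigma>_def)
    then obtain \<Delta> where "coloured_diagram P \<R> \<Delta>" "has_V_loop P \<Delta>" "CArea P \<R> \<Delta> < CArea P \<R> \<Gamma>"
      using red_loop_shrinks[OF P col _ _ redS[OF x] redS[OF g]] x SD by blast
    then show False using less.prems(1) unfolding loop_minimal_def by (meson leD)
  qed
  \<comment> \<open>A rim edge starts where its spoke ends, which is away from the centre.\<close>
  have rim: "?f x \<notin> S" if "x \<in> S" for x
  proof
    assume "?f x \<in> S"
    then have "\<sigma> (?g x) \<in> S" using gg(1)[OF that] by (simp add: \<sigma>_def)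
    then show False using noloop[OF that] S\<sigma> by blast
  qed
  have tri: "?f (?f (\<sigma> x)) = ?g x" "?f (?g x) = \<sigma> x"
    "triangle P (lab \<Gamma> (\<sigma> x)) (lab \<Gamma> (?f (\<sigma> x))) (pinv P (lab \<Gamma> x))" if x: "x \<in> S" for x
  proof -
    have r: "orbit ?f (\<sigma> x) \<in> red_faces P \<Gamma>" using redS[of "\<sigma> x"] S\<sigma> x by blast
    note t = red_face[OF P pd r]
    show 1: "?f (?g x) = \<sigma> x" by (simp add: \<sigma>_def)
    have "?f (?f (?f (\<sigma> x))) = ?f (?g x)"
      using orbit_card_three(1)[OF self_in_orbit[OF p(2,4)] t(1)] unfolding 1 .
    then show 2: "?f (?f (\<sigma> x)) = ?g x" using permutes_inj[OF p(4)] by (simp add: inj_eq)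
    show "triangle P (lab \<Gamma> (\<sigma> x)) (lab \<Gamma> (?f (\<sigma> x))) (pinv P (lab \<Gamma> x))"
      using t(2) coloured_diagram_parts(3)[OF col] x SD unfolding 2 by auto
  qed
  have letter: "lab \<Gamma> x \<in> letters P" if "x \<in> S" for x
    using coloured_diagram_parts(2)[OF col] that SD by blast
  have ne: "\<sigma> d \<noteq> d"
    using triangle_spokes_distinct[OF P] tri(3)[OF dS] letter[OF dS] by metis
  have reduce: ?case
    \<comment> \<open>The triangle between two spokes reads \<open>\<sigma> x\<close>, rim edge,
      inverse of \<open>x\<close>; so the spokes \<open>e1\<close>, \<open>e2\<close>,
      \<open>e3\<close> of the locale are \<open>\<sigma> (\<sigma> x)\<close>,
      \<open>\<sigma> x\<close>, \<open>x\<close>.\<close>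
    if x: "x \<in> S" "\<sigma> x \<noteq> x" and D: "(lab \<Gamma> (?f (\<sigma> (\<sigma> x))), lab \<Gamma> (?f (\<sigma> x))) \<in> pdom P" for x
  proof -
    define e2 where "e2 = \<sigma> x"
    define e1 where "e1 = \<sigma> e2"
    define a where "a = ?f e1"
    define b where "b = ?f e2"
    have e: "e1 \<in> S" "e2 \<in> S" using x(1) S\<sigma> unfolding e1_def e2_def by blast+
    have e12: "e1 \<noteq> e2" using x(2) inj unfolding e1_def e2_def by simp
    interpret adjacent_triangles P \<R> \<Gamma> e1 e2 x a b
    proof
      show "?f e1 = a" "?f e2 = b" by (simp_all add: a_def b_def)
      show "?f a = ?g e2" "?f (?g e2) = e1" using tri(1,2)[OF e(2)] by (simp_all add: a_def e1_def)
      show "?f b = ?g x" "?f (?g x) = e2" using tri(1,2)[OF x(1)] by (simp_all add: b_def e2_def)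
      show "e2 \<notin> {e1, a, ?g e2}" using e12 e rim[OF e(1)] gg(2)[OF e(2)] unfolding a_def by fastforce
      show "x \<noteq> a" "x \<noteq> b" using rim e x(1) unfolding a_def b_def by blast+
    qed (use P col e x(1) SD redS in auto)
    have ab: "(lab \<Gamma> a, lab \<Gamma> b) \<in> pdom P" using D by (simp add: a_def b_def e1_def e2_def)
    note lets = letter[OF e(1)] letter[OF e(2)] letter[OF x(1)]
    show ?case
    proof (cases "pmult P (lab \<Gamma> a) (lab \<Gamma> b) = pone P")
      case True
      then have "lab \<Gamma> b = pinv P (lab \<Gamma> a) \<and> lab \<Gamma> x = lab \<Gamma> e1"
        using triangle_flip(1)[OF P triangles ab] lets by blast
      then show ?thesis using collapse less.prems(2) by blast
    next
      case False
      \<comment> \<open>At degree two the rim labels would be inverse and their product 1, so a flip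
        takes place only at degree at least three.\<close>
      have e1x: "e1 \<noteq> x"
      proof
        assume "e1 = x"
        then have "lab \<Gamma> b = pinv P (lab \<Gamma> a)"
          using triangle_spokes_two[OF P triangles(1)] triangles(2) lets by blast
        then show False
          using False mult_inverse_letter[OF P] triangles(1) by (simp add: triangle_def)
      qed
      obtain \<Delta> where \<Delta>: "coloured_diagram P \<R> \<Delta>" "boundary_word P \<Delta> w" "CArea P \<R> \<Delta> \<le> CArea P \<R> \<Gamma>"
        "darts \<Delta> = darts \<Gamma>" "opp \<Delta> = ?g" "nxt \<Delta> = flip_nxt"
        "\<forall>d\<in>darts \<Gamma>. d \<in> U \<or> orbit (nxt \<Gamma>) d \<in> red_faces P \<Gamma> \<longrightarrow> orbit (nxt \<Delta>) d \<in> red_faces P \<Delta>"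
        using flip[OF PR ab False less.prems(2)] by blast
      let ?S = "orbit (nxt \<Delta> \<circ> opp \<Delta>) e1"
      \<comment> \<open>After the flip the rotation passes from \<open>x\<close> directly to
        \<open>e1\<close>, skipping \<open>e2\<close>. At the other spokes it is unchanged, since
        \<open>opp \<Gamma> z\<close> lies outside \<open>U\<close>.\<close>
      have S': "?S \<subseteq> S - {e2}"
      proof (rule orbit_subset_closed)
        show "e1 \<in> S - {e2}" using e e12 by blast
        fix z assume z: "z \<in> S - {e2}"
        show "(nxt \<Delta> \<circ> opp \<Delta>) z \<in> S - {e2}"
        proof (cases "z = x")
          case True
          then show ?thesis using e e12 \<Delta>(5,6) flip_nxt_simps(3) by simp
        next
          case False
          have zS: "z \<in> S" using z by blast
          have "?g z \<noteq> a"
          proof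
            assume "?g z = a"
            then have "\<sigma> z = ?g e2" using nxt1(2) by (simp add: \<sigma>_def)
            then show False using noloop[OF e(2)] S\<sigma>[of z] zS by simp
          qed
          moreover have "?g z \<noteq> b"
          proof
            assume "?g z = b"
            then have "\<sigma> z = ?g x" using nxt2(2) by (simp add: \<sigma>_def)
            then show False using noloop[OF x(1)] S\<sigma>[of z] zS by simp
          qed
          moreover have "?g z \<noteq> e1" "?g z \<noteq> e2" using noloop[OF zS] e by blast+
          moreover have "?g z \<noteq> ?g e2" "?g z \<noteq> ?g x" using opp_inj z False by simp_all
          ultimately have "(nxt \<Delta> \<circ> opp \<Delta>) z = \<sigma> z"
            using \<Delta>(5,6) flip_nxt_simps(7)[of "?g z"] by (simp add: \<sigma>_def)
          moreover have "\<sigma> z \<in> S" using zS S\<sigma> by blast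
          moreover have "\<sigma> z \<noteq> e2" using False inj unfolding e2_def by simp
          ultimately show ?thesis by simp
        qed
      qed
      have "?S \<subset> S" using S' e(2) by blast
      then have "card ?S < card S" using fin by (rule psubset_card_mono[rotated])
      moreover have "loop_minimal P \<R> \<Delta>" using less.prems(1) \<Delta>(1,3) by (rule loop_minimal_le)
      moreover have "orbit (nxt \<Delta>) z \<in> red_faces P \<Delta>" if "z \<in> ?S" for z
        using \<Delta>(7) S' that redS[of z] SD by blast
      moreover have "e1 \<in> darts \<Delta>" using e SD \<Delta>(4) by blast
      ultimately obtain \<Delta>' where "coloured_diagram P \<R> \<Delta>'" "boundary_word P \<Delta>' w"
        "CArea P \<R> \<Delta>' < CArea P \<R> \<Delta>"
        using less.hyps[OF _ _ \<Delta>(2)] unfolding S_def \<sigma>_def by blast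
      then show ?thesis using \<Delta>(3) order_less_le_trans by blast
    qed
  qed
  have S1: "\<sigma> d \<in> S" "\<sigma> (\<sigma> d) \<in> S" "\<sigma> (\<sigma> (\<sigma> d)) \<in> S" using S\<sigma> dS by blast+
  \<comment> \<open>Three consecutive triangles around the centre. At small degree some of them
    coincide, which (P5) allows.\<close>
  have "(lab \<Gamma> (?f (\<sigma> (\<sigma> (\<sigma> d)))), lab \<Gamma> (?f (\<sigma> (\<sigma> d)))) \<in> pdom P \<or>
    (lab \<Gamma> (?f (\<sigma> (\<sigma> d))), lab \<Gamma> (?f (\<sigma> d))) \<in> pdom P"
    using triangle_spokes_P5[OF P tri(3)[OF S1(2)] tri(3)[OF S1(1)] tri(3)[OF dS]] letter S1 by blast
  then show ?case
  proof
    assume "(lab \<Gamma> (?f (\<sigma> (\<sigma> (\<sigma> d)))), lab \<Gamma> (?f (\<sigma> (\<sigma> d)))) \<in> pdom P"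
    then show ?thesis using reduce[OF S1(1)] ne inj by blast
  next
    assume "(lab \<Gamma> (?f (\<sigma> (\<sigma> d))), lab \<Gamma> (?f (\<sigma> d))) \<in> pdom P"
    then show ?thesis using reduce[OF dS] ne by blast
  qed
qed

section \<open>Counting\<close>

lemma card_Union_faces:
  assumes "planar_diagram \<Gamma>" "\<F> \<subseteq> orbit (nxt \<Gamma>) ` darts \<Gamma>"
  shows "card (\<Union>\<F>) = sum card \<F>"
proof (rule card_Union_disjoint)
  note p = planar_diagram_parts(2,4)[OF assms(1)]
  show "pairwise disjnt \<F>"
  proof (rule pairwiseI)
    fix F F' assume "F \<in> \<F>" "F' \<in> \<F>" "F \<noteq> F'"
    moreover from this obtain d d' where "F = orbit (nxt \<Gamma>) d" "F' = orbit (nxt \<Gamma>) d'" using assms(2) by blast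
    ultimately show "disjnt F F'"
      using orbit_mem_eq[OF p] unfolding disjnt_iff by metis
  qed
  show "finite F" if "F \<in> \<F>" for F
  proof -
    have "F \<in> orbit (nxt \<Gamma>) ` darts \<Gamma>" using assms(2) that by (rule subsetD)
    then obtain d where "F = orbit (nxt \<Gamma>) d" by (rule imageE)
    then show ?thesis using finite_orbit[OF self_in_orbit[OF p]] by simp
  qed
qed

text \<open>Let s be the total length of the internal green faces. Counting darts by faces, 2E = n +
  s + 3(Area - |F_G|), and Euler's formula gives Area = 2V - 2 - n - s + 3|F_G|. As every vertex is
  a corner of a green face, V is at most n + s; with s at most r|F_G| the bound follows.\<close>

lemma area_bound:
  assumes PR: "pregroup_presentation P \<R>" and col: "coloured_diagram P \<R> \<Gamma>"
    and w: "boundary_word P \<Gamma> w" "length w \<ge> 1"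
    and \<delta>: "\<And>v. v \<in> verts \<Gamma> \<Longrightarrow> delta_G P \<R> v \<Gamma> \<ge> 1"
  shows "int (Area \<Gamma>) \<le> (3 + int (Max (length ` \<R>))) * int (card (green_faces P \<R> \<Gamma>)) + int (length w) - 2"
proof -
  have P: "is_pregroup P" and finR: "finite \<R>" using PR by (simp_all add: pregroup_presentation_def)
  note pd = coloured_diagram_parts(1)[OF col]
  note p = planar_diagram_parts[OF pd]
  let ?G = "green_faces P \<R> \<Gamma>" and ?I = "internal_faces \<Gamma>" and ?r = "Max (length ` \<R>)"
  let ?orb = "orbit (nxt \<Gamma>)"
  have ne: "darts \<Gamma> \<noteq> {}" using w by (auto simp: boundary_word_def)
  have GI: "?G \<subseteq> ?I" by (auto simp: green_faces_def)
  have fin: "finite ?I" "finite ?G" using finite_faces[OF pd] by blast+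
  have Iorb: "?I \<subseteq> ?orb ` darts \<Gamma>" by (auto simp: internal_faces_def)
  have oorb: "outer \<Gamma> \<in> ?orb ` darts \<Gamma>" using p(9) ne by blast
  have oI: "outer \<Gamma> \<notin> ?I" by (simp add: internal_faces_def)
  have all: "?orb ` darts \<Gamma> = insert (outer \<Gamma>) ?I" using oorb by (auto simp: internal_faces_def)
  have fw: "length (face_word \<Gamma> d) = card F" if "F \<in> ?orb ` darts \<Gamma>" "d \<in> F" for d F
  proof -
    from that(1) obtain e where "F = ?orb e" by (rule imageE)
    then have "?orb d = F" using orbit_mem_eq[OF p(2,4)] that(2) by blast
    then show ?thesis by (simp add: face_word_def)
  qed
  have n: "card (outer \<Gamma>) = length w"
    using w(1) ne fw[OF oorb] by (auto simp: boundary_word_def inv_word_def)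
  have Gr: "card F \<le> ?r" if "F \<in> ?G" for F
  proof -
    from that obtain d where d: "F \<in> ?I" "d \<in> F" "face_word \<Gamma> d \<in> sym_relators P \<R>"
      by (auto simp: green_faces_def)
    then have "length (face_word \<Gamma> d) \<in> length ` \<R>"
      by (auto simp: sym_relators_def inv_word_def)
    moreover have "length (face_word \<Gamma> d) = card F" using fw[of F d] d(1,2) Iorb by blast
    ultimately show ?thesis using finR by simp
  qed
  have R3: "card F = 3" if "F \<in> ?I - ?G" for F
  proof -
    have "F \<in> red_faces P \<Gamma>" using that coloured_diagram_parts(4)[OF col] by blast
    moreover have "F \<in> ?orb ` darts \<Gamma>" using that Iorb by blast
    then obtain d where "F = ?orb d" by (rule imageE)
    ultimately show ?thesis using red_face(1)[OF P pd] by blast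
  qed
  define s where "s = sum card ?G"
  \<comment> \<open>For empty \<R> the value of \<open>Max\<close> is unspecified, but then there
    are no green faces and both sides are 0.\<close>
  have s: "s \<le> ?r * card ?G" unfolding s_def using sum_bounded_above[of ?G card ?r] Gr by (simp add: mult.commute)
  have "\<Union>(?orb ` darts \<Gamma>) = darts \<Gamma>"
    using permutes_orbit_subset[OF p(4)] self_in_orbit[OF p(2,4)] by blast
  then have "card (darts \<Gamma>) = sum card (insert (outer \<Gamma>) ?I)"
    using card_Union_faces[OF pd, of "?orb ` darts \<Gamma>"] all by simp
  also have "\<dots> = length w + sum card ?I" using fin(1) oI n by simp
  also have "sum card ?I = s + sum card (?I - ?G)"
    unfolding s_def using sum.subset_diff[OF GI fin(1), of card] by simp
  also have "sum card (?I - ?G) = 3 * card (?I - ?G)" using R3 by simp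
  finally have N: "card (darts \<Gamma>) = length w + s + 3 * card (?I - ?G)" by simp
  have E: "card (darts \<Gamma>) = 2 * card (edges \<Gamma>)"
    unfolding edges_def using p(2,3,5,6) by (rule card_edges(2))
  have I: "card ?I = card ?G + card (?I - ?G)"
    using card_Diff_subset[OF fin(2) GI] card_mono[OF fin(1) GI] by simp
  \<comment> \<open>A green incidence at \<open>v\<close> is a dart leaving \<open>v\<close> on the
    external face or on an internal green one.\<close>
  have corners: "verts \<Gamma> \<subseteq> src \<Gamma> ` \<Union>(insert (outer \<Gamma>) ?G)"
  proof
    fix v assume v: "v \<in> verts \<Gamma>"
    have "card {d \<in> darts \<Gamma>. src \<Gamma> d = v \<and> ?orb d \<in> insert (outer \<Gamma>) ?G} \<noteq> 0"
      using \<delta>[OF v] ne by (simp add: delta_G_def)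
    then have "{d \<in> darts \<Gamma>. src \<Gamma> d = v \<and> ?orb d \<in> insert (outer \<Gamma>) ?G} \<noteq> {}"
      by (rule contrapos_nn) (simp only: card.empty)
    then obtain d where d: "src \<Gamma> d = v" "?orb d \<in> insert (outer \<Gamma>) ?G"
      by blast
    have "d \<in> ?orb d" using p(2,4) by (rule self_in_orbit)
    then show "v \<in> src \<Gamma> ` \<Union>(insert (outer \<Gamma>) ?G)" using d by blast
  qed
  have "\<Union>(insert (outer \<Gamma>) ?G) \<subseteq> darts \<Gamma>"
    using permutes_orbit_subset[OF p(4)] oorb GI Iorb by blast
  then have "finite (\<Union>(insert (outer \<Gamma>) ?G))" using p(2) by (rule finite_subset)
  then have "card (verts \<Gamma>) \<le> card (\<Union>(insert (outer \<Gamma>) ?G))"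
    using corners by (rule surj_card_le)
  also have "\<dots> = sum card (insert (outer \<Gamma>) ?G)"
    using oorb GI Iorb by (intro card_Union_faces[OF pd]) blast
  also have "\<dots> = length w + s" using fin(2) oI GI n by (subst sum.insert) (auto simp: s_def)
  finally have V: "card (verts \<Gamma>) \<le> length w + s" .
  have "int (card ?I) \<le> int s + int (length w) + 3 * int (card ?G) - 2"
    using V p(11) N E I by linarith
  moreover have "int s \<le> int ?r * int (card ?G)" using s by (metis of_nat_le_iff of_nat_mult)
  ultimately show ?thesis unfolding Area_def by (simp add: algebra_simps)
qed

theorem proposition3p17:
  fixes P :: "'a pregroup" and \<R> :: "'a list set" and \<Gamma> :: "'a diagram"
    and w :: "'a list" and n r :: nat
  assumes "pregroup_presentation P \<R>"
    and "loop_minimal P \<R> \<Gamma>"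
    and "boundary_word P \<Gamma> w"
    and "cyclically_P_reduced P w"
    and "n = length w" and "n \<ge> 1"
    and "r = Max (length ` \<R>)"
  shows "(\<exists>\<Delta>. loop_minimal P \<R> \<Delta> \<and> boundary_word P \<Delta> w \<and>
            int (Area \<Delta>) \<le> (3 + int r) * int (card (green_faces P \<R> \<Delta>)) + int n - 2) \<and>
         ((\<forall>v \<in> verts \<Gamma>. delta_G P \<R> v \<Gamma> \<ge> 1) \<longrightarrow>
            int (Area \<Gamma>) \<le> (3 + int r) * int (card (green_faces P \<R> \<Gamma>)) + int n - 2)"
proof
  have bound: "int (Area \<Delta>) \<le> (3 + int r) * int (card (green_faces P \<R> \<Delta>)) + int n - 2"
    if "loop_minimal P \<R> \<Delta>" "boundary_word P \<Delta> w" "\<And>v. v \<in> verts \<Delta> \<Longrightarrow> delta_G P \<R> v \<Delta> \<ge> 1" for \<Delta>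
    using area_bound[OF assms(1) _ that(2) _ that(3)] that(1) assms(5-7) by (simp add: loop_minimal_def)
  show "(\<forall>v \<in> verts \<Gamma>. delta_G P \<R> v \<Gamma> \<ge> 1) \<longrightarrow>
      int (Area \<Gamma>) \<le> (3 + int r) * int (card (green_faces P \<R> \<Gamma>)) + int n - 2"
    using bound[OF assms(2,3)] by blast
  define Q where "Q c \<longleftrightarrow> (\<exists>\<Delta>. loop_minimal P \<R> \<Delta> \<and> boundary_word P \<Delta> w \<and> CArea P \<R> \<Delta> = c)" for c
  have "Q (CArea P \<R> \<Gamma>)" using assms(2,3) by (auto simp: Q_def)
  \<comment> \<open>The lexicographic order on pairs of natural numbers is a well-order, so a least
    coloured area is attained.\<close>
  then have "Q (LEAST c. Q c)" by (rule LeastI)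
  then obtain \<Delta> where \<Delta>: "loop_minimal P \<R> \<Delta>" "boundary_word P \<Delta> w" "CArea P \<R> \<Delta> = (LEAST c. Q c)"
    by (auto simp: Q_def)
  have col: "coloured_diagram P \<R> \<Delta>" using \<Delta>(1) by (simp add: loop_minimal_def)
  note pd = coloured_diagram_parts(1)[OF col]
  note p = planar_diagram_parts[OF pd]
  have ne: "darts \<Delta> \<noteq> {}" using \<Delta>(2) assms(5,6) by (auto simp: boundary_word_def)
  have "delta_G P \<R> v \<Delta> \<ge> 1" if v: "v \<in> verts \<Delta>" for v
  proof (rule ccontr)
    let ?\<sigma> = "nxt \<Delta> \<circ> opp \<Delta>"
    assume "\<not> delta_G P \<R> v \<Delta> \<ge> 1"
    then have "card {d \<in> darts \<Delta>. src \<Delta> d = v \<and>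
        orbit (nxt \<Delta>) d \<in> insert (outer \<Delta>) (green_faces P \<R> \<Delta>)} = 0"
      using ne by (simp add: delta_G_def)
    then have empty: "{d \<in> darts \<Delta>. src \<Delta> d = v \<and>
        orbit (nxt \<Delta>) d \<in> insert (outer \<Delta>) (green_faces P \<R> \<Delta>)} = {}"
      using p(2) by (subst (asm) card_0_eq) simp_all
    obtain d where d: "d \<in> darts \<Delta>" "v = src \<Delta> d"
      using v planar_diagram_verts[OF pd ne] by blast
    have "orbit (nxt \<Delta>) x \<in> red_faces P \<Delta>" if x: "x \<in> orbit ?\<sigma> d" for x
    proof -
      have xD: "x \<in> darts \<Delta>"
        using permutes_orbit_subset[OF permutes_compose[OF p(3,4)] d(1)] x by blast
      then have "src \<Delta> x = v" using p(8)[OF d(1) xD] x d(2) by simp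
      then have "orbit (nxt \<Delta>) x \<noteq> outer \<Delta>" "orbit (nxt \<Delta>) x \<notin> green_faces P \<R> \<Delta>"
        using empty xD by blast+
      moreover from this(1) have "orbit (nxt \<Delta>) x \<in> internal_faces \<Delta>"
        using xD by (simp add: internal_faces_def)
      ultimately show ?thesis using coloured_diagram_parts(4)[OF col] by blast
    qed
    then obtain \<Delta>' where \<Delta>': "coloured_diagram P \<R> \<Delta>'" "boundary_word P \<Delta>' w" "CArea P \<R> \<Delta>' < CArea P \<R> \<Delta>"
      using red_star_reducible[OF assms(1) \<Delta>(1,2) d(1)] by blast
    have "loop_minimal P \<R> \<Delta>'" using \<Delta>(1) \<Delta>'(1) order_less_imp_le[OF \<Delta>'(3)] by (rule loop_minimal_le)
    then have "Q (CArea P \<R> \<Delta>')" using \<Delta>'(2) by (auto simp: Q_def)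
    then show False using not_less_Least[of "CArea P \<R> \<Delta>'" Q] \<Delta>'(3) \<Delta>(3) by simp
  qed
  then show "\<exists>\<Delta>. loop_minimal P \<R> \<Delta> \<and> boundary_word P \<Delta> w \<and>
      int (Area \<Delta>) \<le> (3 + int r) * int (card (green_faces P \<R> \<Delta>)) + int n - 2"
    using bound \<Delta>(1,2) by blast
qed

end
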